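(* There exist positive constants $C_1, C_2$ depending only on the domain $\mathcal{D}$, with $C_1^2C_2\ge 1$, such that the following holds. Let $\Delta t>0$, $T=M\Delta t$ with $M\in\mathbb{N}$, $\gamma>0$, let $\boldsymbol{f}_j\in L^\infty(0,T;\boldsymbol{H}^{-1}(\mathcal{D}))$ and $\hat{\boldsymbol{u}}_{j,h}^0\in\boldsymbol{V}_h$ for $j=1,\dots,J$, and let $(\hat{\boldsymbol{u}}_{j,h}^{n+1},\hat p_{j,h}^{n+1})$, $n=0,\dots,M-1$, $j=1,\dots,J$, be the solution of the SPP-EEV scheme (defined in the context) with eddy-viscosity parameter $\mu>0$. Suppose that, for all $j$ and $n$, $\alpha_j>C_1\|\nabla\cdot\hat{\boldsymbol{u}}_{j,h}^{'n}\|_{L^\infty}$ and $$\mu\ \ge\ \frac{\alpha_j}{\Delta t\left(C_2\alpha_j^2-\|\nabla\cdot\hat{\boldsymbol{u}}_{j,h}^{'n}\|_{L^\infty}^2\right)}.$$ Then for every $j=1,\dots,J$, $$\|\hat{\boldsymbol{u}}_{j,h}^{M}\|^2+\bar{\nu}_{\min}\Delta t\|\nabla\hat{\boldsymbol{u}}_{j,h}^M\|^2+2\gamma\Delta t\sum_{n=1}^{M}\|\nabla\cdot\hat{\boldsymbol{u}}_{j,h}^{n}\|^2\le\|\hat{\boldsymbol{u}}_{j,h}^0\|^2+\bar{\nu}_{\min}\Delta t\|\nabla \hat{\boldsymbol{u}}_{j,h}^{0}\|^2+\frac{2\Delta t}{\alpha_j}\sum_{n=1}^{M}\|\boldsymbol{f}_{j}(t^{n})\|_{-1}^2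 .$$
   Context: Setting. $\mathcal{D}\subset\mathbb{R}^d$ ($d=2,3$) is a convex polygon or polyhedron; $\|\cdot\|$ and $(\cdot,\cdot)$ are the $L^2(\mathcal{D})$ norm and inner product; $\|\cdot\|_{-1}$ is the norm of $\boldsymbol{H}^{-1}(\mathcal{D})$ dual to $\|\nabla\cdot\|$ on $\boldsymbol{H}_0^1(\mathcal{D})$; $|\cdot|$ is the Euclidean norm of a vector. $\boldsymbol{X}=\boldsymbol{H}_0^1(\mathcal{D})=(H_0^1(\mathcal{D}))^d$, $\boldsymbol{Y}=\{\boldsymbol{v}\in (L^2(\mathcal{D}))^d:\nabla\cdot\boldsymbol{v}\in L^2(\mathcal{D}),\ \boldsymbol{v}\cdot\hat{\boldsymbol{n}}|_{\partial\mathcal{D}}=0\}$ ($\hat{\boldsymbol n}$ the outward unit normal), $Q=L_0^2(\mathcal{D})$ (mean-zero $L^2$ functions). $\boldsymbol{X}_h\subset\boldsymbol{X}$, $Q_h\subset Q$, $\boldsymbol{Y}_h\subset\boldsymbol{Y}$ are conforming finite element spaces on a regular triangulation of maximum diameter $h$, with $\boldsymbol{X}_h\subset\boldsymbol{Y}_h$, for which inverse inequalities hold, and $(\boldsymbol{X}_h,Q_h)$ satisfies the inf-sup condition $\inf_{q_h\in Q_h}\sup_{\boldsymbol{v}_h\in\boldsymbol{X}_h}\frac{(q_h,\nabla\cdot\boldsymbol{v}_h)}{\|q_h\|\|\nabla\boldsymbol{v}_h\|}\ge\beta>0$ with $\beta$ independent of $h$. $\boldsymbol{V}_h=\{\boldsymbol{v}_h\in\boldsymbol{X}_h:(\nabla\cdot\boldsymbol{v}_h,q_h)=0\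 \forall q_h\in Q_h\}$. The skew-symmetric trilinear form is $b^*(\boldsymbol{u},\boldsymbol{v},\boldsymbol{w})=\frac12(\boldsymbol{u}\cdot\nabla\boldsymbol{v},\boldsymbol{w})-\frac12(\boldsymbol{u}\cdot\nabla\boldsymbol{w},\boldsymbol{v})$. Viscosities. For $j=1,\dots,J$, $\nu_j\in L^\infty(\mathcal{D})$ with $\nu_j(\boldsymbol{x})\ge\nu_{j,\min}>0$. Set $\bar\nu=\frac1J\sum_{j=1}^J\nu_j$, $\nu_j'=\nu_j-\bar\nu$, $\bar\nu_{\min}=\min_{\boldsymbol{x}\in\mathcal{D}}\bar\nu(\boldsymbol{x})$, $\alpha_j=\bar\nu_{\min}-\|\nu_j'\|_{\infty}$, and assume $\alpha_j>0$ for all $j$. Ensemble notation. For a family $(\hat{\boldsymbol{u}}^n_{j,h})_{j=1}^J$: $\langle\hat{\boldsymbol{u}}_h\rangle^n=\frac1J\sum_{j=1}^J\hat{\boldsymbol{u}}_{j,h}^n$, $\hat{\boldsymbol{u}}_{j,h}^{'n}=\hat{\boldsymbol{u}}_{j,h}^n-\langle\hat{\boldsymbol{u}}_h\rangle^n$, and the ensemble eddy viscosity is $\nu_T(\hat{\boldsymbol{u}}_h',t^n)=\mu\Delta t\sum_{j=1}^J|\hat{\boldsymbol{u}}_{j,h}^{'n}|^2$, with $t^n=n\Delta t$. SPP-EEV scheme. Start from $\hat{\boldsymbol{u}}_{j,h}^0=\tilde{\boldsymbol{u}}_{j,h}^0$. For $n=0,\dots,M-1$ and each $j$: Step 1: find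 $\hat{\boldsymbol{u}}_{j,h}^{n+1}\in\boldsymbol{X}_h$ such that for all $\boldsymbol{\chi}_h\in\boldsymbol{X}_h$ $$\Big(\tfrac{\hat{\boldsymbol{u}}_{j,h}^{n+1}-\tilde{\boldsymbol{u}}_{j,h}^n}{\Delta t},\boldsymbol{\chi}_h\Big)+b^*(\langle\hat{\boldsymbol{u}}_h\rangle^n,\hat{\boldsymbol{u}}_{j,h}^{n+1},\boldsymbol{\chi}_h)+(\bar\nu\nabla\hat{\boldsymbol{u}}_{j,h}^{n+1},\nabla\boldsymbol{\chi}_h)+\gamma(\nabla\cdot\hat{\boldsymbol{u}}_{j,h}^{n+1},\nabla\cdot\boldsymbol{\chi}_h)+(2\nu_T(\hat{\boldsymbol{u}}_h',t^n)\nabla\hat{\boldsymbol{u}}_{j,h}^{n+1},\nabla\boldsymbol{\chi}_h)$$ $$=(\boldsymbol{f}_j(t^{n+1}),\boldsymbol{\chi}_h)-b^*(\hat{\boldsymbol{u}}_{j,h}^{'n},\hat{\boldsymbol{u}}_{j,h}^n,\boldsymbol{\chi}_h)-(\nu_j'\nabla\hat{\boldsymbol{u}}_{j,h}^n,\nabla\boldsymbol{\chi}_h).$$ Step 2: find $(\tilde{\boldsymbol{u}}_{j,h}^{n+1},\hat p_{j,h}^{n+1})\in\boldsymbol{Y}_h\times Q_h$ such that for all $(\boldsymbol{v}_h,q_h)\in\boldsymbol{Y}_h\times Q_h$ $$\Big(\tfrac{\tilde{\boldsymbol{u}}_{j,h}^{n+1}-\hat{\boldsymbol{u}}_{j,h}^{n+1}}{\Delta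 t},\boldsymbol{v}_h\Big)-(\hat p_{j,h}^{n+1},\nabla\cdot\boldsymbol{v}_h)=0,\qquad(\nabla\cdot\tilde{\boldsymbol{u}}_{j,h}^{n+1},q_h)=0.$$ *)

theory Defs
  imports "HOL-Analysis.Analysis" "HOL-Probability.Essential_Supremum"
begin

text \<open>
  Elements of Lebesgue and Sobolev spaces on a domain \<^term>\<open>D\<close> are represented by total functions
  on \<^typ>\<open>real^'n\<close>. Only their restriction to \<^term>\<open>D\<close>, up to null sets, is relevant.
\<close>

section \<open>Lebesgue spaces\<close>

definition L2_space :: "(real^'n) set \<Rightarrow> (real^'n \<Rightarrow> 'b::euclidean_space) set" where
  "L2_space D = {f \<in> borel_measurable (lebesgue_on D). integrable (lebesgue_on D) (\<lambda>x. (norm (f x))\<^sup>2)}"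

text \<open>On matrix-valued functions this is the \<open>L\<^sup>2\<close> product built on the Frobenius product.\<close>

definition l2_inner :: "(real^'n) set \<Rightarrow> (real^'n \<Rightarrow> 'b::euclidean_space) \<Rightarrow> (real^'n \<Rightarrow> 'b) \<Rightarrow> real" where
  "l2_inner D f g = (\<integral>x. f x \<bullet> g x \<partial>(lebesgue_on D))"

definition l2_norm :: "(real^'n) set \<Rightarrow> (real^'n \<Rightarrow> 'b::euclidean_space) \<Rightarrow> real" where
  "l2_norm D f = sqrt (l2_inner D f f)"

definition Linf_space :: "(real^'n) set \<Rightarrow> (real^'n \<Rightarrow> 'b::euclidean_space) set" where
  "Linf_space D = {f \<in> borel_measurable (lebesgue_on D).
     esssup (lebesgue_on D) (\<lambda>x. ereal (norm (f x))) < \<infinity>}"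

definition linf_norm :: "(real^'n) set \<Rightarrow> (real^'n \<Rightarrow> 'b::euclidean_space) \<Rightarrow> real" where
  "linf_norm D f = real_of_ereal (esssup (lebesgue_on D) (\<lambda>x. ereal (norm (f x))))"

definition ess_inf :: "(real^'n) set \<Rightarrow> (real^'n \<Rightarrow> real) \<Rightarrow> real" where
  "ess_inf D f = real_of_ereal (- esssup (lebesgue_on D) (\<lambda>x. - ereal (f x)))"

section \<open>Test functions, weak derivatives and Sobolev spaces\<close>

definition pgrad :: "(real^'n \<Rightarrow> real) \<Rightarrow> real^'n \<Rightarrow> real^'n" where
  "pgrad \<phi> x = (\<chi> i. frechet_derivative \<phi> (at x) (axis i 1))"

primrec times_differentiable :: "nat \<Rightarrow> (real^'n \<Rightarrow> real) \<Rightarrow> bool" where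
  "times_differentiable 0 \<phi> \<longleftrightarrow> continuous_on UNIV \<phi>"
| "times_differentiable (Suc k) \<phi> \<longleftrightarrow>
     (\<forall>x. \<phi> differentiable (at x)) \<and> (\<forall>i. times_differentiable k (\<lambda>x. pgrad \<phi> x $ i))"

definition test_functions :: "(real^'n) set \<Rightarrow> (real^'n \<Rightarrow> real) set" where
  "test_functions D = {\<phi>. (\<forall>k. times_differentiable k \<phi>) \<and>
     compact (closure {x. \<phi> x \<noteq> 0}) \<and> closure {x. \<phi> x \<noteq> 0} \<subseteq> D}"

definition has_weak_grad :: "(real^'n) set \<Rightarrow> (real^'n \<Rightarrow> real) \<Rightarrow> (real^'n \<Rightarrow> real^'n) \<Rightarrow> bool" where
  "has_weak_grad D u g \<longleftrightarrow> u \<in> L2_space D \<and> g \<in> L2_space D \<and>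
     (\<forall>\<phi>\<in>test_functions D. \<forall>i.
        (\<integral>x. u x * pgrad \<phi> x $ i \<partial>(lebesgue_on D)) = - (\<integral>x. g x $ i * \<phi> x \<partial>(lebesgue_on D)))"

definition has_weak_div :: "(real^'n) set \<Rightarrow> (real^'n \<Rightarrow> real^'n) \<Rightarrow> (real^'n \<Rightarrow> real) \<Rightarrow> bool" where
  "has_weak_div D v g \<longleftrightarrow> v \<in> L2_space D \<and> g \<in> L2_space D \<and>
     (\<forall>\<phi>\<in>test_functions D.
        (\<integral>x. v x \<bullet> pgrad \<phi> x \<partial>(lebesgue_on D)) = - (\<integral>x. g x * \<phi> x \<partial>(lebesgue_on D)))"

text \<open>
  Weak derivatives are unique only almost everywhere, hence the choice operator; every quantity
  formed from them below is insensitive to changes on null sets.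
\<close>

definition wgrad :: "(real^'n) set \<Rightarrow> (real^'n \<Rightarrow> real) \<Rightarrow> real^'n \<Rightarrow> real^'n" where
  "wgrad D u = (SOME g. has_weak_grad D u g)"

definition wdiv :: "(real^'n) set \<Rightarrow> (real^'n \<Rightarrow> real^'n) \<Rightarrow> real^'n \<Rightarrow> real" where
  "wdiv D v = (SOME g. has_weak_div D v g)"

text \<open>Row \<open>i\<close> of \<open>grad D v x\<close> is the gradient of the \<open>i\<close>-th component of \<open>v\<close>.\<close>

definition grad :: "(real^'n) set \<Rightarrow> (real^'n \<Rightarrow> real^'n) \<Rightarrow> real^'n \<Rightarrow> real^'n^'n" where
  "grad D v x = (\<chi> i. wgrad D (\<lambda>y. v y $ i) x)"

definition H1_space :: "(real^'n) set \<Rightarrow> (real^'n \<Rightarrow> real) set" where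
  "H1_space D = {u. \<exists>g. has_weak_grad D u g}"

definition H10_scalar :: "(real^'n) set \<Rightarrow> (real^'n \<Rightarrow> real) set" where
  "H10_scalar D = {u \<in> H1_space D. \<exists>\<phi> :: nat \<Rightarrow> real^'n \<Rightarrow> real. (\<forall>k. \<phi> k \<in> test_functions D) \<and>
     (\<lambda>k. l2_norm D (\<lambda>x. \<phi> k x - u x)) \<longlonglongrightarrow> 0 \<and>
     (\<lambda>k. l2_norm D (\<lambda>x. pgrad (\<phi> k) x - wgrad D u x)) \<longlonglongrightarrow> 0}"

definition H10_space :: "(real^'n) set \<Rightarrow> (real^'n \<Rightarrow> real^'n) set" where
  "H10_space D = {v. \<forall>i. (\<lambda>x. v x $ i) \<in> H10_scalar D}"

text \<open>
  The normal trace of a field with square-integrable divergence is the functional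
  \<open>\<phi> \<mapsto> (v, \<nabla>\<phi>) + (\<nabla>\<cdot>v, \<phi>)\<close> on \<open>H\<^sup>1\<close> (Green's formula).
\<close>

definition normal_trace_zero :: "(real^'n) set \<Rightarrow> (real^'n \<Rightarrow> real^'n) \<Rightarrow> bool" where
  "normal_trace_zero D v \<longleftrightarrow>
     (\<forall>\<phi>\<in>H1_space D. l2_inner D v (wgrad D \<phi>) + l2_inner D (wdiv D v) \<phi> = 0)"

definition Y_space :: "(real^'n) set \<Rightarrow> (real^'n \<Rightarrow> real^'n) set" where
  "Y_space D = {v. (\<exists>g. has_weak_div D v g) \<and> normal_trace_zero D v}"

definition Q_space :: "(real^'n) set \<Rightarrow> (real^'n \<Rightarrow> real) set" where
  "Q_space D = {q \<in> L2_space D. (\<integral>x. q x \<partial>(lebesgue_on D)) = 0}"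

definition Hm1_space :: "(real^'n) set \<Rightarrow> ((real^'n \<Rightarrow> real^'n) \<Rightarrow> real) set" where
  "Hm1_space D = {F.
     (\<forall>u\<in>H10_space D. \<forall>v\<in>H10_space D. \<forall>a b. F (\<lambda>x. a *\<^sub>R u x + b *\<^sub>R v x) = a * F u + b * F v) \<and>
     (\<exists>K. \<forall>v\<in>H10_space D. \<bar>F v\<bar> \<le> K * l2_norm D (grad D v))}"

definition hm1_norm :: "(real^'n) set \<Rightarrow> ((real^'n \<Rightarrow> real^'n) \<Rightarrow> real) \<Rightarrow> real" where
  "hm1_norm D F = (SUP v \<in> {v \<in> H10_space D. l2_norm D (grad D v) \<noteq> 0}. \<bar>F v\<bar> / l2_norm D (grad D v))"

text \<open>Bochner measurability and essential boundedness on \<open>(0,T)\<close>.\<close>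

definition Linf_time_Hm1 :: "(real^'n) set \<Rightarrow> real \<Rightarrow> (real \<Rightarrow> (real^'n \<Rightarrow> real^'n) \<Rightarrow> real) set" where
  "Linf_time_Hm1 D T = {F.
     (AE t in lebesgue_on {0<..<T}. F t \<in> Hm1_space D) \<and>
     (\<exists>S. (\<forall>k::nat. simple_function (lebesgue_on {0<..<T}) (S k) \<and> S k ` {0<..<T} \<subseteq> Hm1_space D) \<and>
          (AE t in lebesgue_on {0<..<T}. (\<lambda>k. hm1_norm D (\<lambda>v. S k t v - F t v)) \<longlonglongrightarrow> 0)) \<and>
     (\<exists>K. AE t in lebesgue_on {0<..<T}. hm1_norm D (F t) \<le> K)}"

section \<open>Domain, triangulation and finite element spaces\<close>

definition convex_polytopal_domain :: "(real^'n) set \<Rightarrow> bool" where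
  "convex_polytopal_domain D \<longleftrightarrow> D \<noteq> {} \<and> open D \<and> convex D \<and> polytope (closure D)"

text \<open>
  Here \<open>h\<close> is the maximum diameter and \<open>\<sigma>\<close> bounds the ratio of the diameter of a cell to the
  radius of a ball inscribed in it.
\<close>

definition regular_triangulation :: "(real^'n) set \<Rightarrow> real \<Rightarrow> real \<Rightarrow> (real^'n) set set \<Rightarrow> bool" where
  "regular_triangulation D h \<sigma> \<T> \<longleftrightarrow>
     triangulation \<T> \<and> (\<forall>K\<in>\<T>. int CARD('n) simplex K) \<and> \<Union>\<T> = closure D \<and>
     h = Max (diameter ` \<T>) \<and>
     (\<forall>K\<in>\<T>. \<exists>x r. r > 0 \<and> cball x r \<subseteq> K \<and> diameter K \<le> \<sigma> * r)"

definition polynomial_le :: "nat \<Rightarrow> (real^'n \<Rightarrow> real) \<Rightarrow> bool" where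
  "polynomial_le k p \<longleftrightarrow> (\<exists>c :: ('n \<Rightarrow> nat) \<Rightarrow> real.
     \<forall>x. p x = (\<Sum>a | sum a UNIV \<le> k. c a * (\<Prod>i\<in>UNIV. x $ i ^ a i)))"

definition piecewise_polynomial :: "(real^'n) set set \<Rightarrow> nat \<Rightarrow> (real^'n \<Rightarrow> real) \<Rightarrow> bool" where
  "piecewise_polynomial \<T> k u \<longleftrightarrow>
     (\<forall>K\<in>\<T>. \<exists>p. polynomial_le k p \<and> (AE x in lebesgue_on K. u x = p x))"

definition function_subspace :: "(real^'n \<Rightarrow> 'b::real_vector) set \<Rightarrow> bool" where
  "function_subspace V \<longleftrightarrow> (\<lambda>x. 0) \<in> V \<and>
     (\<forall>u\<in>V. \<forall>v\<in>V. \<forall>a b. (\<lambda>x. a *\<^sub>R u x + b *\<^sub>R v x) \<in> V)"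

text \<open>Bounding the degree makes these spaces finite-dimensional modulo null sets.\<close>

definition fe_scalar_space :: "(real^'n) set set \<Rightarrow> (real^'n \<Rightarrow> real) set \<Rightarrow> bool" where
  "fe_scalar_space \<T> V \<longleftrightarrow> function_subspace V \<and> (\<exists>k. \<forall>q\<in>V. piecewise_polynomial \<T> k q)"

definition fe_vector_space :: "(real^'n) set set \<Rightarrow> (real^'n \<Rightarrow> real^'n) set \<Rightarrow> bool" where
  "fe_vector_space \<T> V \<longleftrightarrow> function_subspace V \<and>
     (\<exists>k. \<forall>v\<in>V. \<forall>i. piecewise_polynomial \<T> k (\<lambda>x. v x $ i))"

definition inverse_inequalities ::
  "(real^'n) set \<Rightarrow> real \<Rightarrow> real \<Rightarrow> (real^'n \<Rightarrow> real^'n) set \<Rightarrow> (real^'n \<Rightarrow> real^'n) set \<Rightarrow> bool" where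
  "inverse_inequalities D h c Xh Yh \<longleftrightarrow>
     (\<forall>v\<in>Xh. l2_norm D (grad D v) \<le> c * h powr (-1) * l2_norm D v) \<and>
     (\<forall>v\<in>Xh. linf_norm D v \<le> c * h powr (- real CARD('n) / 2) * l2_norm D v) \<and>
     (\<forall>v\<in>Yh. l2_norm D (wdiv D v) \<le> c * h powr (-1) * l2_norm D v)"

text \<open>Formed in the extended reals, so that the infimum over an empty set is \<open>\<infinity>\<close>.\<close>

definition inf_sup_condition ::
  "(real^'n) set \<Rightarrow> real \<Rightarrow> (real^'n \<Rightarrow> real^'n) set \<Rightarrow> (real^'n \<Rightarrow> real) set \<Rightarrow> bool" where
  "inf_sup_condition D \<beta> Xh Qh \<longleftrightarrow>
     (INF q \<in> {q \<in> Qh. l2_norm D q \<noteq> 0}. SUP v \<in> {v \<in> Xh. l2_norm D (grad D v) \<noteq> 0}.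
        ereal (l2_inner D q (wdiv D v) / (l2_norm D q * l2_norm D (grad D v)))) \<ge> ereal \<beta>"

definition fe_discretization ::
  "(real^'n) set \<Rightarrow> real \<Rightarrow> real \<Rightarrow> real \<Rightarrow> real \<Rightarrow> (real^'n) set set \<Rightarrow>
   (real^'n \<Rightarrow> real^'n) set \<Rightarrow> (real^'n \<Rightarrow> real^'n) set \<Rightarrow> (real^'n \<Rightarrow> real) set \<Rightarrow> bool" where
  "fe_discretization D h \<sigma> c \<beta> \<T> Xh Yh Qh \<longleftrightarrow>
     regular_triangulation D h \<sigma> \<T> \<and>
     fe_vector_space \<T> Xh \<and> fe_vector_space \<T> Yh \<and> fe_scalar_space \<T> Qh \<and>
     Xh \<subseteq> H10_space D \<and> Yh \<subseteq> Y_space D \<and> Qh \<subseteq> Q_space D \<and> Xh \<subseteq> Yh \<and>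
     inverse_inequalities D h c Xh Yh \<and> inf_sup_condition D \<beta> Xh Qh"

definition Vh_space ::
  "(real^'n) set \<Rightarrow> (real^'n \<Rightarrow> real^'n) set \<Rightarrow> (real^'n \<Rightarrow> real) set \<Rightarrow> (real^'n \<Rightarrow> real^'n) set" where
  "Vh_space D Xh Qh = {v \<in> Xh. \<forall>q\<in>Qh. l2_inner D (wdiv D v) q = 0}"

section \<open>Viscosities\<close>

definition nu_bar :: "nat \<Rightarrow> (nat \<Rightarrow> real^'n \<Rightarrow> real) \<Rightarrow> real^'n \<Rightarrow> real" where
  "nu_bar J \<nu> x = (1 / real J) * (\<Sum>j=1..J. \<nu> j x)"

definition nu_fluct :: "nat \<Rightarrow> (nat \<Rightarrow> real^'n \<Rightarrow> real) \<Rightarrow> nat \<Rightarrow> real^'n \<Rightarrow> real" where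
  "nu_fluct J \<nu> j x = \<nu> j x - nu_bar J \<nu> x"

definition nu_bar_min :: "(real^'n) set \<Rightarrow> nat \<Rightarrow> (nat \<Rightarrow> real^'n \<Rightarrow> real) \<Rightarrow> real" where
  "nu_bar_min D J \<nu> = ess_inf D (nu_bar J \<nu>)"

definition alpha :: "(real^'n) set \<Rightarrow> nat \<Rightarrow> (nat \<Rightarrow> real^'n \<Rightarrow> real) \<Rightarrow> nat \<Rightarrow> real" where
  "alpha D J \<nu> j = nu_bar_min D J \<nu> - linf_norm D (nu_fluct J \<nu> j)"

definition admissible_viscosities :: "(real^'n) set \<Rightarrow> nat \<Rightarrow> (nat \<Rightarrow> real^'n \<Rightarrow> real) \<Rightarrow> bool" where
  "admissible_viscosities D J \<nu> \<longleftrightarrow>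
     (\<forall>j\<in>{1..J}. \<nu> j \<in> Linf_space D \<and> (\<exists>\<nu>min>0. AE x in lebesgue_on D. \<nu> j x \<ge> \<nu>min) \<and>
        alpha D J \<nu> j > 0)"

section \<open>The SPP-EEV scheme\<close>

text \<open>\<open>u j n\<close> is the field of ensemble member \<open>j\<close> at time level \<open>n\<close>.\<close>

definition ens_mean :: "nat \<Rightarrow> (nat \<Rightarrow> nat \<Rightarrow> real^'n \<Rightarrow> real^'n) \<Rightarrow> nat \<Rightarrow> real^'n \<Rightarrow> real^'n" where
  "ens_mean J u n x = (1 / real J) *\<^sub>R (\<Sum>j=1..J. u j n x)"

definition ens_fluct ::
  "nat \<Rightarrow> (nat \<Rightarrow> nat \<Rightarrow> real^'n \<Rightarrow> real^'n) \<Rightarrow> nat \<Rightarrow> nat \<Rightarrow> real^'n \<Rightarrow> real^'n" where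
  "ens_fluct J u j n x = u j n x - ens_mean J u n x"

definition eddy_viscosity ::
  "nat \<Rightarrow> real \<Rightarrow> real \<Rightarrow> (nat \<Rightarrow> nat \<Rightarrow> real^'n \<Rightarrow> real^'n) \<Rightarrow> nat \<Rightarrow> real^'n \<Rightarrow> real" where
  "eddy_viscosity J \<mu> \<Delta>t u n x = \<mu> * \<Delta>t * (\<Sum>j=1..J. (norm (ens_fluct J u j n x))\<^sup>2)"

text \<open>\<open>convect D u v\<close> is \<open>u \<cdot> \<nabla>v\<close>, with components \<open>\<Sum>j. u\<^sub>j \<partial>\<^sub>j v\<^sub>i\<close>.\<close>

definition convect ::
  "(real^'n) set \<Rightarrow> (real^'n \<Rightarrow> real^'n) \<Rightarrow> (real^'n \<Rightarrow> real^'n) \<Rightarrow> real^'n \<Rightarrow> real^'n" where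
  "convect D u v x = grad D v x *v u x"

definition bstar ::
  "(real^'n) set \<Rightarrow> (real^'n \<Rightarrow> real^'n) \<Rightarrow> (real^'n \<Rightarrow> real^'n) \<Rightarrow> (real^'n \<Rightarrow> real^'n) \<Rightarrow> real" where
  "bstar D u v w = 1/2 * l2_inner D (convect D u v) w - 1/2 * l2_inner D (convect D u w) v"

text \<open>In both steps \<open>u\<close> and \<open>ut\<close> stand for the fields written with a hat and a tilde.\<close>

definition spp_eev_step1 ::
  "(real^'n) set \<Rightarrow> (real^'n \<Rightarrow> real^'n) set \<Rightarrow> nat \<Rightarrow> real \<Rightarrow> (nat \<Rightarrow> real^'n \<Rightarrow> real) \<Rightarrow> real \<Rightarrow> real \<Rightarrow>
   (nat \<Rightarrow> real \<Rightarrow> (real^'n \<Rightarrow> real^'n) \<Rightarrow> real) \<Rightarrow>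
   (nat \<Rightarrow> nat \<Rightarrow> real^'n \<Rightarrow> real^'n) \<Rightarrow> (nat \<Rightarrow> nat \<Rightarrow> real^'n \<Rightarrow> real^'n) \<Rightarrow> nat \<Rightarrow> nat \<Rightarrow> bool" where
  "spp_eev_step1 D Xh J \<Delta>t \<nu> \<gamma> \<mu> f u ut j n \<longleftrightarrow>
     u j (Suc n) \<in> Xh \<and>
     (\<forall>w\<in>Xh.
        l2_inner D (\<lambda>x. (u j (Suc n) x - ut j n x) /\<^sub>R \<Delta>t) w
        + bstar D (ens_mean J u n) (u j (Suc n)) w
        + l2_inner D (\<lambda>x. nu_bar J \<nu> x *\<^sub>R grad D (u j (Suc n)) x) (grad D w)
        + \<gamma> * l2_inner D (wdiv D (u j (Suc n))) (wdiv D w)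
        + l2_inner D (\<lambda>x. (2 * eddy_viscosity J \<mu> \<Delta>t u n x) *\<^sub>R grad D (u j (Suc n)) x) (grad D w)
        = f j (real (Suc n) * \<Delta>t) w
        - bstar D (ens_fluct J u j n) (u j n) w
        - l2_inner D (\<lambda>x. nu_fluct J \<nu> j x *\<^sub>R grad D (u j n) x) (grad D w))"

definition spp_eev_step2 ::
  "(real^'n) set \<Rightarrow> (real^'n \<Rightarrow> real^'n) set \<Rightarrow> (real^'n \<Rightarrow> real) set \<Rightarrow> real \<Rightarrow>
   (nat \<Rightarrow> nat \<Rightarrow> real^'n \<Rightarrow> real^'n) \<Rightarrow> (nat \<Rightarrow> nat \<Rightarrow> real^'n \<Rightarrow> real^'n) \<Rightarrow>
   (nat \<Rightarrow> nat \<Rightarrow> real^'n \<Rightarrow> real) \<Rightarrow> nat \<Rightarrow> nat \<Rightarrow> bool" where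
  "spp_eev_step2 D Yh Qh \<Delta>t u ut p j n \<longleftrightarrow>
     ut j (Suc n) \<in> Yh \<and> p j (Suc n) \<in> Qh \<and>
     (\<forall>v\<in>Yh. l2_inner D (\<lambda>x. (ut j (Suc n) x - u j (Suc n) x) /\<^sub>R \<Delta>t) v
               - l2_inner D (p j (Suc n)) (wdiv D v) = 0) \<and>
     (\<forall>q\<in>Qh. l2_inner D (wdiv D (ut j (Suc n))) q = 0)"

definition spp_eev_solution ::
  "(real^'n) set \<Rightarrow> (real^'n \<Rightarrow> real^'n) set \<Rightarrow> (real^'n \<Rightarrow> real^'n) set \<Rightarrow> (real^'n \<Rightarrow> real) set \<Rightarrow>
   nat \<Rightarrow> nat \<Rightarrow> real \<Rightarrow> (nat \<Rightarrow> real^'n \<Rightarrow> real) \<Rightarrow> real \<Rightarrow> real \<Rightarrow>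
   (nat \<Rightarrow> real \<Rightarrow> (real^'n \<Rightarrow> real^'n) \<Rightarrow> real) \<Rightarrow>
   (nat \<Rightarrow> nat \<Rightarrow> real^'n \<Rightarrow> real^'n) \<Rightarrow> (nat \<Rightarrow> nat \<Rightarrow> real^'n \<Rightarrow> real^'n) \<Rightarrow>
   (nat \<Rightarrow> nat \<Rightarrow> real^'n \<Rightarrow> real) \<Rightarrow> bool" where
  "spp_eev_solution D Xh Yh Qh J M \<Delta>t \<nu> \<gamma> \<mu> f u ut p \<longleftrightarrow>
     (\<forall>j\<in>{1..J}. ut j 0 = u j 0 \<and>
        (\<forall>n<M. spp_eev_step1 D Xh J \<Delta>t \<nu> \<gamma> \<mu> f u ut j n \<and> spp_eev_step2 D Yh Qh \<Delta>t u ut p j n))"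

end

theory Submission
  imports Defs
begin

text \<open>
  Testing Step 1 with the new iterate \<open>v\<close> leaves, besides the dissipation, only the fluctuation terms
  at the old iterate \<open>y\<close>. As the normal trace of the fluctuation \<open>u'\<close> vanishes,
  \<open>-b\<^sup>*(u', y, v) = (u' \<cdot> \<nabla>v, y) + (\<nabla>\<cdot>u' y, v)/2\<close>. The first term is absorbed by the eddy viscosity,
  which controls \<open>\<parallel>\<bar>u'\<bar> \<nabla>v\<parallel>\<close>, together with the Poincare inequality
  \<open>\<parallel>y\<parallel> \<le> P \<parallel>\<nabla>y\<parallel>\<close>; the second by the slack \<open>\<alpha>\<^sub>j\<close>, which gives \<open>C1 = P\<^sup>2\<close> and \<open>C2 = 2 / P\<^sup>2\<close>.
  Step 2 is an \<open>L\<^sup>2\<close>-contraction, so the one-step estimate can be summed.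

  The manipulations with weak derivatives rest on their uniqueness (the fundamental lemma of the
  calculus of variations) and on the product rule for bounded functions. Finite element functions
  are bounded, with bounded divergence, because they are piecewise polynomials.
\<close>

section \<open>Smooth functions and test functions\<close>

text \<open>Here P = 2R, where R \<ge> 1 bounds |x| on \<open>D\<close>, so C1 and C2 are fixed by
  the domain alone. The choice R \<ge> 1 gives C1^2 C2 = 2 P^2 \<ge> 1. It also settles the sign of
  the denominator in the bound on \<mu>: with d the sup norm of the divergence of the fluctuation,
  P^2 d < \<alpha> implies d^2 P^2 \<le> \<alpha>^2 < 2 \<alpha>^2, that is, d^2 < C2 \<alpha>^2.
  Only with a positive denominator does that bound say anything; it then yields \<mu> \<Delta>t
  \<ge> P^2 / (2 \<alpha>), which is the strength that the eddy viscosity must have.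

  After multiplication by 2 \<Delta>t the dissipation is 2 N \<Delta>t |grad v|^2 in the L2 sense,
  with N = \<open>nu_bar_min\<close>. Young's inequality splits every term with the old iterate y
  between grad v and grad y. The shares of grad v, together with that of the force, add up to N, and
  so do those of grad y. What survives is N \<Delta>t |grad v|^2 on the left against N \<Delta>t
  |grad y|^2 on the right, a pair that telescopes. This is why the gradient norm belongs to the
  energy and why its weight is \<open>nu_bar_min\<close> and not \<alpha>.\<close>

lemma pgrad_eq:
  assumes "(f has_derivative f') (at x)"
  shows "pgrad f x $ i = f' (axis i 1)"
  using frechet_derivative_at[OF assms] by (simp add: pgrad_def)

lemma has_derivative_pgrad:
  assumes "f differentiable (at x)"
  shows "(f has_derivative (\<lambda>h. pgrad f x \<bullet> h)) (at x)"
proof -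
  obtain f' where f': "(f has_derivative f') (at x)"
    using assms by (auto simp: differentiable_def)
  then have lin: "linear f'" by (rule has_derivative_linear)
  have "f' = (\<lambda>h. pgrad f x \<bullet> h)"
  proof
    fix h
    have "f' h = f' (\<Sum>i\<in>UNIV. h $ i *\<^sub>R axis i 1)"
      using basis_expansion[of h] by (simp add: scalar_mult_eq_scaleR)
    also have "\<dots> = (\<Sum>i\<in>UNIV. h $ i * f' (axis i 1))"
      by (simp add: linear_sum[OF lin] linear_scale[OF lin])
    also have "\<dots> = pgrad f x \<bullet> h"
      by (simp add: inner_vec_def pgrad_eq[OF f'] mult.commute)
    finally show "f' h = pgrad f x \<bullet> h" .
  qed
  with f' show ?thesis by simp
qed

lemma times_differentiable_mono:
  "times_differentiable (Suc k) f \<Longrightarrow> times_differentiable k f"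
proof (induction k arbitrary: f)
  case 0
  then show ?case
    by (auto simp: continuous_on_eq_continuous_at intro: differentiable_imp_continuous_within)
next
  case (Suc k)
  then show ?case by (metis times_differentiable.simps(2))
qed

section \<open>Closure properties of smooth functions\<close>

text \<open>The smoothness half of \<open>test_functions\<close>, split off because polynomials,
  coordinates and exponentials are smooth without compact support and enter as factors or in
  compositions.\<close>

definition smooth :: "(real^'n \<Rightarrow> real) \<Rightarrow> bool" where
  "smooth f \<longleftrightarrow> (\<forall>k. times_differentiable k f)"

lemma smooth_differentiable: "smooth f \<Longrightarrow> f differentiable (at x)"
  unfolding smooth_def by (metis times_differentiable.simps(2))

lemma smooth_pgrad: "smooth f \<Longrightarrow> smooth (\<lambda>x. pgrad f x $ i)"
  unfolding smooth_def by (metis times_differentiable.simps(2))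

lemma smooth_continuous: "smooth f \<Longrightarrow> continuous_on UNIV f"
  unfolding smooth_def by (metis times_differentiable.simps(1))

lemma smooth_continuous_pgrad:
  assumes "smooth f" shows "continuous_on UNIV (pgrad f)"
  using smooth_continuous[OF smooth_pgrad[OF assms]] continuous_on_vec_lambda[of UNIV "\<lambda>i x. pgrad f x $ i"]
  by simp

lemma pgrad_const [simp]: "pgrad (\<lambda>x. c) x = 0"
  by (simp add: vec_eq_iff pgrad_eq[OF has_derivative_const])

lemma pgrad_coord [simp]: "pgrad (\<lambda>x. x $ i) x = axis i 1"
proof -
  have "((\<lambda>x::real^'a. x $ i) has_derivative (\<lambda>h. h $ i)) (at x)"
    by (intro bounded_linear_imp_has_derivative bounded_linear_vec_nth)
  then show ?thesis
    by (simp add: vec_eq_iff pgrad_eq) (simp add: axis_def)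
qed

lemma pgrad_add:
  assumes "f differentiable (at x)" "g differentiable (at x)"
  shows "pgrad (\<lambda>x. f x + g x) x = pgrad f x + pgrad g x"
  by (simp add: vec_eq_iff inner_axis
      pgrad_eq[OF has_derivative_add[OF has_derivative_pgrad[OF assms(1)] has_derivative_pgrad[OF assms(2)]]])

lemma pgrad_mult:
  assumes "f differentiable (at x)" "g differentiable (at x)"
  shows "pgrad (\<lambda>x. f x * g x) x = f x *\<^sub>R pgrad g x + g x *\<^sub>R pgrad f x"
  by (simp add: vec_eq_iff inner_axis mult.commute
      pgrad_eq[OF has_derivative_mult[OF has_derivative_pgrad[OF assms(1)] has_derivative_pgrad[OF assms(2)]]])

lemma pgrad_comp:
  assumes "f differentiable (at x)" "(e has_real_derivative d) (at (f x))"
  shows "pgrad (\<lambda>x. e (f x)) x = d *\<^sub>R pgrad f x"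
proof -
  have "((\<lambda>x. e (f x)) has_derivative (\<lambda>h. d * (pgrad f x \<bullet> h))) (at x)"
    using has_derivative_compose[OF has_derivative_pgrad[OF assms(1)], of e "(*) d"] assms(2)
    by (simp add: has_field_derivative_def)
  then show ?thesis
    by (simp add: vec_eq_iff pgrad_eq inner_axis)
qed

lemma differentiable_comp:
  fixes f :: "real^'n \<Rightarrow> real"
  assumes "f differentiable (at x)" "(e has_real_derivative d) (at (f x))"
  shows "(\<lambda>x. e (f x)) differentiable (at x)"
  using has_derivative_compose[OF has_derivative_pgrad[OF assms(1)], of e "(*) d"] assms(2)
  by (auto simp: has_field_derivative_def differentiable_def)

lemma times_differentiable_const: "times_differentiable k (\<lambda>x. c)"
  by (induction k arbitrary: c) auto

lemma smooth_const: "smooth (\<lambda>x. c)"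
  by (simp add: smooth_def times_differentiable_const)

lemma smooth_coord: "smooth (\<lambda>x. x $ i)"
  unfolding smooth_def
proof
  fix k show "times_differentiable k (\<lambda>x. x $ i)"
    by (cases k) (auto intro!: continuous_intros simp: axis_def times_differentiable_const
        bounded_linear_imp_differentiable bounded_linear_vec_nth)
qed

lemma times_differentiable_add:
  "times_differentiable k f \<Longrightarrow> times_differentiable k g \<Longrightarrow> times_differentiable k (\<lambda>x. f x + g x)"
proof (induction k arbitrary: f g)
  case 0 then show ?case by (auto intro!: continuous_intros)
next
  case (Suc k)
  then show ?case by (simp add: pgrad_add)
qed

lemma smooth_add: "smooth f \<Longrightarrow> smooth g \<Longrightarrow> smooth (\<lambda>x. f x + g x)"
  by (simp add: smooth_def times_differentiable_add)

text \<open>The gradient of a product contains f and g undifferentiated, so the induction step needs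
  them at order k as well as at order k + 1.\<close>

lemma times_differentiable_mult:
  "times_differentiable k f \<Longrightarrow> times_differentiable k g \<Longrightarrow> times_differentiable k (\<lambda>x. f x * g x)"
proof (induction k arbitrary: f g)
  case 0 then show ?case by (auto intro!: continuous_intros)
next
  case (Suc k)
  have "times_differentiable k f" "times_differentiable k g"
    using Suc.prems times_differentiable_mono by auto
  then show ?case using Suc by (simp add: pgrad_mult times_differentiable_add)
qed

lemma smooth_mult: "smooth f \<Longrightarrow> smooth g \<Longrightarrow> smooth (\<lambda>x. f x * g x)"
  by (simp add: smooth_def times_differentiable_mult)

lemma smooth_sum: "(\<And>i. i \<in> I \<Longrightarrow> smooth (f i)) \<Longrightarrow> smooth (\<lambda>x. \<Sum>i\<in>I. f i x)"
  by (induction I rule: infinite_finite_induct) (auto simp: smooth_const smooth_add)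

lemma smooth_prod: "(\<And>i. i \<in> I \<Longrightarrow> smooth (f i)) \<Longrightarrow> smooth (\<lambda>x. \<Prod>i\<in>I. f i x)"
  by (induction I rule: infinite_finite_induct) (auto simp: smooth_const smooth_mult)

lemma smooth_power: "smooth f \<Longrightarrow> smooth (\<lambda>x. f x ^ k)"
  by (induction k) (auto simp: smooth_const smooth_mult)

lemma smooth_polynomial:
  assumes "polynomial_le k p" shows "smooth p"
proof -
  obtain c :: "('a \<Rightarrow> nat) \<Rightarrow> real" where
    "\<forall>x. p x = (\<Sum>a | sum a UNIV \<le> k. c a * (\<Prod>i\<in>UNIV. x $ i ^ a i))"
    using assms unfolding polynomial_le_def by blast
  then have "p = (\<lambda>x. \<Sum>a | sum a UNIV \<le> k. c a * (\<Prod>i\<in>UNIV. x $ i ^ a i))" by auto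
  then show ?thesis
    by (simp add: smooth_sum smooth_mult smooth_const smooth_prod smooth_power smooth_coord)
qed

lemma times_differentiable_exp:
  "times_differentiable k f \<Longrightarrow> times_differentiable k (\<lambda>x. exp (f x))"
proof (induction k)
  case 0 then show ?case by (auto intro!: continuous_intros)
next
  case (Suc k)
  then have "times_differentiable k f" using times_differentiable_mono by blast
  with Suc show ?case
    by (auto simp: pgrad_comp[OF _ DERIV_exp] intro!: differentiable_comp[OF _ DERIV_exp] times_differentiable_mult)
qed

lemma smooth_exp: "smooth f \<Longrightarrow> smooth (\<lambda>x. exp (f x))"
  by (simp add: smooth_def times_differentiable_exp)

text \<open>Allowing every power of \<open>t\<close> in the denominator closes the family under differentiation.\<close>

definition flat :: "nat \<Rightarrow> real \<Rightarrow> real" where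
  "flat m t = (if t > 0 then exp (- 1 / t) / t ^ m else 0)"

text \<open>The substitution s = 1/t turns the limit into that of s^m / exp s at infinity.\<close>

lemma flat_tendsto_0: "((\<lambda>t. exp (- 1 / t) / t ^ m) \<longlongrightarrow> 0) (at_right (0::real))"
proof -
  have "((\<lambda>s::real. s ^ m / exp s) \<longlongrightarrow> 0) at_top"
    by (rule tendsto_power_div_exp_0)
  then have "((\<lambda>t. (inverse t) ^ m / exp (inverse t)) \<longlongrightarrow> 0) (at_right (0::real))"
    by (rule filterlim_compose[OF _ filterlim_inverse_at_top_right])
  then show ?thesis
    by (rule Lim_transform_eventually)
       (auto simp: eventually_at_filter field_simps exp_minus)
qed

text \<open>For t > 0 this is the quotient rule. At 0 the right difference quotient of
  \<open>flat m\<close> is again exp(-1/t) / t^k, now with k = m + 1, so the preceding limit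
  applies; both terms of the formula are 0 for t \<le> 0.\<close>

lemma flat_has_derivative:
  "(flat m has_real_derivative (flat (m + 2) t - m * flat (m + 1) t)) (at t)"
proof -
  consider "t < 0" | "t = 0" | "t > 0" by linarith
  then show ?thesis
  proof cases
    case 1
    have "(flat m has_real_derivative 0) (at t)"
      by (rule DERIV_cong_ev[THEN iffD2, OF refl _ refl, of _ "\<lambda>_. 0"])
         (use 1 in \<open>auto simp: flat_def eventually_at_topological intro!: eventually_mono[OF order_tendstoD(2)[OF tendsto_ident_at 1]] exI[of _ "{..<0}"] eventually_nhds[THEN iffD2]\<close>)
    then show ?thesis using 1 by (simp add: flat_def)
  next
    case 2
    have "((\<lambda>h. (flat m (0 + h) - flat m 0) / h) \<longlongrightarrow> 0) (at 0)"
    proof (rule filterlim_split_at)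
      show "((\<lambda>h. (flat m (0 + h) - flat m 0) / h) \<longlongrightarrow> 0) (at_left 0)"
        by (rule Lim_transform_eventually[OF tendsto_const]) (auto simp: flat_def eventually_at_filter)
      show "((\<lambda>h. (flat m (0 + h) - flat m 0) / h) \<longlongrightarrow> 0) (at_right 0)"
        by (rule Lim_transform_eventually[OF flat_tendsto_0[of "Suc m"]])
           (auto simp: flat_def eventually_at_filter field_simps)
    qed
    then show ?thesis using 2 by (simp add: DERIV_def flat_def)
  next
    case 3
    have "((\<lambda>t. exp (- 1 / t) / t ^ m) has_real_derivative (flat (m + 2) t - m * flat (m + 1) t)) (at t)"
      using 3 by (auto intro!: derivative_eq_intros simp: flat_def)
         (cases m; auto simp: field_simps power2_eq_square)
    moreover have "\<forall>\<^sub>F s in nhds t. flat m s = exp (- 1 / s) / s ^ m"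
      using 3 by (auto simp: eventually_nhds flat_def intro!: exI[of _ "{0<..}"])
    ultimately show ?thesis by (simp add: DERIV_cong_ev)
  qed
qed

text \<open>Differentiation raises the power in the denominator, hence the induction on k with m
  arbitrary.\<close>

lemma times_differentiable_flat:
  assumes "smooth f" shows "times_differentiable k (\<lambda>x. flat m (f x))"
proof (induction k arbitrary: m)
  case 0
  have "continuous_on UNIV (flat m)"
    by (meson DERIV_isCont continuous_at_imp_continuous_on flat_has_derivative)
  from continuous_on_compose2[OF this smooth_continuous[OF assms]] show ?case by simp
next
  case (Suc k)
  have diff: "f differentiable (at x)" for x by (rule smooth_differentiable[OF assms])
  have "times_differentiable k (\<lambda>x. (flat (m + 2) (f x) + (- real m) * flat (m + 1) (f x)) * pgrad f x $ i)" for i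
    using smooth_pgrad[OF assms, of i] Suc unfolding smooth_def
    by (intro times_differentiable_mult times_differentiable_add times_differentiable_const) auto
  then show ?case
    by (auto simp: pgrad_comp[OF diff flat_has_derivative] intro!: differentiable_comp[OF diff flat_has_derivative])
qed

lemma smooth_flat: "smooth f \<Longrightarrow> smooth (\<lambda>x. flat m (f x))"
  by (simp add: smooth_def times_differentiable_flat)

section \<open>Supports of test functions\<close>

text \<open>Any compact subset of D that carries the nonzero values serves as a witness, so sums and
  products are handled by uniting or reusing such sets instead of computing closures.\<close>

lemma test_functions_iff:
  "\<phi> \<in> test_functions D \<longleftrightarrow> smooth \<phi> \<and> (\<exists>K. compact K \<and> K \<subseteq> D \<and> (\<forall>x. \<phi> x \<noteq> 0 \<longrightarrow> x \<in> K))"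
proof
  assume "\<phi> \<in> test_functions D"
  then show "smooth \<phi> \<and> (\<exists>K. compact K \<and> K \<subseteq> D \<and> (\<forall>x. \<phi> x \<noteq> 0 \<longrightarrow> x \<in> K))"
    unfolding test_functions_def smooth_def
    by (auto intro!: exI[of _ "closure {x. \<phi> x \<noteq> 0}"] closure_subset[THEN subsetD])
next
  assume "smooth \<phi> \<and> (\<exists>K. compact K \<and> K \<subseteq> D \<and> (\<forall>x. \<phi> x \<noteq> 0 \<longrightarrow> x \<in> K))"
  then obtain K where K: "smooth \<phi>" "compact K" "K \<subseteq> D" "{x. \<phi> x \<noteq> 0} \<subseteq> K" by auto
  then have "closure {x. \<phi> x \<noteq> 0} \<subseteq> K"
    by (simp add: closure_minimal compact_imp_closed)
  with K show "\<phi> \<in> test_functions D"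
    unfolding test_functions_def smooth_def
    by (auto intro: compact_closure[THEN iffD2] bounded_subset compact_imp_bounded)
qed

lemma test_functions_smooth: "\<phi> \<in> test_functions D \<Longrightarrow> smooth \<phi>"
  by (simp add: test_functions_iff)

lemma test_functions_mono: "\<phi> \<in> test_functions U \<Longrightarrow> U \<subseteq> D \<Longrightarrow> \<phi> \<in> test_functions D"
  unfolding test_functions_iff by blast

lemma test_functions_mult: "smooth f \<Longrightarrow> \<phi> \<in> test_functions D \<Longrightarrow> (\<lambda>x. f x * \<phi> x) \<in> test_functions D"
  unfolding test_functions_iff by (auto intro!: smooth_mult)

lemma pgrad_zero_outside:
  assumes "closed K" "\<And>x. \<phi> x \<noteq> 0 \<Longrightarrow> x \<in> K" "x \<notin> K"
  shows "pgrad \<phi> x = 0"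
proof -
  have "(\<phi> has_derivative (\<lambda>h. 0)) (at x)"
    by (rule has_derivative_transform_within_open[of "\<lambda>x. 0" _ _ _ "- K"])
       (use assms in \<open>auto simp: open_Compl\<close>)
  then show ?thesis by (simp add: vec_eq_iff pgrad_eq)
qed

text \<open>Off the closed set K the function is locally zero, so one set serves for the function
  and for its gradient.\<close>

lemma test_functions_support:
  assumes "\<phi> \<in> test_functions D"
  obtains K where "compact K" "K \<subseteq> D" "\<And>x. x \<notin> K \<Longrightarrow> \<phi> x = 0" "\<And>x. x \<notin> K \<Longrightarrow> pgrad \<phi> x = 0"
proof -
  obtain K where K: "compact K" "K \<subseteq> D" "\<And>x. \<phi> x \<noteq> 0 \<Longrightarrow> x \<in> K"
    using assms unfolding test_functions_iff by blast
  show ?thesis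
    using that[OF K(1,2)] K(3) pgrad_zero_outside[OF compact_imp_closed[OF K(1)], of \<phi>] by blast
qed

section \<open>Integrals against test functions\<close>

text \<open>The mean value inequality. It bounds difference quotients uniformly in the step, as
  dominated convergence requires.\<close>

lemma Lipschitz_if_pgrad_bounded:
  fixes f :: "real^'n \<Rightarrow> real"
  assumes "\<And>x. f differentiable (at x)" "\<And>x. norm (pgrad f x) \<le> B"
  shows "norm (f x - f y) \<le> B * norm (x - y)"
proof (rule differentiable_bound[of UNIV f "\<lambda>x h. pgrad f x \<bullet> h"])
  show "(f has_derivative (\<lambda>h. pgrad f x \<bullet> h)) (at x within UNIV)" for x
    using has_derivative_pgrad[OF assms(1)] by simp
  show "onorm (\<lambda>h. pgrad f x \<bullet> h) \<le> B" for x
  proof (rule onorm_le)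
    show "norm (pgrad f x \<bullet> h) \<le> B * norm h" for h
      using Cauchy_Schwarz_ineq2[of "pgrad f x" h] assms(2)[of x]
      by (simp add: mult_right_mono order_trans)
  qed
qed auto

lemma compact_support_bounded:
  fixes f :: "'a::metric_space \<Rightarrow> 'b::real_normed_vector"
  assumes "compact K" "continuous_on UNIV f" "\<And>x. x \<notin> K \<Longrightarrow> f x = 0"
  obtains B where "B \<ge> 0" "\<And>x. norm (f x) \<le> B"
proof -
  have "bounded (f ` K)"
    using assms by (meson compact_imp_bounded compact_continuous_image continuous_on_subset subset_UNIV)
  then obtain B where B: "B > 0" "\<And>x. x \<in> K \<Longrightarrow> norm (f x) \<le> B"
    by (auto simp: bounded_pos)
  have "norm (f x) \<le> B" for x
    using B assms(3)[of x] by (cases "x \<in> K") auto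
  with B(1) that[of B] show ?thesis by auto
qed

lemma compact_support_integrable:
  fixes f :: "'a::euclidean_space \<Rightarrow> real"
  assumes "compact K" "continuous_on UNIV f" "\<And>x. x \<notin> K \<Longrightarrow> f x = 0"
  shows "integrable lborel f"
proof -
  have "integrable lborel (\<lambda>x. indicator K x *\<^sub>R f x)"
    using assms by (intro borel_integrable_compact) (auto intro: continuous_on_subset)
  moreover have "(\<lambda>x. indicator K x *\<^sub>R f x) = f"
    using assms(3) by (auto simp: fun_eq_iff indicator_def)
  ultimately show ?thesis by simp
qed

lemma directional_limit:
  fixes f :: "real^'n \<Rightarrow> real"
  assumes "f differentiable (at x)"
  shows "(\<lambda>k. (f (x + inverse (real (Suc k)) *\<^sub>R axis i 1) - f x) * real (Suc k)) \<longlonglongrightarrow> pgrad f x $ i"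
proof -
  have "((\<lambda>t. f (x + t *\<^sub>R axis i 1)) has_derivative (\<lambda>t. pgrad f x \<bullet> (t *\<^sub>R axis i 1))) (at 0)"
    by (rule has_derivative_compose[of "\<lambda>t. x + t *\<^sub>R axis i 1" _ _ UNIV f])
       (auto intro!: derivative_eq_intros has_derivative_pgrad assms)
  moreover have "(\<lambda>t. pgrad f x \<bullet> (t *\<^sub>R axis i 1)) = (*) (pgrad f x $ i)"
    by (auto simp: inner_axis)
  ultimately have "((\<lambda>t. f (x + t *\<^sub>R axis i 1)) has_real_derivative pgrad f x $ i) (at 0)"
    by (simp add: has_field_derivative_def)
  then have "((\<lambda>h. (f (x + h *\<^sub>R axis i 1) - f x) / h) \<longlongrightarrow> pgrad f x $ i) (at 0)"
    by (simp add: DERIV_def)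
  moreover have "filterlim (\<lambda>k. inverse (real (Suc k))) (at 0) sequentially"
    unfolding filterlim_at using LIMSEQ_inverse_real_of_nat by (auto intro!: eventuallyI)
  ultimately have "(\<lambda>k. (f (x + inverse (real (Suc k)) *\<^sub>R axis i 1) - f x) / inverse (real (Suc k)))
      \<longlonglongrightarrow> pgrad f x $ i"
    by (rule filterlim_compose)
  then show ?thesis by (simp add: divide_inverse)
qed

text \<open>The integral of a difference quotient vanishes by translation invariance.\<close>

lemma lborel_integral_pgrad_test:
  fixes \<phi> :: "real^'n \<Rightarrow> real"
  assumes "\<phi> \<in> test_functions UNIV"
  shows "(\<integral>x. pgrad \<phi> x $ i \<partial>lborel) = 0"
proof -
  have sm: "smooth \<phi>" using assms by (rule test_functions_smooth)
  obtain K where K: "compact K" "\<And>x. x \<notin> K \<Longrightarrow> \<phi> x = 0" "\<And>x. x \<notin> K \<Longrightarrow> pgrad \<phi> x = 0"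
    using test_functions_support[OF assms] by metis
  obtain B where B: "B \<ge> 0" "\<And>x. norm (pgrad \<phi> x) \<le> B"
    using compact_support_bounded[OF K(1) smooth_continuous_pgrad[OF sm] K(3)] by metis
  obtain R where R: "\<And>x. x \<in> K \<Longrightarrow> norm x \<le> R"
    using compact_imp_bounded[OF K(1)] by (auto simp: bounded_iff)
  define e :: "nat \<Rightarrow> real^'n" where "e k = inverse (real (Suc k)) *\<^sub>R axis i 1" for k
  define q where "q k x = (\<phi> (x + e k) - \<phi> x) * real (Suc k)" for k x
  have e: "norm (e k) = inverse (real (Suc k))" "norm (e k) \<le> 1" for k
    by (auto simp: e_def norm_axis_1 field_simps)
  have cont: "continuous_on UNIV \<phi>" by (rule smooth_continuous[OF sm])
  have meas [measurable]: "\<phi> \<in> borel_measurable borel"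
    using cont by (rule borel_measurable_continuous_onI)
  have meas' [measurable]: "(\<lambda>x. pgrad \<phi> x $ i) \<in> borel_measurable borel"
    using smooth_continuous[OF smooth_pgrad[OF sm]] by (rule borel_measurable_continuous_onI)
  have int: "integrable lborel \<phi>"
    by (rule compact_support_integrable[OF K(1) cont K(2)])
  have shift: "integrable lborel (\<lambda>x. \<phi> (x + a))" "(\<integral>x. \<phi> (x + a) \<partial>lborel) = (\<integral>x. \<phi> x \<partial>lborel)" for a
  proof -
    have "integrable (distr lborel borel ((+) a)) \<phi>" "(\<integral>x. \<phi> x \<partial>distr lborel borel ((+) a)) = (\<integral>x. \<phi> x \<partial>lborel)"
      using int by (simp_all add: lborel_distr_plus)
    then show "integrable lborel (\<lambda>x. \<phi> (x + a))" "(\<integral>x. \<phi> (x + a) \<partial>lborel) = (\<integral>x. \<phi> x \<partial>lborel)"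
      by (simp_all add: integrable_distr_eq integral_distr add.commute)
  qed
  have q0: "(\<integral>x. q k x \<partial>lborel) = 0" for k
    unfolding q_def using int shift by simp
  \<comment> \<open>All shifts have length at most 1, so every difference quotient vanishes outside
    the ball of radius R + 1, and one multiple of the indicator of that ball dominates them
    all.\<close>
  have bound: "norm (q k x) \<le> indicator (cball 0 (R + 1)) x *\<^sub>R B" for k x
  proof (cases "x \<in> cball 0 (R + 1)")
    case True
    have "norm (\<phi> (x + e k) - \<phi> x) \<le> B * norm (e k)"
      using Lipschitz_if_pgrad_bounded[OF smooth_differentiable[OF sm] B(2), of "x + e k" x] by simp
    then have "norm (q k x) \<le> B * norm (e k) * real (Suc k)"
      unfolding q_def norm_mult by (simp add: mult_right_mono)
    moreover have "norm (e k) * real (Suc k) = 1" by (simp only: e(1)) simp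
    ultimately show ?thesis using True by (simp add: mult.assoc)
  next
    case False
    have "norm x \<le> norm (x + e k) + norm (e k)"
      using norm_triangle_ineq4[of "x + e k" "e k"] by simp
    with False e[of k] have "x \<notin> K" "x + e k \<notin> K"
      using R[of x] R[of "x + e k"] by auto
    with False show ?thesis by (simp add: q_def K(2))
  qed
  have "(\<lambda>k. \<integral>x. q k x \<partial>lborel) \<longlonglongrightarrow> (\<integral>x. pgrad \<phi> x $ i \<partial>lborel)"
  proof (rule integral_dominated_convergence)
    show "integrable lborel (\<lambda>x. indicator (cball (0::real^'n) (R + 1)) x *\<^sub>R B)"
      by (rule borel_integrable_compact) auto
    show "AE x in lborel. (\<lambda>k. q k x) \<longlonglongrightarrow> pgrad \<phi> x $ i"
      using directional_limit[OF smooth_differentiable[OF sm]] by (auto simp: q_def e_def)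
    show "q k \<in> borel_measurable lborel" for k
      unfolding q_def by measurable
  qed (use bound in auto)
  with q0 show ?thesis by (simp add: LIMSEQ_const_iff)
qed

lemma continuous_measurable_lebesgue_on:
  fixes f :: "'a::euclidean_space \<Rightarrow> 'b::euclidean_space"
  assumes "continuous_on UNIV f" shows "f \<in> borel_measurable (lebesgue_on D)"
  using borel_measurable_continuous_onI[OF assms]
  by (intro measurable_restrict_space1 measurable_completion) auto

text \<open>A function carried by a subset of D coincides with its extension by zero from D, so
  restricting the measure changes nothing; continuity makes it Borel measurable, so completing the
  measure changes nothing either.\<close>

lemma integral_lebesgue_on_compact_support:
  fixes f :: "'a::euclidean_space \<Rightarrow> real"
  assumes "D \<in> sets lebesgue" "continuous_on UNIV f" "compact K" "K \<subseteq> D" "\<And>x. x \<notin> K \<Longrightarrow> f x = 0"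
  shows "integrable (lebesgue_on D) f" "(\<integral>x. f x \<partial>lebesgue_on D) = (\<integral>x. f x \<partial>lborel)"
proof -
  have f: "(\<lambda>x. if x \<in> D then f x else 0) = f" using assms(4,5) by (auto simp: fun_eq_iff)
  have m: "f \<in> borel_measurable lborel" using borel_measurable_continuous_onI[OF assms(2)] by simp
  show "integrable (lebesgue_on D) f"
    using Lebesgue_Measure.integrable_restrict_UNIV[OF assms(1), of f]
      compact_support_integrable[OF assms(3,2,5)] integrable_completion[OF m] by (simp add: f)
  show "(\<integral>x. f x \<partial>lebesgue_on D) = (\<integral>x. f x \<partial>lborel)"
    using Lebesgue_Measure.integral_restrict_UNIV[OF assms(1), of f] integral_completion[OF m] by (simp add: f)
qed

lemma integral_pgrad_test:
  fixes \<phi> :: "real^'n \<Rightarrow> real"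
  assumes "D \<in> sets lebesgue" "\<phi> \<in> test_functions D"
  shows "integrable (lebesgue_on D) (\<lambda>x. pgrad \<phi> x $ i)" "(\<integral>x. pgrad \<phi> x $ i \<partial>lebesgue_on D) = 0"
proof -
  obtain K where K: "compact K" "K \<subseteq> D" "\<And>x. x \<notin> K \<Longrightarrow> \<phi> x = 0" "\<And>x. x \<notin> K \<Longrightarrow> pgrad \<phi> x = 0"
    using test_functions_support[OF assms(2)] by metis
  have c: "continuous_on UNIV (\<lambda>x. pgrad \<phi> x $ i)"
    by (intro smooth_continuous smooth_pgrad test_functions_smooth[OF assms(2)])
  note * = integral_lebesgue_on_compact_support[OF assms(1) c K(1,2)]
  show "integrable (lebesgue_on D) (\<lambda>x. pgrad \<phi> x $ i)" using * K(4) by simp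
  show "(\<integral>x. pgrad \<phi> x $ i \<partial>lebesgue_on D) = 0"
    using * K(4) lborel_integral_pgrad_test[OF test_functions_mono[OF assms(2)], of i] by simp
qed

section \<open>Bump functions and the fundamental lemma\<close>

text \<open>The standard bump, as \<open>flat 0 t\<close> is exp(-1/t) for t > 0. The squared
  distance is used because it is a polynomial in the coordinates, hence smooth also at the
  centre.\<close>

lemma test_function_ball:
  fixes a :: "real^'n"
  assumes "cball a r \<subseteq> U" "r > 0"
  shows "(\<lambda>x. flat 0 (r\<^sup>2 - (dist a x)\<^sup>2)) \<in> test_functions U"
    and "flat 0 (r\<^sup>2 - (dist a x)\<^sup>2) \<ge> 0"
    and "flat 0 (r\<^sup>2 - (dist a x)\<^sup>2) > 0 \<longleftrightarrow> x \<in> ball a r"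
proof -
  have pos: "r\<^sup>2 - (dist a x)\<^sup>2 > 0 \<longleftrightarrow> x \<in> ball a r" for x
    using assms(2) by (simp add: abs_le_square_iff[symmetric] linorder_not_le[symmetric])
  have "(dist a x)\<^sup>2 = (\<Sum>i\<in>UNIV. (x $ i + - a $ i) * (x $ i + - a $ i))" for x
    unfolding dist_commute[of a x] dist_norm power2_norm_eq_inner inner_vec_def
    by (intro sum.cong) (auto simp: algebra_simps)
  then have "smooth (\<lambda>x. r\<^sup>2 + (- 1) * (dist a x)\<^sup>2)"
    by (simp only:) (intro smooth_add smooth_const smooth_mult smooth_sum smooth_coord)
  then have "smooth (\<lambda>x. flat 0 (r\<^sup>2 - (dist a x)\<^sup>2))"
    using smooth_flat[of "\<lambda>x. r\<^sup>2 - (dist a x)\<^sup>2"] by simp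
  moreover have "flat 0 (r\<^sup>2 - (dist a x)\<^sup>2) \<noteq> 0 \<Longrightarrow> x \<in> cball a r" for x
    using pos[of x] by (auto simp: flat_def split: if_splits)
  ultimately show "(\<lambda>x. flat 0 (r\<^sup>2 - (dist a x)\<^sup>2)) \<in> test_functions U"
    unfolding test_functions_iff using assms(1) compact_cball by blast
  show "flat 0 (r\<^sup>2 - (dist a x)\<^sup>2) \<ge> 0" "flat 0 (r\<^sup>2 - (dist a x)\<^sup>2) > 0 \<longleftrightarrow> x \<in> ball a r"
    using pos[of x] by (auto simp: flat_def)
qed

lemma test_functions_zero: "(\<lambda>x. 0) \<in> test_functions U"
  by (auto simp: test_functions_iff smooth_const intro: exI[of _ "{}"])

lemma test_functions_add:
  assumes "\<phi> \<in> test_functions U" "\<psi> \<in> test_functions U"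
  shows "(\<lambda>x. \<phi> x + \<psi> x) \<in> test_functions U"
proof -
  obtain K L where "compact K" "K \<subseteq> U" "\<And>x. \<phi> x \<noteq> 0 \<Longrightarrow> x \<in> K" "compact L" "L \<subseteq> U" "\<And>x. \<psi> x \<noteq> 0 \<Longrightarrow> x \<in> L"
    using assms unfolding test_functions_iff by blast
  then have "compact (K \<union> L)" "K \<union> L \<subseteq> U" "\<And>x. \<phi> x + \<psi> x \<noteq> 0 \<Longrightarrow> x \<in> K \<union> L"
    by (simp_all add: compact_Un) force
  moreover have "smooth (\<lambda>x. \<phi> x + \<psi> x)"
    using assms test_functions_smooth smooth_add by blast
  ultimately show ?thesis unfolding test_functions_iff by blast
qed

lemma test_functions_sum:
  "(\<And>m. m \<in> I \<Longrightarrow> \<phi> m \<in> test_functions U) \<Longrightarrow> (\<lambda>x. \<Sum>m\<in>I. \<phi> m x) \<in> test_functions U"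
  by (induction I rule: infinite_finite_induct) (auto simp: test_functions_zero test_functions_add)

text \<open>The map t -> 1 - exp(-c t) fixes 0, hence preserves compact support, and for c \<ge> 0
  sends nonnegative values into [0, 1). Cut-offs arise this way without normalisation.\<close>

lemma test_functions_one_minus_exp:
  assumes "\<phi> \<in> test_functions U"
  shows "(\<lambda>x. 1 - exp (- c * \<phi> x)) \<in> test_functions U"
proof -
  have "smooth (\<lambda>x. 1 + (- 1) * exp (- c * \<phi> x))"
    by (intro smooth_add smooth_const smooth_mult smooth_exp test_functions_smooth[OF assms])
  moreover obtain K where "compact K" "K \<subseteq> U" "\<And>x. \<phi> x \<noteq> 0 \<Longrightarrow> x \<in> K"
    using assms unfolding test_functions_iff by blast
  ultimately show ?thesis unfolding test_functions_iff by (auto intro!: exI[of _ K])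
qed

text \<open>U is a countable union of open balls whose closed balls lie in U. The cut-off is 1 -
  exp(-s) with s equal to N times a partial sum of their bumps: at a point of U some bump is
  positive and drives s to infinity, off U all bumps vanish.\<close>

lemma open_indicator_limit:
  fixes U :: "(real^'n) set"
  assumes "open U"
  obtains \<psi> :: "nat \<Rightarrow> real^'n \<Rightarrow> real" where
    "\<And>N. \<psi> N \<in> test_functions U" "\<And>N x. 0 \<le> \<psi> N x" "\<And>N x. \<psi> N x \<le> 1"
    "\<And>x. (\<lambda>N. \<psi> N x) \<longlonglongrightarrow> indicator U x"
proof (cases "U = {}")
  case True
  then show ?thesis using that[of "\<lambda>_ _. 0"] by (simp add: test_functions_zero)
next
  case False
  define F where "F = {ball a r |a r. 0 < r \<and> cball a r \<subseteq> U}"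
  have "U \<subseteq> \<Union>F"
  proof
    fix x assume "x \<in> U"
    then obtain r where "0 < r" "cball x r \<subseteq> U"
      using open_contains_cball[of U] assms by blast
    then show "x \<in> \<Union>F" unfolding F_def by (intro UnionI[of "ball x r"]) auto
  qed
  then have F: "\<Union>F = U" unfolding F_def using ball_subset_cball by blast
  have opn: "open S" if "S \<in> F" for S using that by (auto simp: F_def)
  obtain F' where F': "F' \<subseteq> F" "countable F'" "\<Union>F' = \<Union>F"
    using opn by (rule Lindelof)
  \<comment> \<open>\<open>from_nat_into\<close> enumerates nonempty countable sets only, which is
    why the empty U is treated apart.\<close>
  then have ne: "F' \<noteq> {}" using False F by auto
  have "\<exists>a r. 0 < r \<and> cball a r \<subseteq> U \<and> from_nat_into F' m = ball a r" for m
  proof -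
    have "from_nat_into F' m \<in> F" using subsetD[OF F'(1) from_nat_into[OF ne]] .
    then show ?thesis by (auto simp: F_def)
  qed
  then obtain a r where ar: "\<And>m. 0 < r m" "\<And>m. cball (a m) (r m) \<subseteq> U" "\<And>m. from_nat_into F' m = ball (a m) (r m)"
    by metis
  have U: "U = (\<Union>m. ball (a m) (r m))"
  proof -
    have "U = (\<Union>m. from_nat_into F' m)"
      using range_from_nat_into[OF ne F'(2)] F'(3) F by simp
    then show ?thesis by (simp only: ar(3))
  qed
  define \<beta> where "\<beta> m x = flat 0 ((r m)\<^sup>2 - (dist (a m) x)\<^sup>2)" for m x
  note \<beta> = test_function_ball[OF ar(2,1), folded \<beta>_def]
  define \<psi> where "\<psi> N x = 1 - exp (- real N * (\<Sum>m<N. \<beta> m x))" for N x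
  have s: "(\<Sum>m<N. \<beta> m x) \<ge> 0" for N x by (intro sum_nonneg \<beta>(2))
  show ?thesis
  proof
    show "\<psi> N \<in> test_functions U" for N
      unfolding \<psi>_def by (intro test_functions_one_minus_exp test_functions_sum) (use \<beta>(1) in \<open>simp add: \<beta>_def\<close>)
    show "0 \<le> \<psi> N x" "\<psi> N x \<le> 1" for N x
      unfolding \<psi>_def using s[where N=N and x=x] by auto
    show "(\<lambda>N. \<psi> N x) \<longlonglongrightarrow> indicator U x" for x
    proof (cases "x \<in> U")
      case False
      then have "\<beta> m x = 0" for m
        using \<beta>(2,3)[of m x] U by fastforce
      with False show ?thesis by (simp add: \<psi>_def)
    next
      case True
      then obtain m where m: "x \<in> ball (a m) (r m)" using U by auto
      then have pos: "\<beta> m x > 0" using \<beta>(3) by simp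
      have "(\<lambda>N. 1 - exp (- \<beta> m x) ^ N) \<longlonglongrightarrow> 1 - 0"
        using pos by (intro tendsto_diff tendsto_const LIMSEQ_realpow_zero) auto
      then have lim: "(\<lambda>N. 1 - exp (- (\<beta> m x * real N))) \<longlonglongrightarrow> 1"
        by (simp add: mult.commute flip: exp_of_nat_mult)
      have "(\<lambda>N. \<psi> N x) \<longlonglongrightarrow> 1"
      proof (rule tendsto_sandwich[OF _ _ lim tendsto_const])
        show "\<forall>\<^sub>F N in sequentially. 1 - exp (- (\<beta> m x * real N)) \<le> \<psi> N x"
        proof (rule eventually_sequentiallyI[of "Suc m"])
          fix N assume "Suc m \<le> N"
          then have "\<beta> m x \<le> (\<Sum>m<N. \<beta> m x)"
            by (intro member_le_sum) (auto simp: \<beta>(2))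
          then show "1 - exp (- (\<beta> m x * real N)) \<le> \<psi> N x"
            by (simp add: \<psi>_def mult.commute mult_left_mono)
        qed
      qed (simp add: \<psi>_def)
      with True show ?thesis by simp
    qed
  qed
qed

lemma Int_stable_open: "Int_stable {S::'a::topological_space set. open S}"
  by (auto simp: Int_stable_def)

text \<open>A Dynkin argument: the open sets are stable under intersection and generate the Borel
  sets, and the sets over which g integrates to 0 are closed under complements and countable
  disjoint unions. A Lebesgue set differs from a Borel set by a null set, and on a sigma-finite
  space an integrable function whose integral over every measurable set is 0 vanishes almost
  everywhere.\<close>

lemma AE_zero_if_open_integrals_zero:
  fixes g :: "real^'n \<Rightarrow> real"
  assumes g: "integrable lebesgue g"
    and open0: "\<And>U. open U \<Longrightarrow> (\<integral>x. indicator U x * g x \<partial>lebesgue) = 0"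
  shows "AE x in lebesgue. g x = 0"
proof -
  have gint: "integrable lebesgue (\<lambda>x. indicator A x * g x)" if "A \<in> sets lebesgue" for A
    using integrable_mult_indicator[OF that g] by simp
  have borel0: "(\<integral>x. indicator A x * g x \<partial>lebesgue) = 0" if "A \<in> sets borel" for A
  proof -
    have "{S. open S} \<subseteq> Pow (UNIV :: (real^'n) set)" by auto
    moreover have "A \<in> sigma_sets UNIV {S. open S}" using that by (simp add: sets_borel)
    ultimately show ?thesis
    proof (induction rule: sigma_sets_induct_disjoint[OF Int_stable_open, consumes 2, case_names basic empty compl union])
      case (compl A)
      then have A: "A \<in> sets lebesgue" by (simp flip: sets_borel)
      \<comment> \<open>The whole space is open, so the integral over it is 0 and the complement
        inherits the property from A.\<close>
      have "(\<integral>x. indicator (UNIV - A) x * g x \<partial>lebesgue) = (\<integral>x. indicator UNIV x * g x - indicator A x * g x \<partial>lebesgue)"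
        by (intro Bochner_Integration.integral_cong) (auto simp: indicator_def)
      also have "\<dots> = 0"
        by (subst Bochner_Integration.integral_diff) (use gint[OF A] gint[of UNIV] compl open0[of UNIV] in auto)
      finally show ?case .
    next
      case (union A)
      then have A: "A i \<in> sets lebesgue" for i by (auto simp flip: sets_borel)
      have "(\<integral>x. indicator (\<Union>i. A i) x * g x \<partial>lebesgue) = (\<integral>x\<in>(\<Union>i. A i). g x \<partial>lebesgue)"
        by (simp add: set_lebesgue_integral_def)
      also have "\<dots> = (\<Sum>i. \<integral>x\<in>A i. g x \<partial>lebesgue)"
        by (rule lebesgue_integral_countable_add)
           (use A union.hyps(1) gint[of "\<Union>i. A i"] in \<open>auto simp: set_integrable_def disjoint_family_on_def\<close>)
      also have "\<dots> = 0" using union by (simp add: set_lebesgue_integral_def)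
      finally show ?case .
    qed (auto simp: open0)
  qed
  have "set_lebesgue_integral lebesgue A g = 0" if "A \<in> sets lebesgue" for A
  proof -
    obtain B N N' where *: "A = B \<union> N" "N \<subseteq> N'" "N' \<in> null_sets lborel" "B \<in> sets lborel"
      using \<open>A \<in> sets lebesgue\<close> by (rule sets_completionE)
    have "AE x in lebesgue. x \<notin> N'"
      using *(3) by (intro AE_not_in null_sets_completionI)
    then have "AE x in lebesgue. indicator A x * g x = indicator B x * g x"
      by eventually_elim (use * in \<open>auto simp: indicator_def\<close>)
    moreover have B: "B \<in> sets lebesgue" "B \<in> sets borel" using *(4) by auto
    ultimately have "(\<integral>x. indicator A x * g x \<partial>lebesgue) = (\<integral>x. indicator B x * g x \<partial>lebesgue)"
      by (intro integral_cong_AE borel_measurable_integrable gint that)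
    then show ?thesis using borel0[OF B(2)] by (simp add: set_lebesgue_integral_def)
  qed
  moreover have "sigma_finite_measure (lebesgue :: (real^'n) measure)"
  proof
    obtain A :: "(real^'n) set set" where A: "countable A" "A \<subseteq> sets lborel" "\<Union>A = space lborel"
      "\<And>a. a \<in> A \<Longrightarrow> emeasure lborel a \<noteq> \<infinity>"
      using lborel.sigma_finite_countable by metis
    then show "\<exists>A. countable A \<and> A \<subseteq> sets (lebesgue :: (real^'n) measure) \<and> \<Union>A = space lebesgue \<and>
        (\<forall>a\<in>A. emeasure lebesgue a \<noteq> \<infinity>)"
      by (intro exI[of _ A]) (auto simp: subset_iff)
  qed
  ultimately show ?thesis
    using sigma_finite_measure.density_zero[OF _ g] by blast
qed

text \<open>Test functions converge boundedly to the indicator of V \<inter> U for every open V,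
  which reduces the claim to the preceding lemma. U = D gives uniqueness of weak gradients; smaller
  U localise a weak divergence to the interior of a cell.\<close>

lemma fundamental_lemma:
  fixes g :: "real^'n \<Rightarrow> real"
  assumes D: "D \<in> sets lebesgue" and g: "integrable (lebesgue_on D) g" and U: "open U" "U \<subseteq> D"
    and test0: "\<And>\<phi>. \<phi> \<in> test_functions U \<Longrightarrow> (\<integral>x. g x * \<phi> x \<partial>lebesgue_on D) = 0"
  shows "AE x in lebesgue. x \<in> U \<longrightarrow> g x = 0"
proof -
  define G where "G x = (if x \<in> U then g x else 0)" for x
  have gD: "integrable lebesgue (\<lambda>x. if x \<in> D then g x else 0)"
    using g Lebesgue_Measure.integrable_restrict_UNIV[OF D] by blast
  have "integrable lebesgue (\<lambda>x. indicator U x *\<^sub>R (if x \<in> D then g x else 0))"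
    using U by (intro integrable_mult_indicator gD) auto
  moreover have "(\<lambda>x. indicator U x *\<^sub>R (if x \<in> D then g x else 0)) = G"
    using U by (auto simp: G_def indicator_def fun_eq_iff)
  ultimately have G: "integrable lebesgue G" by simp
  have G0: "(\<integral>x. \<phi> x * G x \<partial>lebesgue) = 0" if "\<phi> \<in> test_functions U" for \<phi>
  proof -
    have "(\<integral>x. \<phi> x * G x \<partial>lebesgue) = (\<integral>x. (if x \<in> D then g x * \<phi> x else 0) \<partial>lebesgue)"
      using that U(2) by (intro Bochner_Integration.integral_cong) (auto simp: G_def test_functions_iff)
    also have "\<dots> = 0" using test0[OF that] by (simp add: Lebesgue_Measure.integral_restrict_UNIV[OF D])
    finally show ?thesis .
  qed
  have "AE x in lebesgue. G x = 0"
  proof (rule AE_zero_if_open_integrals_zero[OF G])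
    fix V :: "(real^'n) set" assume "open V"
    then have "open (V \<inter> U)" using U by auto
    then obtain \<psi> :: "nat \<Rightarrow> real^'n \<Rightarrow> real" where \<psi>: "\<And>N. \<psi> N \<in> test_functions (V \<inter> U)"
      "\<And>N x. 0 \<le> \<psi> N x" "\<And>N x. \<psi> N x \<le> 1" "\<And>x. (\<lambda>N. \<psi> N x) \<longlonglongrightarrow> indicator (V \<inter> U) x"
      by (rule open_indicator_limit) blast
    have "(\<lambda>N. \<integral>x. \<psi> N x * G x \<partial>lebesgue) \<longlonglongrightarrow> (\<integral>x. indicator (V \<inter> U) x * G x \<partial>lebesgue)"
    proof (rule integral_dominated_convergence)
      show "integrable lebesgue (\<lambda>x. \<bar>G x\<bar>)" using G by simp
      show "AE x in lebesgue. norm (\<psi> N x * G x) \<le> \<bar>G x\<bar>" for N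
        using \<psi>(2,3) by (intro AE_I2) (auto simp: abs_mult intro: mult_left_le_one_le)
      show "AE x in lebesgue. (\<lambda>N. \<psi> N x * G x) \<longlonglongrightarrow> indicator (V \<inter> U) x * G x"
        using \<psi>(4) by (intro AE_I2 tendsto_mult tendsto_const)
      have "\<psi> N \<in> borel_measurable lebesgue" for N
        using borel_measurable_continuous_onI[OF smooth_continuous[OF test_functions_smooth[OF \<psi>(1)]]]
        by (intro measurable_completion) auto
      then show "(\<lambda>x. \<psi> N x * G x) \<in> borel_measurable lebesgue" for N
        using G by (intro borel_measurable_times) auto
      show "(\<lambda>x. indicator (V \<inter> U) x * G x) \<in> borel_measurable lebesgue"
        using G \<open>open (V \<inter> U)\<close> by (intro borel_measurable_times borel_measurable_indicator) auto
    qed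
    moreover have "(\<integral>x. \<psi> N x * G x \<partial>lebesgue) = 0" for N
      by (rule G0, rule test_functions_mono[OF \<psi>(1)]) auto
    ultimately have "(\<integral>x. indicator (V \<inter> U) x * G x \<partial>lebesgue) = 0"
      by (simp add: LIMSEQ_const_iff)
    moreover have "(\<integral>x. indicator (V \<inter> U) x * G x \<partial>lebesgue) = (\<integral>x. indicator V x * G x \<partial>lebesgue)"
      by (intro Bochner_Integration.integral_cong) (auto simp: G_def indicator_def)
    ultimately show "(\<integral>x. indicator V x * G x \<partial>lebesgue) = 0" by simp
  qed
  then show ?thesis by eventually_elim (auto simp: G_def)
qed

section \<open>Weak derivatives in \<open>L\<^sup>2\<close>\<close>

lemma norm_vec_sq: "(norm (x::'a::real_inner^'n))\<^sup>2 = (\<Sum>i\<in>UNIV. (norm (x $ i))\<^sup>2)"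
  by (simp add: power2_norm_eq_inner inner_vec_def)

lemma measurable_vec_iff:
  fixes f :: "'a \<Rightarrow> 'b::euclidean_space^'n"
  shows "f \<in> borel_measurable M \<longleftrightarrow> (\<forall>i. (\<lambda>x. f x $ i) \<in> borel_measurable M)"
proof
  assume f: "f \<in> borel_measurable M"
  have "(\<lambda>y::'b^'n. y $ i) \<in> borel_measurable borel" for i
    by (intro borel_measurable_continuous_onI continuous_intros)
  from measurable_compose[OF f this] show "\<forall>i. (\<lambda>x. f x $ i) \<in> borel_measurable M" by simp
next
  assume *: "\<forall>i. (\<lambda>x. f x $ i) \<in> borel_measurable M"
  show "f \<in> borel_measurable M"
    unfolding borel_measurable_euclidean_space[of f]
  proof
    fix b :: "'b^'n" assume "b \<in> Basis"
    have "(\<lambda>x. f x \<bullet> b) = (\<lambda>x. \<Sum>i\<in>UNIV. f x $ i \<bullet> b $ i)"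
      by (simp add: inner_vec_def)
    then show "(\<lambda>x. f x \<bullet> b) \<in> borel_measurable M"
      using * by (auto intro!: borel_measurable_sum borel_measurable_inner)
  qed
qed

lemma L2_spaceD:
  assumes "f \<in> L2_space D"
  shows "f \<in> borel_measurable (lebesgue_on D)" "integrable (lebesgue_on D) (\<lambda>x. (norm (f x))\<^sup>2)"
  using assms by (auto simp: L2_space_def)

lemma L2_spaceI:
  assumes "f \<in> borel_measurable (lebesgue_on D)" "integrable (lebesgue_on D) g"
    "AE x in lebesgue_on D. (norm (f x))\<^sup>2 \<le> g x"
  shows "f \<in> L2_space D"
  unfolding L2_space_def using assms(1)
  by (auto intro!: Bochner_Integration.integrable_bound[OF assms(2)] eventually_mono[OF assms(3)])

lemma L2_add:
  assumes "f \<in> L2_space D" "g \<in> L2_space D"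
  shows "(\<lambda>x. f x + g x) \<in> L2_space D"
proof (rule L2_spaceI)
  show "(\<lambda>x. f x + g x) \<in> borel_measurable (lebesgue_on D)"
    using assms[THEN L2_spaceD(1)] by (rule borel_measurable_add)
  show "integrable (lebesgue_on D) (\<lambda>x. 2 * (norm (f x))\<^sup>2 + 2 * (norm (g x))\<^sup>2)"
    using assms[THEN L2_spaceD(2)] by simp
  have "(norm (a + b))\<^sup>2 \<le> 2 * (norm a)\<^sup>2 + 2 * (norm b)\<^sup>2" for a b :: 'b
    using zero_le_power2[of "norm (a - b)"] by (simp add: power2_norm_eq_inner algebra_simps inner_commute)
  then show "AE x in lebesgue_on D. (norm (f x + g x))\<^sup>2 \<le> 2 * (norm (f x))\<^sup>2 + 2 * (norm (g x))\<^sup>2"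
    by simp
qed

lemma L2_scaleR_bounded:
  assumes "f \<in> L2_space D" "h \<in> borel_measurable (lebesgue_on D)" "AE x in lebesgue_on D. \<bar>h x\<bar> \<le> B"
  shows "(\<lambda>x. h x *\<^sub>R f x) \<in> L2_space D"
proof (rule L2_spaceI)
  show "(\<lambda>x. h x *\<^sub>R f x) \<in> borel_measurable (lebesgue_on D)"
    using assms(2) L2_spaceD(1)[OF assms(1)] by (rule borel_measurable_scaleR)
  show "integrable (lebesgue_on D) (\<lambda>x. B\<^sup>2 * (norm (f x))\<^sup>2)"
    using L2_spaceD(2)[OF assms(1)] by simp
  show "AE x in lebesgue_on D. (norm (h x *\<^sub>R f x))\<^sup>2 \<le> B\<^sup>2 * (norm (f x))\<^sup>2"
    using assms(3)
  proof eventually_elim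
    fix x assume "\<bar>h x\<bar> \<le> B"
    then have "\<bar>h x\<bar>\<^sup>2 \<le> B\<^sup>2" by (intro power_mono) auto
    then show "(norm (h x *\<^sub>R f x))\<^sup>2 \<le> B\<^sup>2 * (norm (f x))\<^sup>2"
      by (simp add: power_mult_distrib mult_right_mono)
  qed
qed

lemma L2_scaleR_const: "f \<in> L2_space D \<Longrightarrow> (\<lambda>x. c *\<^sub>R f x) \<in> L2_space D"
  by (rule L2_scaleR_bounded[of _ _ _ "\<bar>c\<bar>"]) auto

lemma L2_diff: "f \<in> L2_space D \<Longrightarrow> g \<in> L2_space D \<Longrightarrow> (\<lambda>x. f x - g x) \<in> L2_space D"
  using L2_add[of f D "\<lambda>x. (-1) *\<^sub>R g x"] L2_scaleR_const[of g D "-1"] by simp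

lemma L2_component:
  fixes f :: "real^'n \<Rightarrow> 'b::euclidean_space^'m"
  shows "f \<in> L2_space D \<Longrightarrow> (\<lambda>x. f x $ i) \<in> L2_space D"
  by (rule L2_spaceI[of _ _ "\<lambda>x. (norm (f x))\<^sup>2"])
     (auto simp: L2_space_def measurable_vec_iff intro!: power_mono Finite_Cartesian_Product.norm_nth_le)

lemma L2_vec:
  fixes f :: "real^'n \<Rightarrow> 'b::euclidean_space^'m"
  assumes "\<And>i. (\<lambda>x. f x $ i) \<in> L2_space D"
  shows "f \<in> L2_space D"
  using assms by (auto simp: L2_space_def measurable_vec_iff norm_vec_sq)

lemma L2_integrable_inner:
  assumes "f \<in> L2_space D" "g \<in> L2_space D"
  shows "integrable (lebesgue_on D) (\<lambda>x. f x \<bullet> g x)"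
proof (rule Bochner_Integration.integrable_bound)
  show "integrable (lebesgue_on D) (\<lambda>x. (norm (f x))\<^sup>2 + (norm (g x))\<^sup>2)"
    using assms[THEN L2_spaceD(2)] by simp
  show "(\<lambda>x. f x \<bullet> g x) \<in> borel_measurable (lebesgue_on D)"
    using assms[THEN L2_spaceD(1)] by (rule borel_measurable_inner)
  have "\<bar>a \<bullet> b\<bar> \<le> (norm a)\<^sup>2 + (norm b)\<^sup>2" for a b :: 'b
    using Cauchy_Schwarz_ineq2[of a b] sum_squares_bound[of "norm a" "norm b"]
      mult_nonneg_nonneg[OF norm_ge_zero norm_ge_zero, of a b] by linarith
  then show "AE x in lebesgue_on D. norm (f x \<bullet> g x) \<le> norm ((norm (f x))\<^sup>2 + (norm (g x))\<^sup>2)"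
    by simp
qed

text \<open>Holds for every f: the integrand is nonnegative and a Bochner integral that fails to
  exist has the value 0, so squaring always undoes the square root.\<close>

lemma l2_norm_sq: "(l2_norm D f)\<^sup>2 = (\<integral>x. (norm (f x))\<^sup>2 \<partial>lebesgue_on D)"
  by (simp add: l2_norm_def l2_inner_def power2_norm_eq_inner)

lemma l2_norm_nonneg [simp]: "l2_norm D f \<ge> 0"
  by (simp add: l2_norm_def l2_inner_def)

lemma l2_inner_self: "l2_inner D f f = (l2_norm D f)\<^sup>2"
  by (simp add: l2_norm_sq l2_inner_def power2_norm_eq_inner)

lemma l2_inner_commute: "l2_inner D f g = l2_inner D g f"
  by (simp add: l2_inner_def inner_commute)

lemma l2_inner_diff_left:
  assumes "f \<in> L2_space D" "g \<in> L2_space D" "k \<in> L2_space D"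
  shows "l2_inner D (\<lambda>x. f x - g x) k = l2_inner D f k - l2_inner D g k"
  using assms by (simp add: l2_inner_def inner_diff_left L2_integrable_inner)

lemma l2_inner_scaleR_left: "l2_inner D (\<lambda>x. c *\<^sub>R f x) k = c * l2_inner D f k"
  by (simp add: l2_inner_def)

text \<open>The scalar c is kept free because Cauchy-Schwarz varies it; c = 1 serves the triangle
  inequality.\<close>

lemma l2_norm_add_sq:
  assumes "f \<in> L2_space D" "g \<in> L2_space D"
  shows "(l2_norm D (\<lambda>x. f x + c *\<^sub>R g x))\<^sup>2 = (l2_norm D f)\<^sup>2 + 2 * c * l2_inner D f g + c\<^sup>2 * (l2_norm D g)\<^sup>2"
proof -
  have "(norm (f x + c *\<^sub>R g x))\<^sup>2 = (norm (f x))\<^sup>2 + 2 * c * (f x \<bullet> g x) + c\<^sup>2 * (norm (g x))\<^sup>2" for x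
    by (simp add: power2_norm_eq_inner algebra_simps inner_commute) (simp add: power2_eq_square)
  then show ?thesis
    using assms[THEN L2_spaceD(2)] L2_integrable_inner[OF assms]
    by (simp add: l2_norm_sq l2_inner_def)
qed

lemma l2_Cauchy_Schwarz:
  assumes "f \<in> L2_space D" "g \<in> L2_space D"
  shows "\<bar>l2_inner D f g\<bar> \<le> l2_norm D f * l2_norm D g"
proof -
  define a b c where "a = (l2_norm D f)\<^sup>2" and "b = l2_inner D f g" and "c = (l2_norm D g)\<^sup>2"
  have q: "a + 2 * t * b + t\<^sup>2 * c \<ge> 0" for t
    using l2_norm_add_sq[OF assms, of t] zero_le_power2[of "l2_norm D (\<lambda>x. f x + t *\<^sub>R g x)"]
    unfolding a_def b_def c_def by linarith
  have "b\<^sup>2 \<le> a * c"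
  proof (cases "c = 0")
    case True
    have "b = 0"
    proof (rule ccontr)
      assume "b \<noteq> 0"
      \<comment> \<open>For c = 0 the quadratic in t is affine, and at this t it would take the
        value -1.\<close>
      with True q[of "- (a + 1) / (2 * b)"] show False by (simp add: field_simps)
    qed
    with True show ?thesis by simp
  next
    case False
    then have "c > 0" by (simp add: c_def)
    \<comment> \<open>The minimiser of the quadratic, where its nonnegativity is the discriminant
      condition.\<close>
    with q[of "- b / c"] show ?thesis by (simp add: field_simps power2_eq_square)
  qed
  then have "\<bar>b\<bar> \<le> sqrt (a * c)" by (metis real_sqrt_abs real_sqrt_le_mono)
  then show ?thesis by (simp add: a_def b_def c_def real_sqrt_mult)
qed

lemma l2_norm_triangle:
  assumes "f \<in> L2_space D" "g \<in> L2_space D"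
  shows "l2_norm D f \<le> l2_norm D g + l2_norm D (\<lambda>x. f x - g x)"
proof (rule power2_le_imp_le)
  have d: "(\<lambda>x. f x - g x) \<in> L2_space D" by (rule L2_diff[OF assms])
  have "(l2_norm D f)\<^sup>2 = (l2_norm D g)\<^sup>2 + 2 * l2_inner D g (\<lambda>x. f x - g x) + (l2_norm D (\<lambda>x. f x - g x))\<^sup>2"
    using l2_norm_add_sq[OF assms(2) d, of 1] by simp
  also have "\<dots> \<le> (l2_norm D g + l2_norm D (\<lambda>x. f x - g x))\<^sup>2"
    using l2_Cauchy_Schwarz[OF assms(2) d] by (simp add: power2_sum)
  finally show "(l2_norm D f)\<^sup>2 \<le> (l2_norm D g + l2_norm D (\<lambda>x. f x - g x))\<^sup>2" .
qed simp

lemma l2_inner_tendsto: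
  assumes "\<And>k. f k \<in> L2_space D" "f' \<in> L2_space D" "g \<in> L2_space D"
    and lim: "(\<lambda>k. l2_norm D (\<lambda>x. f k x - f' x)) \<longlonglongrightarrow> 0"
  shows "(\<lambda>k. l2_inner D (f k) g) \<longlonglongrightarrow> l2_inner D f' g"
proof -
  have "(\<lambda>k. l2_inner D (f k) g - l2_inner D f' g) \<longlonglongrightarrow> 0"
  proof (rule Lim_null_comparison)
    show "\<forall>\<^sub>F k in sequentially. norm (l2_inner D (f k) g - l2_inner D f' g) \<le> l2_norm D (\<lambda>x. f k x - f' x) * l2_norm D g"
      using l2_Cauchy_Schwarz[OF L2_diff[OF assms(1,2)] assms(3)]
      by (simp add: l2_inner_diff_left assms)
    show "(\<lambda>k. l2_norm D (\<lambda>x. f k x - f' x) * l2_norm D g) \<longlonglongrightarrow> 0"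
      using tendsto_mult[OF lim tendsto_const] by simp
  qed
  then show ?thesis by (rule LIM_zero_cancel)
qed

lemma L2_integrable:
  fixes f :: "real^'n \<Rightarrow> real"
  assumes "D \<in> lmeasurable" "f \<in> L2_space D"
  shows "integrable (lebesgue_on D) f"
proof (rule Bochner_Integration.integrable_bound)
  have "finite_measure (lebesgue_on D)"
    using assms(1) by (auto intro!: finite_measureI simp: emeasure_restrict_space fmeasurable_def)
  then have "integrable (lebesgue_on D) (\<lambda>x. 1::real)"
    by (rule finite_measure.integrable_const)
  then show "integrable (lebesgue_on D) (\<lambda>x. 1 + (norm (f x))\<^sup>2)"
    using L2_spaceD(2)[OF assms(2)] by simp
  have "\<bar>t\<bar> \<le> 1 + t\<^sup>2" for t :: real
    using sum_squares_bound[of 1 "\<bar>t\<bar>"] abs_ge_zero[of t] by simp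
  then show "AE x in lebesgue_on D. norm (f x) \<le> norm (1 + (norm (f x))\<^sup>2)" by simp
qed (use L2_spaceD(1)[OF assms(2)] in auto)

lemma L2_continuous_compact_support:
  fixes f :: "real^'n \<Rightarrow> 'b::euclidean_space"
  assumes "D \<in> sets lebesgue" "continuous_on UNIV f" "compact K" "K \<subseteq> D" "\<And>x. x \<notin> K \<Longrightarrow> f x = 0"
  shows "f \<in> L2_space D"
proof -
  have "integrable (lebesgue_on D) (\<lambda>x. (norm (f x))\<^sup>2)"
    using assms by (intro integral_lebesgue_on_compact_support(1)[OF assms(1) _ assms(3,4)]) (auto intro!: continuous_intros)
  then show ?thesis
    using continuous_measurable_lebesgue_on[OF assms(2)] by (simp add: L2_space_def)
qed

lemma test_functions_L2:
  assumes "D \<in> sets lebesgue" "\<phi> \<in> test_functions D"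
  shows "\<phi> \<in> L2_space D" "pgrad \<phi> \<in> L2_space D"
proof -
  obtain K where K: "compact K" "K \<subseteq> D" "\<And>x. x \<notin> K \<Longrightarrow> \<phi> x = 0" "\<And>x. x \<notin> K \<Longrightarrow> pgrad \<phi> x = 0"
    using test_functions_support[OF assms(2)] by metis
  have sm: "smooth \<phi>" by (rule test_functions_smooth[OF assms(2)])
  show "\<phi> \<in> L2_space D"
    by (rule L2_continuous_compact_support[OF assms(1) smooth_continuous[OF sm] K(1-3)])
  show "pgrad \<phi> \<in> L2_space D"
    by (rule L2_continuous_compact_support[OF assms(1) smooth_continuous_pgrad[OF sm] K(1,2,4)])
qed

lemma test_functions_bounded:
  assumes "\<phi> \<in> test_functions D"
  obtains B where "\<And>x. \<bar>\<phi> x\<bar> \<le> B" "\<And>x i. \<bar>pgrad \<phi> x $ i\<bar> \<le> B"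
proof -
  obtain K where K: "compact K" "K \<subseteq> D" "\<And>x. x \<notin> K \<Longrightarrow> \<phi> x = 0" "\<And>x. x \<notin> K \<Longrightarrow> pgrad \<phi> x = 0"
    using test_functions_support[OF assms] by metis
  have sm: "smooth \<phi>" by (rule test_functions_smooth[OF assms])
  obtain B1 where B1: "\<And>x. norm (\<phi> x) \<le> B1"
    using compact_support_bounded[OF K(1) smooth_continuous[OF sm] K(3)] by metis
  obtain B2 where B2: "\<And>x. norm (pgrad \<phi> x) \<le> B2"
    using compact_support_bounded[OF K(1) smooth_continuous_pgrad[OF sm] K(4)] by metis
  have "\<bar>pgrad \<phi> x $ i\<bar> \<le> B2" for x i
    using Finite_Cartesian_Product.norm_nth_le[of "pgrad \<phi> x" i] B2[of x] by simp
  with B1 that[of "max B1 B2"] show ?thesis by (force simp: le_max_iff_disj)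
qed

section \<open>Weak gradients and the Poincare inequality\<close>

lemma has_weak_gradD:
  assumes "has_weak_grad D u g"
  shows "u \<in> L2_space D" "g \<in> L2_space D"
    "\<phi> \<in> test_functions D \<Longrightarrow>
      (\<integral>x. u x * pgrad \<phi> x $ i \<partial>(lebesgue_on D)) = - (\<integral>x. g x $ i * \<phi> x \<partial>(lebesgue_on D))"
  using assms unfolding has_weak_grad_def by auto

lemma H1_has_weak_grad: "u \<in> H1_space D \<Longrightarrow> has_weak_grad D u (wgrad D u)"
  using someI_ex[of "has_weak_grad D u"] by (simp add: H1_space_def wgrad_def)

text \<open>\<open>wgrad\<close> picks an arbitrary weak gradient; uniqueness allows a gradient
  computed by the product rule to replace it under an integral.\<close>

lemma has_weak_grad_unique:
  fixes D :: "(real^'n) set"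
  assumes "open D" "D \<in> lmeasurable" "has_weak_grad D u g" "has_weak_grad D u g'"
  shows "AE x in lebesgue_on D. g x = g' x"
proof -
  have D: "D \<in> sets lebesgue" using assms(2) by auto
  have comp: "(\<lambda>x. g x $ i) \<in> L2_space D" "(\<lambda>x. g' x $ i) \<in> L2_space D" for i
    using assms(3,4)[THEN has_weak_gradD(2)] by (auto intro: L2_component)
  have "AE x in lebesgue. x \<in> D \<longrightarrow> g x $ i - g' x $ i = 0" for i
  proof (rule fundamental_lemma[OF D _ assms(1) subset_refl])
    show "integrable (lebesgue_on D) (\<lambda>x. g x $ i - g' x $ i)"
      by (intro Bochner_Integration.integrable_diff L2_integrable assms comp)
    fix \<phi> assume \<phi>: "\<phi> \<in> test_functions D"
    have "integrable (lebesgue_on D) (\<lambda>x. g x $ i * \<phi> x)" "integrable (lebesgue_on D) (\<lambda>x. g' x $ i * \<phi> x)"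
      using L2_integrable_inner[OF comp(1) test_functions_L2(1)[OF D \<phi>]]
        L2_integrable_inner[OF comp(2) test_functions_L2(1)[OF D \<phi>]] by simp_all
    then show "(\<integral>x. (g x $ i - g' x $ i) * \<phi> x \<partial>lebesgue_on D) = 0"
      using has_weak_gradD(3)[OF assms(3) \<phi>, of i] has_weak_gradD(3)[OF assms(4) \<phi>, of i]
      by (simp add: left_diff_distrib)
  qed
  then have "AE x in lebesgue_on D. g x $ i = g' x $ i" for i
    using D by (simp add: AE_restrict_space_iff)
  then show ?thesis unfolding vec_eq_iff AE_all_countable by blast
qed

lemma H10_scalarE:
  assumes "u \<in> H10_scalar D"
  obtains \<phi> :: "nat \<Rightarrow> real^'n \<Rightarrow> real" where "\<And>k. \<phi> k \<in> test_functions D"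
     "(\<lambda>k. l2_norm D (\<lambda>x. \<phi> k x - u x)) \<longlonglongrightarrow> 0"
     "(\<lambda>k. l2_norm D (\<lambda>x. pgrad (\<phi> k) x - wgrad D u x)) \<longlonglongrightarrow> 0"
  using assms unfolding H10_scalar_def by auto

lemma H10_scalar_H1: "u \<in> H10_scalar D \<Longrightarrow> u \<in> H1_space D"
  by (simp add: H10_scalar_def)

lemma H10_scalar_has_weak_grad: "u \<in> H10_scalar D \<Longrightarrow> has_weak_grad D u (wgrad D u)"
  by (intro H1_has_weak_grad H10_scalar_H1)

text \<open>Approximating \<open>u\<close> by test functions \<open>\<phi>\<^sub>k\<close> turns the product rule into the weak
  derivative of \<open>w\<close> tested against \<open>\<phi>\<^sub>k \<phi>\<close>.\<close>

lemma has_weak_grad_mult: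
  fixes D :: "(real^'n) set"
  assumes D: "D \<in> sets lebesgue" and u: "u \<in> H10_scalar D" and w: "has_weak_grad D w g"
    and bounded: "AE x in lebesgue_on D. \<bar>u x\<bar> \<le> B" "AE x in lebesgue_on D. \<bar>w x\<bar> \<le> B"
  shows "has_weak_grad D (\<lambda>x. u x * w x) (\<lambda>x. u x *\<^sub>R g x + w x *\<^sub>R wgrad D u x)"
  unfolding has_weak_grad_def
proof (intro conjI ballI allI)
  have uw: "has_weak_grad D u (wgrad D u)" by (rule H10_scalar_has_weak_grad[OF u])
  note L2 = has_weak_gradD(1,2)[OF uw] has_weak_gradD(1,2)[OF w]
  note meas = L2[THEN L2_spaceD(1)]
  show "(\<lambda>x. u x * w x) \<in> L2_space D"
    using L2_scaleR_bounded[OF L2(3) meas(1) bounded(1)] by simp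
  have L2_1: "(\<lambda>x. u x *\<^sub>R g x) \<in> L2_space D" "(\<lambda>x. w x *\<^sub>R wgrad D u x) \<in> L2_space D"
    by (rule L2_scaleR_bounded[OF L2(4) meas(1) bounded(1)], rule L2_scaleR_bounded[OF L2(2) meas(3) bounded(2)])
  then show "(\<lambda>x. u x *\<^sub>R g x + w x *\<^sub>R wgrad D u x) \<in> L2_space D"
    by (rule L2_add)
  fix \<phi> i assume \<phi>: "\<phi> \<in> test_functions D"
  note \<phi>L2 = test_functions_L2[OF D \<phi>]
  obtain C where C: "\<And>x. \<bar>\<phi> x\<bar> \<le> C" "\<And>x i. \<bar>pgrad \<phi> x $ i\<bar> \<le> C"
    using test_functions_bounded[OF \<phi>] by metis
  have m\<phi>: "\<phi> \<in> borel_measurable (lebesgue_on D)" "(\<lambda>x. pgrad \<phi> x $ i) \<in> borel_measurable (lebesgue_on D)"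
    by (rule L2_spaceD(1)[OF \<phi>L2(1)], rule L2_spaceD(1)[OF L2_component[OF \<phi>L2(2)]])
  obtain e where e: "\<And>k. e k \<in> test_functions D"
     "(\<lambda>k. l2_norm D (\<lambda>x. e k x - u x)) \<longlonglongrightarrow> 0"
     "(\<lambda>k. l2_norm D (\<lambda>x. pgrad (e k) x - wgrad D u x)) \<longlonglongrightarrow> 0"
    using u by (rule H10_scalarE) blast
  \<comment> \<open>\<open>a\<close> and \<open>b\<close> collect everything that u and its gradient
    are paired with: the claim becomes (u, a) + (grad u, b) = 0. Both are square-integrable because
    the test function and w are bounded, so the expression is continuous in u for the H1 norm and
    passes to the limit.\<close>
  define a where "a x = pgrad \<phi> x $ i *\<^sub>R w x + \<phi> x *\<^sub>R g x $ i" for x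
  define b where "b x = axis i (\<phi> x *\<^sub>R w x)" for x
  have aL2: "a \<in> L2_space D" "(\<lambda>x. pgrad \<phi> x $ i *\<^sub>R w x) \<in> L2_space D" "(\<lambda>x. \<phi> x *\<^sub>R g x $ i) \<in> L2_space D"
    unfolding a_def
    by (intro L2_add L2_scaleR_bounded[of _ _ _ C] L2 L2_component[OF L2(4)] m\<phi> AE_I2 C)+
  have bL2: "b \<in> L2_space D"
  proof (rule L2_vec)
    show "(\<lambda>x. b x $ j) \<in> L2_space D" for j
      using L2_scaleR_bounded[OF L2(3) m\<phi>(1), of C] C(1) L2_scaleR_const[OF L2(3), of 0]
      by (cases "i = j") (auto simp: b_def axis_def)
  qed
  have zero: "l2_inner D (e k) a + l2_inner D (pgrad (e k)) b = 0" for k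
  proof -
    note eL2 = test_functions_L2[OF D e(1)[of k]]
    have diff: "e k differentiable (at x)" "\<phi> differentiable (at x)" for x
      by (intro smooth_differentiable test_functions_smooth[OF e(1)] test_functions_smooth[OF \<phi>])+
    have "(\<lambda>x. e k x * \<phi> x) \<in> test_functions D"
      by (intro test_functions_mult test_functions_smooth[OF e(1)] \<phi>)
    from has_weak_gradD(3)[OF w this, of i]
    have 1: "(\<integral>x. w x * (e k x * pgrad \<phi> x $ i + \<phi> x * pgrad (e k) x $ i) \<partial>lebesgue_on D)
      = - (\<integral>x. g x $ i * (e k x * \<phi> x) \<partial>lebesgue_on D)"
      by (simp add: pgrad_mult[OF diff])
    have 2: "integrable (lebesgue_on D) (\<lambda>x. e k x * (pgrad \<phi> x $ i * w x))"
        "integrable (lebesgue_on D) (\<lambda>x. e k x * (\<phi> x * g x $ i))"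
        "integrable (lebesgue_on D) (\<lambda>x. pgrad (e k) x $ i * (\<phi> x * w x))"
      using L2_integrable_inner[OF eL2(1) aL2(2)] L2_integrable_inner[OF eL2(1) aL2(3)]
        L2_integrable_inner[OF eL2(2) bL2] by (simp_all add: b_def inner_axis)
    have "l2_inner D (e k) a + l2_inner D (pgrad (e k)) b =
       (\<integral>x. e k x * (pgrad \<phi> x $ i * w x) \<partial>lebesgue_on D) + (\<integral>x. e k x * (\<phi> x * g x $ i) \<partial>lebesgue_on D)
       + (\<integral>x. pgrad (e k) x $ i * (\<phi> x * w x) \<partial>lebesgue_on D)"
      using 2 by (simp add: l2_inner_def a_def b_def inner_axis distrib_left)
    also have "\<dots> = (\<integral>x. w x * (e k x * pgrad \<phi> x $ i + \<phi> x * pgrad (e k) x $ i) \<partial>lebesgue_on D)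
       + (\<integral>x. g x $ i * (e k x * \<phi> x) \<partial>lebesgue_on D)"
      using 2 by (simp add: distrib_left ac_simps)
    finally show ?thesis using 1 by simp
  qed
  have "(\<lambda>k. l2_inner D (e k) a + l2_inner D (pgrad (e k)) b) \<longlonglongrightarrow> l2_inner D u a + l2_inner D (wgrad D u) b"
    using test_functions_L2[OF D e(1)] by (intro tendsto_add l2_inner_tendsto L2 aL2 bL2 e(2,3))
  with zero have lim: "l2_inner D u a + l2_inner D (wgrad D u) b = 0"
    by (simp add: LIMSEQ_const_iff)
  have 2: "integrable (lebesgue_on D) (\<lambda>x. u x * (pgrad \<phi> x $ i * w x))"
      "integrable (lebesgue_on D) (\<lambda>x. u x * (\<phi> x * g x $ i))"
      "integrable (lebesgue_on D) (\<lambda>x. wgrad D u x $ i * (\<phi> x * w x))"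
    using L2_integrable_inner[OF L2(1) aL2(2)] L2_integrable_inner[OF L2(1) aL2(3)]
      L2_integrable_inner[OF L2(2) bL2] by (simp_all add: b_def inner_axis)
  have "l2_inner D u a + l2_inner D (wgrad D u) b =
      (\<integral>x. u x * (pgrad \<phi> x $ i * w x) \<partial>lebesgue_on D) + (\<integral>x. u x * (\<phi> x * g x $ i) \<partial>lebesgue_on D)
       + (\<integral>x. wgrad D u x $ i * (\<phi> x * w x) \<partial>lebesgue_on D)"
    using 2 by (simp add: l2_inner_def a_def b_def inner_axis distrib_left)
  also have "\<dots> = (\<integral>x. u x * w x * pgrad \<phi> x $ i \<partial>lebesgue_on D)
      + (\<integral>x. (u x *\<^sub>R g x + w x *\<^sub>R wgrad D u x) $ i * \<phi> x \<partial>lebesgue_on D)"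
    using 2 by (simp add: distrib_left distrib_right ac_simps)
  finally show "(\<integral>x. u x * w x * pgrad \<phi> x $ i \<partial>lebesgue_on D)
      = - (\<integral>x. (u x *\<^sub>R g x + w x *\<^sub>R wgrad D u x) $ i * \<phi> x \<partial>lebesgue_on D)"
    using lim by simp
qed

text \<open>Integrating the derivative of \<open>x\<^sub>i \<phi>\<^sup>2\<close> over \<open>D\<close>.\<close>

lemma Poincare_test_function:
  fixes D :: "(real^'n) set"
  assumes D: "D \<in> sets lebesgue" and R: "\<And>x. x \<in> D \<Longrightarrow> norm x \<le> R" "R \<ge> 0"
    and \<phi>: "\<phi> \<in> test_functions D"
  shows "l2_norm D \<phi> \<le> 2 * R * l2_norm D (pgrad \<phi>)"
proof (rule power2_le_imp_le)
  \<comment> \<open>Any coordinate direction serves; the index type is nonempty.\<close>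
  obtain i :: 'n where True by simp
  note L2 = test_functions_L2[OF D \<phi>]
  have sm: "smooth \<phi>" by (rule test_functions_smooth[OF \<phi>])
  have diff: "\<phi> differentiable (at x)" "(\<lambda>x. x $ i) differentiable (at x)"
      "(\<lambda>x. x $ i * \<phi> x) differentiable (at x)" for x
    by (intro smooth_differentiable sm smooth_coord smooth_mult)+
  have "(\<lambda>x. x $ i * \<phi> x * \<phi> x) \<in> test_functions D"
    by (intro test_functions_mult \<phi> smooth_mult smooth_coord sm)
  note * = integral_pgrad_test[OF D this, of i]
  have eq: "pgrad (\<lambda>x. x $ i * \<phi> x * \<phi> x) x $ i = (norm (\<phi> x))\<^sup>2 + 2 * x $ i * \<phi> x * pgrad \<phi> x $ i" for x
    unfolding pgrad_mult[OF diff(3,1)] pgrad_mult[OF diff(2,1)]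
    by (simp add: power2_eq_square algebra_simps axis_def)
  have i1: "integrable (lebesgue_on D) (\<lambda>x. (norm (\<phi> x))\<^sup>2)" "integrable (lebesgue_on D) (\<lambda>x. (norm (pgrad \<phi> x))\<^sup>2)"
    using L2[THEN L2_spaceD(2)] .
  have i2: "integrable (lebesgue_on D) (\<lambda>x. - (2 * x $ i * \<phi> x * pgrad \<phi> x $ i))"
    using Bochner_Integration.integrable_diff[OF i1(1) *(1)] by (simp add: eq)
  have "(\<integral>x. (norm (\<phi> x))\<^sup>2 \<partial>lebesgue_on D) = (\<integral>x. - (2 * x $ i * \<phi> x * pgrad \<phi> x $ i) \<partial>lebesgue_on D)"
    using *(2) Bochner_Integration.integral_diff[OF *(1) i1(1)] by (simp add: eq)
  \<comment> \<open>Young's inequality with weight 1/2 lets half of the squared norm of \<phi>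
    return to the left, and |x_i| \<le> R on D. Doubling 2 R^2 then yields the factor (2R)^2, the
    origin of P = 2R.\<close>
  also have "\<dots> \<le> (\<integral>x. (norm (\<phi> x))\<^sup>2 / 2 + 2 * R\<^sup>2 * (norm (pgrad \<phi> x))\<^sup>2 \<partial>lebesgue_on D)"
  proof (rule integral_mono[OF i2])
    show "integrable (lebesgue_on D) (\<lambda>x. (norm (\<phi> x))\<^sup>2 / 2 + 2 * R\<^sup>2 * (norm (pgrad \<phi> x))\<^sup>2)"
      using i1 by simp
    fix x assume "x \<in> space (lebesgue_on D)"
    then have "\<bar>x $ i\<bar> \<le> R" using R(1)[of x] Finite_Cartesian_Product.norm_nth_le[of x i] by simp
    moreover have "\<bar>pgrad \<phi> x $ i\<bar> \<le> norm (pgrad \<phi> x)" using Finite_Cartesian_Product.norm_nth_le[of "pgrad \<phi> x" i] by simp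
    ultimately have "\<bar>x $ i * pgrad \<phi> x $ i\<bar> \<le> R * norm (pgrad \<phi> x)"
      unfolding abs_mult by (intro mult_mono) auto
    then have "(x $ i * pgrad \<phi> x $ i)\<^sup>2 \<le> (R * norm (pgrad \<phi> x))\<^sup>2"
      by (metis abs_ge_zero power2_abs power_mono)
    moreover have "- (2 * a * b * c) \<le> b\<^sup>2 / 2 + 2 * (a * c)\<^sup>2" for a b c :: real
      using zero_le_power2[of "b + 2 * (a * c)"] by (simp add: power2_sum algebra_simps)
    note this[of "x $ i" "\<phi> x" "pgrad \<phi> x $ i"]
    ultimately show "- (2 * x $ i * \<phi> x * pgrad \<phi> x $ i) \<le> (norm (\<phi> x))\<^sup>2 / 2 + 2 * R\<^sup>2 * (norm (pgrad \<phi> x))\<^sup>2"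
      by (simp add: power_mult_distrib)
  qed
  also have "\<dots> = (\<integral>x. (norm (\<phi> x))\<^sup>2 \<partial>lebesgue_on D) / 2 + 2 * R\<^sup>2 * (\<integral>x. (norm (pgrad \<phi> x))\<^sup>2 \<partial>lebesgue_on D)"
    using i1 by simp
  finally show "(l2_norm D \<phi>)\<^sup>2 \<le> (2 * R * l2_norm D (pgrad \<phi>))\<^sup>2"
    by (simp add: power_mult_distrib l2_norm_sq)
qed (use R(2) in simp)

text \<open>The approximating test functions converge to u together with their gradients, so both
  sides of their inequality pass to the limit.\<close>

lemma Poincare_scalar:
  fixes D :: "(real^'n) set"
  assumes D: "D \<in> sets lebesgue" and R: "\<And>x. x \<in> D \<Longrightarrow> norm x \<le> R" "R \<ge> 0"
    and u: "u \<in> H10_scalar D"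
  shows "l2_norm D u \<le> 2 * R * l2_norm D (wgrad D u)"
proof -
  note L2 = has_weak_gradD(1,2)[OF H10_scalar_has_weak_grad[OF u]]
  obtain e where e: "\<And>k. e k \<in> test_functions D"
     "(\<lambda>k. l2_norm D (\<lambda>x. e k x - u x)) \<longlonglongrightarrow> 0"
     "(\<lambda>k. l2_norm D (\<lambda>x. pgrad (e k) x - wgrad D u x)) \<longlonglongrightarrow> 0"
    using u by (rule H10_scalarE) blast
  have sym: "l2_norm D (\<lambda>x. f x - h x) = l2_norm D (\<lambda>x. h x - f x)" for f h :: "real^'n \<Rightarrow> real"
    by (simp add: l2_norm_def l2_inner_def algebra_simps)
  have "l2_norm D u \<le> 2 * R * (l2_norm D (wgrad D u) + l2_norm D (\<lambda>x. pgrad (e k) x - wgrad D u x))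
      + l2_norm D (\<lambda>x. e k x - u x)" for k
  proof -
    note eL2 = test_functions_L2[OF D e(1)[of k]]
    have "l2_norm D u \<le> l2_norm D (e k) + l2_norm D (\<lambda>x. e k x - u x)"
      using l2_norm_triangle[OF L2(1) eL2(1)] by (simp add: sym[of u])
    moreover have "l2_norm D (e k) \<le> 2 * R * l2_norm D (pgrad (e k))"
      by (rule Poincare_test_function[OF D R e(1)])
    moreover have "2 * R * l2_norm D (pgrad (e k)) \<le> 2 * R * (l2_norm D (wgrad D u) + l2_norm D (\<lambda>x. pgrad (e k) x - wgrad D u x))"
      using R(2) l2_norm_triangle[OF eL2(2) L2(2)] by (intro mult_left_mono) auto
    ultimately show ?thesis by linarith
  qed
  moreover have "(\<lambda>k. 2 * R * (l2_norm D (wgrad D u) + l2_norm D (\<lambda>x. pgrad (e k) x - wgrad D u x))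
      + l2_norm D (\<lambda>x. e k x - u x)) \<longlonglongrightarrow> 2 * R * (l2_norm D (wgrad D u) + 0) + 0"
    by (intro tendsto_add tendsto_mult tendsto_const e(2,3))
  ultimately have "l2_norm D u \<le> 2 * R * (l2_norm D (wgrad D u) + 0) + 0"
    by (intro LIMSEQ_le_const) blast+
  then show ?thesis by simp
qed

lemma H10_space_component: "v \<in> H10_space D \<Longrightarrow> (\<lambda>x. v x $ i) \<in> H10_scalar D"
  by (simp add: H10_space_def)

lemma H10_space_L2:
  assumes "v \<in> H10_space D" shows "v \<in> L2_space D" "grad D v \<in> L2_space D"
proof -
  have "(\<lambda>x. v x $ i) \<in> L2_space D" "(\<lambda>x. grad D v x $ i) \<in> L2_space D" for i
    using has_weak_gradD(1,2)[OF H10_scalar_has_weak_grad[OF H10_space_component[OF assms]]]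
    by (simp_all add: grad_def)
  then show "v \<in> L2_space D" "grad D v \<in> L2_space D" by (auto intro: L2_vec)
qed

lemma l2_norm_vec_sq:
  fixes f :: "real^'n \<Rightarrow> 'b::euclidean_space^'m"
  assumes "f \<in> L2_space D"
  shows "(l2_norm D f)\<^sup>2 = (\<Sum>i\<in>UNIV. (l2_norm D (\<lambda>x. f x $ i))\<^sup>2)"
  unfolding l2_norm_sq norm_vec_sq
  using L2_spaceD(2)[OF L2_component[OF assms]] by (simp add: Bochner_Integration.integral_sum)

text \<open>The Frobenius norm makes the squared norm of \<open>grad\<close> the sum over its rows,
  so summing over components leaves the constant unchanged.\<close>

lemma Poincare:
  fixes D :: "(real^'n) set"
  assumes D: "D \<in> sets lebesgue" and R: "\<And>x. x \<in> D \<Longrightarrow> norm x \<le> R" "R \<ge> 0"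
    and v: "v \<in> H10_space D"
  shows "(l2_norm D v)\<^sup>2 \<le> (2 * R)\<^sup>2 * (l2_norm D (grad D v))\<^sup>2"
proof -
  have "(l2_norm D (\<lambda>x. v x $ i))\<^sup>2 \<le> (2 * R)\<^sup>2 * (l2_norm D (\<lambda>x. grad D v x $ i))\<^sup>2" for i
  proof -
    have "l2_norm D (\<lambda>x. v x $ i) \<le> 2 * R * l2_norm D (\<lambda>x. grad D v x $ i)"
      using Poincare_scalar[OF D R H10_space_component[OF v]] by (simp add: grad_def)
    then have "(l2_norm D (\<lambda>x. v x $ i))\<^sup>2 \<le> (2 * R * l2_norm D (\<lambda>x. grad D v x $ i))\<^sup>2"
      by (intro power_mono) auto
    then show ?thesis by (simp add: power_mult_distrib)
  qed
  then have "(\<Sum>i\<in>UNIV. (l2_norm D (\<lambda>x. v x $ i))\<^sup>2) \<le> (\<Sum>i\<in>UNIV. (2 * R)\<^sup>2 * (l2_norm D (\<lambda>x. grad D v x $ i))\<^sup>2)"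
    by (rule sum_mono)
  then show ?thesis
    by (simp add: l2_norm_vec_sq[OF H10_space_L2(1)[OF v]] l2_norm_vec_sq[OF H10_space_L2(2)[OF v]] sum_distrib_left)
qed

section \<open>Finite element functions and convection\<close>

lemma polytopal_domain_facts:
  assumes "convex_polytopal_domain D"
  shows "open D" "bounded D" "D \<noteq> {}" "D \<in> lmeasurable" "D \<in> sets lebesgue"
proof -
  show *: "open D" "D \<noteq> {}" using assms by (auto simp: convex_polytopal_domain_def)
  show "bounded D"
    using assms bounded_subset[OF polytope_imp_bounded closure_subset, of D]
    by (simp add: convex_polytopal_domain_def)
  with * show "D \<in> lmeasurable" by (intro lmeasurable_open) auto
  then show "D \<in> sets lebesgue" by auto
qed

lemma triangulation_cells:
  assumes "regular_triangulation D h \<sigma> \<T>"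
  shows "finite \<T>" "D \<subseteq> \<Union>\<T>" "K \<in> \<T> \<Longrightarrow> compact K" "K \<in> \<T> \<Longrightarrow> convex K" "K \<in> \<T> \<Longrightarrow> K \<in> sets lebesgue"
proof -
  show "finite \<T>" "D \<subseteq> \<Union>\<T>"
    using assms closure_subset unfolding regular_triangulation_def triangulation_def by blast+
  assume "K \<in> \<T>"
  then obtain n where "n simplex K"
    using assms unfolding regular_triangulation_def triangulation_def by blast
  then show c: "compact K" "convex K" by (auto intro: compact_simplex convex_simplex)
  then show "K \<in> sets lebesgue" by (intro fmeasurableD lmeasurable_compact)
qed

text \<open>The cells are finitely many and cover D, so the cellwise bounds add up to a global one;
  the absolute values prevent other summands from lowering it.\<close>

lemma AE_on_cells:
  fixes u :: "real^'n \<Rightarrow> real"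
  assumes "regular_triangulation D h \<sigma> \<T>" "D \<in> sets lebesgue"
    and cells: "\<And>K. K \<in> \<T> \<Longrightarrow> \<exists>B. AE x in lebesgue. x \<in> K \<inter> D \<longrightarrow> \<bar>u x\<bar> \<le> B"
  obtains B where "AE x in lebesgue_on D. \<bar>u x\<bar> \<le> B"
proof -
  note T = triangulation_cells[OF assms(1)]
  obtain B where B: "\<And>K. K \<in> \<T> \<Longrightarrow> AE x in lebesgue. x \<in> K \<inter> D \<longrightarrow> \<bar>u x\<bar> \<le> B K"
    using cells by metis
  have "AE x in lebesgue. \<forall>K\<in>\<T>. x \<in> K \<inter> D \<longrightarrow> \<bar>u x\<bar> \<le> B K"
    by (rule AE_finite_allI[OF T(1) B])
  then have "AE x in lebesgue. x \<in> D \<longrightarrow> \<bar>u x\<bar> \<le> (\<Sum>K\<in>\<T>. \<bar>B K\<bar>)"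
  proof eventually_elim
    fix x assume *: "\<forall>K\<in>\<T>. x \<in> K \<inter> D \<longrightarrow> \<bar>u x\<bar> \<le> B K"
    show "x \<in> D \<longrightarrow> \<bar>u x\<bar> \<le> (\<Sum>K\<in>\<T>. \<bar>B K\<bar>)"
    proof
      assume "x \<in> D"
      then obtain K where K: "K \<in> \<T>" "x \<in> K" using T(2) by blast
      then have "\<bar>u x\<bar> \<le> \<bar>B K\<bar>" using * \<open>x \<in> D\<close> by fastforce
      also have "\<dots> \<le> (\<Sum>K\<in>\<T>. \<bar>B K\<bar>)" by (rule member_le_sum[OF K(1)]) (auto simp: T(1))
      finally show "\<bar>u x\<bar> \<le> (\<Sum>K\<in>\<T>. \<bar>B K\<bar>)" .
    qed
  qed
  then show ?thesis using assms(2) that by (simp add: AE_restrict_space_iff)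
qed

lemma continuous_bounded_on:
  fixes f :: "'a::heine_borel \<Rightarrow> real"
  assumes "continuous_on UNIV f" "bounded S"
  obtains B where "B \<ge> 0" "\<And>x. x \<in> S \<Longrightarrow> \<bar>f x\<bar> \<le> B"
proof -
  have "compact (f ` closure S)"
    using assms by (meson compact_closure compact_continuous_image continuous_on_subset subset_UNIV)
  then obtain B where "B > 0" "\<And>x. x \<in> closure S \<Longrightarrow> \<bar>f x\<bar> \<le> B"
    using compact_imp_bounded bounded_pos by (metis image_eqI real_norm_def)
  then show ?thesis using that[of B] closure_subset[of S] by auto
qed

lemma L2_continuous:
  fixes f :: "real^'n \<Rightarrow> real"
  assumes "bounded D" "D \<in> lmeasurable" "continuous_on UNIV f"
  shows "f \<in> L2_space D"
proof -
  obtain B where B: "B \<ge> 0" "\<And>x. x \<in> D \<Longrightarrow> \<bar>f x\<bar> \<le> B"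
    by (rule continuous_bounded_on[OF assms(3,1)]) blast
  have "finite_measure (lebesgue_on D)"
    using assms(2) by (auto intro!: finite_measureI simp: emeasure_restrict_space fmeasurable_def)
  then have "integrable (lebesgue_on D) (\<lambda>x. B\<^sup>2)" by (rule finite_measure.integrable_const)
  then show ?thesis
  proof (rule L2_spaceI[OF continuous_measurable_lebesgue_on[OF assms(3)]])
    show "AE x in lebesgue_on D. (norm (f x))\<^sup>2 \<le> B\<^sup>2"
      using B(2) by (intro AE_I2 power_mono) auto
  qed
qed

lemma piecewise_polynomial_bounded:
  assumes T: "regular_triangulation D h \<sigma> \<T>" and D: "D \<in> sets lebesgue"
    and u: "piecewise_polynomial \<T> k u"
  obtains B where "AE x in lebesgue_on D. \<bar>u x\<bar> \<le> B"
proof (rule AE_on_cells[OF T D])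
  fix K assume K: "K \<in> \<T>"
  note cell = triangulation_cells(3-5)[OF T K]
  obtain p where p: "polynomial_le k p" "AE x in lebesgue_on K. u x = p x"
    using u K unfolding piecewise_polynomial_def by blast
  obtain B where "\<And>x. x \<in> K \<Longrightarrow> \<bar>p x\<bar> \<le> B"
    by (rule continuous_bounded_on[OF smooth_continuous[OF smooth_polynomial[OF p(1)]] compact_imp_bounded[OF cell(1)]])
      blast
  moreover have "AE x in lebesgue. x \<in> K \<longrightarrow> u x = p x"
    using p(2) cell(3) by (simp add: AE_restrict_space_iff)
  ultimately show "\<exists>B. AE x in lebesgue. x \<in> K \<inter> D \<longrightarrow> \<bar>u x\<bar> \<le> B"
    by (intro exI[of _ B]) (auto elim!: eventually_mono)
qed

lemma fe_vector_bounded: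
  assumes T: "regular_triangulation D h \<sigma> \<T>" and D: "D \<in> sets lebesgue"
    and V: "fe_vector_space \<T> V" "v \<in> V"
  obtains B where "B \<ge> 0" "AE x in lebesgue_on D. norm (v x) \<le> B"
proof -
  obtain k where k: "\<And>i. piecewise_polynomial \<T> k (\<lambda>x. v x $ i)"
    using V unfolding fe_vector_space_def by blast
  have "\<exists>B. AE x in lebesgue_on D. \<bar>v x $ i\<bar> \<le> B" for i
    by (rule piecewise_polynomial_bounded[OF T D k[of i]]) blast
  then obtain B where B: "\<And>i. AE x in lebesgue_on D. \<bar>v x $ i\<bar> \<le> B i"
    by metis
  then have "AE x in lebesgue_on D. \<forall>i. \<bar>v x $ i\<bar> \<le> B i"
    unfolding AE_all_countable by blast
  then have "AE x in lebesgue_on D. norm (v x) \<le> (\<Sum>i\<in>UNIV. \<bar>B i\<bar>)"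
  proof eventually_elim
    fix x assume *: "\<forall>i. \<bar>v x $ i\<bar> \<le> B i"
    have "norm (v x) \<le> (\<Sum>i\<in>UNIV. \<bar>v x $ i\<bar>)" by (rule norm_le_l1_cart)
    also have "\<dots> \<le> (\<Sum>i\<in>UNIV. \<bar>B i\<bar>)" by (rule sum_mono) (use * abs_ge_self order_trans in blast)
    finally show "norm (v x) \<le> (\<Sum>i\<in>UNIV. \<bar>B i\<bar>)" .
  qed
  then show ?thesis by (intro that[of "\<Sum>i\<in>UNIV. \<bar>B i\<bar>"]) (auto intro: sum_nonneg)
qed

lemma has_weak_divD:
  assumes "has_weak_div D v g"
  shows "v \<in> L2_space D" "g \<in> L2_space D"
    "\<phi> \<in> test_functions D \<Longrightarrow>
      (\<integral>x. v x \<bullet> pgrad \<phi> x \<partial>(lebesgue_on D)) = - (\<integral>x. g x * \<phi> x \<partial>(lebesgue_on D))"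
  using assms unfolding has_weak_div_def by auto

text \<open>A test function supported in U sees only p, and for p integration by parts is the
  vanishing of the integral of a derivative of p_i \<phi>. The fundamental lemma on U then
  identifies g with the classical divergence.\<close>

lemma weak_div_eq_classical:
  fixes D :: "(real^'n) set"
  assumes D: "bounded D" "D \<in> lmeasurable" and g: "has_weak_div D v g"
    and U: "open U" "U \<subseteq> D" and p: "\<And>i. smooth (p i)"
    and vp: "\<And>i. AE x in lebesgue. x \<in> U \<longrightarrow> v x $ i = p i x"
  shows "AE x in lebesgue. x \<in> U \<longrightarrow> g x = (\<Sum>i\<in>UNIV. pgrad (p i) x $ i)"
proof -
  have Ds: "D \<in> sets lebesgue" using D by auto
  define q where "q x = (\<Sum>i\<in>UNIV. pgrad (p i) x $ i)" for x
  have L2: "p i \<in> L2_space D" "(\<lambda>x. pgrad (p i) x $ j) \<in> L2_space D" "q \<in> L2_space D" for i j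
    unfolding q_def
    by (intro L2_continuous D smooth_continuous smooth_sum smooth_pgrad p)+
  have "AE x in lebesgue. x \<in> U \<longrightarrow> g x - q x = 0"
  proof (rule fundamental_lemma[OF Ds _ U])
    show "integrable (lebesgue_on D) (\<lambda>x. g x - q x)"
      by (intro L2_integrable L2_diff L2 D has_weak_divD(2)[OF g])
    fix \<phi> assume \<phi>U: "\<phi> \<in> test_functions U"
    then have \<phi>: "\<phi> \<in> test_functions D" using U(2) by (rule test_functions_mono)
    note \<phi>L2 = test_functions_L2[OF Ds \<phi>]
    obtain K where K: "compact K" "K \<subseteq> U" "\<And>x. x \<notin> K \<Longrightarrow> \<phi> x = 0" "\<And>x. x \<notin> K \<Longrightarrow> pgrad \<phi> x = 0"
      using test_functions_support[OF \<phi>U] by metis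
    have i1: "integrable (lebesgue_on D) (\<lambda>x. p i x * pgrad \<phi> x $ i)"
        "integrable (lebesgue_on D) (\<lambda>x. pgrad (p i) x $ i * \<phi> x)" for i
      using L2_integrable_inner[OF L2(1) L2_component[OF \<phi>L2(2)]] L2_integrable_inner[OF L2(2) \<phi>L2(1)] by simp_all
    have parts: "(\<integral>x. p i x * pgrad \<phi> x $ i \<partial>lebesgue_on D) = - (\<integral>x. pgrad (p i) x $ i * \<phi> x \<partial>lebesgue_on D)" for i
    proof -
      have diff: "p i differentiable (at x)" "\<phi> differentiable (at x)" for x
        by (intro smooth_differentiable p test_functions_smooth[OF \<phi>])+
      have "(\<integral>x. pgrad (\<lambda>x. p i x * \<phi> x) x $ i \<partial>lebesgue_on D) = 0"
        by (intro integral_pgrad_test Ds test_functions_mult p \<phi>)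
      then have "(\<integral>x. p i x * pgrad \<phi> x $ i + \<phi> x * pgrad (p i) x $ i \<partial>lebesgue_on D) = 0"
        by (simp add: pgrad_mult[OF diff])
      with i1[of i] show ?thesis by (simp add: mult.commute)
    qed
    have "AE x in lebesgue. \<forall>i. x \<in> U \<longrightarrow> v x $ i = p i x"
      unfolding AE_all_countable using vp by blast
    then have ae: "AE x in lebesgue. v x \<bullet> pgrad \<phi> x = (\<Sum>i\<in>UNIV. p i x * pgrad \<phi> x $ i)"
    proof eventually_elim
      fix x assume "\<forall>i. x \<in> U \<longrightarrow> v x $ i = p i x"
      then show "v x \<bullet> pgrad \<phi> x = (\<Sum>i\<in>UNIV. p i x * pgrad \<phi> x $ i)"
        using K(2) K(4)[of x] by (cases "x \<in> K") (auto simp: inner_vec_def)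
    qed
    have "(\<integral>x. v x \<bullet> pgrad \<phi> x \<partial>lebesgue_on D) = (\<integral>x. (\<Sum>i\<in>UNIV. p i x * pgrad \<phi> x $ i) \<partial>lebesgue_on D)"
    proof (rule integral_cong_AE)
      show "(\<lambda>x. v x \<bullet> pgrad \<phi> x) \<in> borel_measurable (lebesgue_on D)"
        using L2_integrable_inner[OF has_weak_divD(1)[OF g] \<phi>L2(2)] by simp
      show "(\<lambda>x. \<Sum>i\<in>UNIV. p i x * pgrad \<phi> x $ i) \<in> borel_measurable (lebesgue_on D)"
        using i1(1) by (intro borel_measurable_sum borel_measurable_integrable)
      show "AE x in lebesgue_on D. v x \<bullet> pgrad \<phi> x = (\<Sum>i\<in>UNIV. p i x * pgrad \<phi> x $ i)"
        using ae Ds by (simp add: AE_restrict_space_iff) (auto elim: eventually_mono)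
    qed
    also have "\<dots> = - (\<integral>x. q x * \<phi> x \<partial>lebesgue_on D)"
      using i1 by (simp add: q_def sum_distrib_right Bochner_Integration.integral_sum parts sum_negf)
    finally have "(\<integral>x. g x * \<phi> x \<partial>lebesgue_on D) = (\<integral>x. q x * \<phi> x \<partial>lebesgue_on D)"
      using has_weak_divD(3)[OF g \<phi>] by simp
    moreover have "integrable (lebesgue_on D) (\<lambda>x. g x * \<phi> x)" "integrable (lebesgue_on D) (\<lambda>x. q x * \<phi> x)"
      using L2_integrable_inner[OF has_weak_divD(2)[OF g] \<phi>L2(1)] L2_integrable_inner[OF L2(3) \<phi>L2(1)] by simp_all
    ultimately show "(\<integral>x. (g x - q x) * \<phi> x \<partial>lebesgue_on D) = 0"
      by (simp add: left_diff_distrib)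
  qed
  then show ?thesis by (simp add: q_def)
qed

text \<open>Needed because \<open>linf_norm\<close> of an essentially unbounded function is the junk value \<open>0\<close>.\<close>

lemma fe_weak_div_bounded:
  fixes D :: "(real^'n) set"
  assumes T: "regular_triangulation D h \<sigma> \<T>" and D: "open D" "bounded D" "D \<in> lmeasurable"
    and V: "fe_vector_space \<T> V" "v \<in> V" and g: "has_weak_div D v g"
  obtains B where "AE x in lebesgue_on D. \<bar>g x\<bar> \<le> B"
proof -
  have Ds: "D \<in> sets lebesgue" using D by auto
  obtain k where k: "\<And>i. piecewise_polynomial \<T> k (\<lambda>x. v x $ i)"
    using V unfolding fe_vector_space_def by blast
  show ?thesis
  proof (rule AE_on_cells[OF T Ds])
    fix K assume K: "K \<in> \<T>"
    note cell = triangulation_cells(3-5)[OF T K]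
    have "\<exists>p. polynomial_le k p \<and> (AE x in lebesgue_on K. v x $ i = p x)" for i
      using k[of i] K unfolding piecewise_polynomial_def by blast
    then obtain p where p: "\<And>i. polynomial_le k (p i)" "\<And>i. AE x in lebesgue_on K. v x $ i = p i x"
      by metis
    have smp: "smooth (p i)" for i by (rule smooth_polynomial[OF p(1)])
    \<comment> \<open>Test functions need an open set, hence the passage from the closed cell to its
      interior.\<close>
    have vp: "AE x in lebesgue. x \<in> interior K \<inter> D \<longrightarrow> v x $ i = p i x" for i
    proof -
      have "AE x in lebesgue. x \<in> K \<longrightarrow> v x $ i = p i x"
        using p(2)[of i] cell(3) by (simp add: AE_restrict_space_iff)
      then show ?thesis
        by eventually_elim (use interior_subset in blast)
    qed
    have cont: "continuous_on UNIV (\<lambda>x. \<Sum>i\<in>UNIV. pgrad (p i) x $ i)"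
      by (intro smooth_continuous smooth_sum smooth_pgrad smp)
    obtain B where B: "\<And>x. x \<in> D \<Longrightarrow> \<bar>\<Sum>i\<in>UNIV. pgrad (p i) x $ i\<bar> \<le> B"
      by (rule continuous_bounded_on[OF cont D(2)]) blast
    have "AE x in lebesgue. x \<in> interior K \<inter> D \<longrightarrow> g x = (\<Sum>i\<in>UNIV. pgrad (p i) x $ i)"
      by (rule weak_div_eq_classical[OF D(2,3) g _ _ smp vp]) (use D(1) in auto)
    \<comment> \<open>The boundary of a convex set is a null set, so nothing is lost by bounding g
      on the interiors of the cells alone.\<close>
    moreover have "AE x in lebesgue. x \<notin> frontier K"
      using negligible_convex_frontier[OF cell(2)] by (intro AE_not_in) (simp add: negligible_iff_null_sets)
    ultimately have "AE x in lebesgue. x \<in> K \<inter> D \<longrightarrow> \<bar>g x\<bar> \<le> B"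
    proof eventually_elim
      fix x assume *: "x \<in> interior K \<inter> D \<longrightarrow> g x = (\<Sum>i\<in>UNIV. pgrad (p i) x $ i)" "x \<notin> frontier K"
      show "x \<in> K \<inter> D \<longrightarrow> \<bar>g x\<bar> \<le> B"
      proof
        assume x: "x \<in> K \<inter> D"
        then have "x \<in> interior K" using *(2) closure_subset[of K] by (auto simp: frontier_def)
        with x *(1) B[of x] show "\<bar>g x\<bar> \<le> B" by simp
      qed
    qed
    then show "\<exists>B. AE x in lebesgue. x \<in> K \<inter> D \<longrightarrow> \<bar>g x\<bar> \<le> B" by blast
  qed (rule that)
qed

section \<open>Convection and integration by parts\<close>

lemma H1_spaceI: "has_weak_grad D u g \<Longrightarrow> u \<in> H1_space D"
  by (auto simp: H1_space_def)

lemma Y_space_has_weak_div: "v \<in> Y_space D \<Longrightarrow> has_weak_div D v (wdiv D v)"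
  using someI_ex[of "has_weak_div D v"] by (simp add: Y_space_def wdiv_def)

text \<open>Cauchy-Schwarz in each row; \<open>norm\<close> of a matrix is its Frobenius norm
  here.\<close>

lemma norm_matrix_vector_mult_le: "norm ((A::real^'n^'m) *v x) \<le> norm x * norm A"
proof (rule power2_le_imp_le)
  have "(norm ((A *v x) $ i))\<^sup>2 \<le> (norm x)\<^sup>2 * (norm (A $ i))\<^sup>2" for i
  proof -
    have "\<bar>(A *v x) $ i\<bar> \<le> norm x * norm (A $ i)"
      using Cauchy_Schwarz_ineq2[of "A $ i" x] by (simp add: matrix_mult_dot mult.commute)
    then show ?thesis by (simp flip: power_mult_distrib add: abs_le_square_iff[symmetric])
  qed
  then have "(\<Sum>i\<in>UNIV. (norm ((A *v x) $ i))\<^sup>2) \<le> (\<Sum>i\<in>UNIV. (norm x)\<^sup>2 * (norm (A $ i))\<^sup>2)"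
    by (rule sum_mono)
  then show "(norm (A *v x))\<^sup>2 \<le> (norm x * norm A)\<^sup>2"
    by (simp add: norm_vec_sq[of "A *v x"] norm_vec_sq[of A] power_mult_distrib sum_distrib_left)
qed simp

text \<open>The weighted gradient |u| grad v is singled out because its squared norm is what the
  eddy viscosity term bounds from below.\<close>

lemma convect_L2:
  fixes u :: "real^'n \<Rightarrow> real^'n"
  assumes u: "u \<in> borel_measurable (lebesgue_on D)" "AE x in lebesgue_on D. norm (u x) \<le> B"
    and v: "v \<in> H10_space D"
  shows "convect D u v \<in> L2_space D" "(\<lambda>x. norm (u x) *\<^sub>R grad D v x) \<in> L2_space D"
    "l2_norm D (convect D u v) \<le> l2_norm D (\<lambda>x. norm (u x) *\<^sub>R grad D v x)"
proof -
  note g = H10_space_L2(2)[OF v]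
  show L: "(\<lambda>x. norm (u x) *\<^sub>R grad D v x) \<in> L2_space D"
    by (rule L2_scaleR_bounded[OF g, of _ B]) (use u in auto)
  have le: "(norm (convect D u v x))\<^sup>2 \<le> (norm (norm (u x) *\<^sub>R grad D v x))\<^sup>2" for x
    using norm_matrix_vector_mult_le[of "grad D v x" "u x"] by (intro power_mono) (auto simp: convect_def)
  have "(\<lambda>x. grad D v x $ i $ j) \<in> borel_measurable (lebesgue_on D)" for i j
    using L2_spaceD(1)[OF g] by (simp add: measurable_vec_iff)
  moreover have "(\<lambda>x. u x $ j) \<in> borel_measurable (lebesgue_on D)" for j
    using u(1) by (simp add: measurable_vec_iff)
  ultimately have "convect D u v \<in> borel_measurable (lebesgue_on D)"
    unfolding measurable_vec_iff
    by (auto simp: convect_def matrix_vector_mult_def intro!: borel_measurable_sum borel_measurable_times)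
  then show C: "convect D u v \<in> L2_space D"
    by (rule L2_spaceI[OF _ L2_spaceD(2)[OF L]]) (intro AE_I2 le)
  have "(l2_norm D (convect D u v))\<^sup>2 \<le> (l2_norm D (\<lambda>x. norm (u x) *\<^sub>R grad D v x))\<^sup>2"
    unfolding l2_norm_sq by (rule integral_mono[OF L2_spaceD(2)[OF C] L2_spaceD(2)[OF L] le])
  then show "l2_norm D (convect D u v) \<le> l2_norm D (\<lambda>x. norm (u x) *\<^sub>R grad D v x)"
    by (rule power2_le_imp_le) simp
qed

text \<open>The vanishing normal trace of u is tested against the products v_i w_i and the results
  are summed over i. Boundedness of v and w puts these products into \<open>H1_space\<close> and
  makes every integrand integrable although u is merely square-integrable.\<close>

lemma convect_by_parts:
  fixes D :: "(real^'n) set"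
  assumes D: "open D" "D \<in> lmeasurable" and u: "u \<in> Y_space D"
    and v: "v \<in> H10_space D" "AE x in lebesgue_on D. norm (v x) \<le> B"
    and w: "w \<in> H10_space D" "AE x in lebesgue_on D. norm (w x) \<le> B"
  shows "l2_inner D (convect D u v) w + l2_inner D (convect D u w) v
      + l2_inner D (\<lambda>x. wdiv D u x *\<^sub>R v x) w = 0"
proof -
  have Ds: "D \<in> sets lebesgue" using D by auto
  note d = Y_space_has_weak_div[OF u]
  have comp: "AE x in lebesgue_on D. \<bar>v x $ i\<bar> \<le> B" "AE x in lebesgue_on D. \<bar>w x $ i\<bar> \<le> B" for i
  proof -
    show "AE x in lebesgue_on D. \<bar>v x $ i\<bar> \<le> B"
      using v(2) by eventually_elim (rule norm_bound_component_le_cart)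
    show "AE x in lebesgue_on D. \<bar>w x $ i\<bar> \<le> B"
      using w(2) by eventually_elim (rule norm_bound_component_le_cart)
  qed
  note vi = H10_space_component[OF v(1)] and wi = H10_space_component[OF w(1)]
  note gv = H10_scalar_has_weak_grad[OF vi] and gw = H10_scalar_has_weak_grad[OF wi]
  have L: "(\<lambda>x. v x $ i *\<^sub>R wgrad D (\<lambda>x. w x $ i) x) \<in> L2_space D"
      "(\<lambda>x. w x $ i *\<^sub>R wgrad D (\<lambda>x. v x $ i) x) \<in> L2_space D"
      "(\<lambda>x. v x $ i * w x $ i) \<in> L2_space D" for i
    using L2_scaleR_bounded[OF has_weak_gradD(2)[OF gw] L2_spaceD(1)[OF has_weak_gradD(1)[OF gv]] comp(1)]
      L2_scaleR_bounded[OF has_weak_gradD(2)[OF gv] L2_spaceD(1)[OF has_weak_gradD(1)[OF gw]] comp(2)]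
      L2_scaleR_bounded[OF has_weak_gradD(1)[OF gw] L2_spaceD(1)[OF has_weak_gradD(1)[OF gv]] comp(1)]
    by simp_all
  have int: "integrable (lebesgue_on D) (\<lambda>x. u x \<bullet> (v x $ i *\<^sub>R wgrad D (\<lambda>x. w x $ i) x))"
    "integrable (lebesgue_on D) (\<lambda>x. u x \<bullet> (w x $ i *\<^sub>R wgrad D (\<lambda>x. v x $ i) x))"
    "integrable (lebesgue_on D) (\<lambda>x. wdiv D u x * (v x $ i * w x $ i))" for i
    using L2_integrable_inner[OF has_weak_divD(1)[OF d] L(1)[of i]]
      L2_integrable_inner[OF has_weak_divD(1)[OF d] L(2)[of i]]
      L2_integrable_inner[OF has_weak_divD(2)[OF d] L(3)[of i]] by simp_all
  have trace: "(\<integral>x. u x \<bullet> (v x $ i *\<^sub>R wgrad D (\<lambda>x. w x $ i) x) \<partial>lebesgue_on D)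
     + (\<integral>x. u x \<bullet> (w x $ i *\<^sub>R wgrad D (\<lambda>x. v x $ i) x) \<partial>lebesgue_on D)
     + (\<integral>x. wdiv D u x * (v x $ i * w x $ i) \<partial>lebesgue_on D) = 0" for i
  proof -
    let ?g = "\<lambda>x. v x $ i *\<^sub>R wgrad D (\<lambda>x. w x $ i) x + w x $ i *\<^sub>R wgrad D (\<lambda>x. v x $ i) x"
    have hg: "has_weak_grad D (\<lambda>x. v x $ i * w x $ i) ?g"
      by (rule has_weak_grad_mult[OF Ds vi gw comp])
    then have H1: "(\<lambda>x. v x $ i * w x $ i) \<in> H1_space D" by (rule H1_spaceI)
    note hw = H1_has_weak_grad[OF H1]
    \<comment> \<open>The trace condition speaks of the chosen gradient of the product; uniqueness
      exchanges it for the product-rule expression.\<close>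
    have "l2_inner D u (wgrad D (\<lambda>x. v x $ i * w x $ i)) = l2_inner D u ?g"
      unfolding l2_inner_def
    proof (rule integral_cong_AE)
      show "(\<lambda>x. u x \<bullet> wgrad D (\<lambda>x. v x $ i * w x $ i) x) \<in> borel_measurable (lebesgue_on D)"
        "(\<lambda>x. u x \<bullet> ?g x) \<in> borel_measurable (lebesgue_on D)"
        using hg hw has_weak_divD(1)[OF d]
        by (auto intro!: borel_measurable_integrable L2_integrable_inner has_weak_gradD(2))
      show "AE x in lebesgue_on D. u x \<bullet> wgrad D (\<lambda>x. v x $ i * w x $ i) x = u x \<bullet> ?g x"
        using has_weak_grad_unique[OF D hw hg] by eventually_elim simp
    qed
    moreover have "l2_inner D u (wgrad D (\<lambda>x. v x $ i * w x $ i)) + l2_inner D (wdiv D u) (\<lambda>x. v x $ i * w x $ i) = 0"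
      using u H1 unfolding Y_space_def normal_trace_zero_def by blast
    ultimately show ?thesis
      using int[of i] by (simp add: l2_inner_def inner_add_right)
  qed
  have pw: "convect D u y x \<bullet> z x = (\<Sum>i\<in>UNIV. u x \<bullet> (z x $ i *\<^sub>R wgrad D (\<lambda>x. y x $ i) x))" for y z x
    by (simp add: convect_def matrix_mult_dot grad_def inner_vec_def sum_distrib_left sum_distrib_right ac_simps)
  have pw': "wdiv D u x *\<^sub>R v x \<bullet> w x = (\<Sum>i\<in>UNIV. wdiv D u x * (v x $ i * w x $ i))" for x
    by (simp add: inner_vec_def mult.assoc)
  have "l2_inner D (convect D u v) w = (\<Sum>i\<in>UNIV. \<integral>x. u x \<bullet> (w x $ i *\<^sub>R wgrad D (\<lambda>x. v x $ i) x) \<partial>lebesgue_on D)"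
    "l2_inner D (convect D u w) v = (\<Sum>i\<in>UNIV. \<integral>x. u x \<bullet> (v x $ i *\<^sub>R wgrad D (\<lambda>x. w x $ i) x) \<partial>lebesgue_on D)"
    "l2_inner D (\<lambda>x. wdiv D u x *\<^sub>R v x) w = (\<Sum>i\<in>UNIV. \<integral>x. wdiv D u x * (v x $ i * w x $ i) \<partial>lebesgue_on D)"
    unfolding l2_inner_def pw pw' by (rule Bochner_Integration.integral_sum, rule int)+
  moreover have "(\<Sum>i\<in>UNIV. (\<integral>x. u x \<bullet> (v x $ i *\<^sub>R wgrad D (\<lambda>x. w x $ i) x) \<partial>lebesgue_on D)
     + (\<integral>x. u x \<bullet> (w x $ i *\<^sub>R wgrad D (\<lambda>x. v x $ i) x) \<partial>lebesgue_on D)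
     + (\<integral>x. wdiv D u x * (v x $ i * w x $ i) \<partial>lebesgue_on D)) = 0"
    using trace by (intro sum.neutral) blast
  ultimately show ?thesis
    unfolding sum.distrib by linarith
qed

section \<open>The energy estimate\<close>

text \<open>Membership in \<open>Linf_space\<close> excludes the essential supremum \<infinity>,
  which \<open>real_of_ereal\<close> would turn into 0; the value -\<infinity> is no upper bound of
  a norm at any point.\<close>

lemma AE_le_linf_norm:
  assumes "g \<in> Linf_space D"
  shows "AE x in lebesgue_on D. norm (g x) \<le> linf_norm D g"
proof -
  define e where "e = esssup (lebesgue_on D) (\<lambda>x. ereal (norm (g x)))"
  have "e < \<infinity>" using assms by (simp add: Linf_space_def e_def)
  have "AE x in lebesgue_on D. ereal (norm (g x)) \<le> e" unfolding e_def by (rule esssup_AE)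
  then show ?thesis
  proof eventually_elim
    fix x assume "ereal (norm (g x)) \<le> e"
    with \<open>e < \<infinity>\<close> show "norm (g x) \<le> linf_norm D g"
      by (cases e) (auto simp: linf_norm_def e_def[symmetric])
  qed
qed

text \<open>A negative bound on a norm can hold almost everywhere only when the measure is null;
  then the essential supremum is -\<infinity>, and \<open>real_of_ereal\<close> sends this to
  0.\<close>

lemma linf_norm_nonneg:
  assumes "g \<in> Linf_space D" shows "linf_norm D g \<ge> 0"
proof (rule ccontr)
  assume neg: "\<not> linf_norm D g \<ge> 0"
  have "AE x in lebesgue_on D. ereal (norm (g x)) \<le> - \<infinity>"
    using AE_le_linf_norm[OF assms]
  proof eventually_elim
    fix x assume "norm (g x) \<le> linf_norm D g"
    then show "ereal (norm (g x)) \<le> - \<infinity>" using neg norm_ge_zero[of "g x"] by linarith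
  qed
  moreover have "(\<lambda>x. ereal (norm (g x))) \<in> borel_measurable (lebesgue_on D)"
    using assms by (auto simp: Linf_space_def)
  ultimately have "esssup (lebesgue_on D) (\<lambda>x. ereal (norm (g x))) \<le> - \<infinity>" by (intro esssup_I)
  then show False using neg by (simp add: linf_norm_def)
qed

lemma Linf_spaceI:
  assumes "g \<in> borel_measurable (lebesgue_on D)" "AE x in lebesgue_on D. norm (g x) \<le> B"
  shows "g \<in> Linf_space D"
proof -
  have "esssup (lebesgue_on D) (\<lambda>x. ereal (norm (g x))) \<le> ereal B"
    using assms by (intro esssup_I) auto
  then show ?thesis using assms(1) by (auto simp: Linf_space_def)
qed

lemma AE_ge_ess_inf:
  assumes "g \<in> borel_measurable (lebesgue_on D)" "AE x in lebesgue_on D. m \<le> g x"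
  shows "AE x in lebesgue_on D. ess_inf D g \<le> g x"
proof -
  define e where "e = esssup (lebesgue_on D) (\<lambda>x. - ereal (g x))"
  have inf_e: "ess_inf D g = - real_of_ereal e" by (simp add: ess_inf_def e_def)
  have "e \<le> ereal (- m)"
    unfolding e_def using assms by (intro esssup_I) auto
  have "AE x in lebesgue_on D. - ereal (g x) \<le> e" unfolding e_def by (rule esssup_AE)
  then show ?thesis
  proof eventually_elim
    fix x assume "- ereal (g x) \<le> e"
    with \<open>e \<le> ereal (- m)\<close> show "ess_inf D g \<le> g x"
      by (cases e) (auto simp: inf_e)
  qed
qed

lemma admissible_viscosity_bounds:
  assumes "admissible_viscosities D J \<nu>" and J: "J \<ge> 1"
  shows "nu_bar J \<nu> \<in> borel_measurable (lebesgue_on D)"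
    and "\<exists>B. AE x in lebesgue_on D. \<bar>nu_bar J \<nu> x\<bar> \<le> B"
    and "AE x in lebesgue_on D. nu_bar_min D J \<nu> \<le> nu_bar J \<nu> x"
    and "j \<in> {1..J} \<Longrightarrow> nu_fluct J \<nu> j \<in> Linf_space D"
proof -
  have \<nu>: "\<nu> k \<in> Linf_space D" "\<exists>m>0. AE x in lebesgue_on D. m \<le> \<nu> k x" if "k \<in> {1..J}" for k
    using assms(1) that unfolding admissible_viscosities_def by blast+
  have m: "\<nu> k \<in> borel_measurable (lebesgue_on D)" if "k \<in> {1..J}" for k
    using \<nu>(1)[OF that] by (simp add: Linf_space_def)
  show mbar: "nu_bar J \<nu> \<in> borel_measurable (lebesgue_on D)"
    unfolding nu_bar_def[abs_def] using m by (intro borel_measurable_times borel_measurable_sum) auto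
  define B where "B = (1 / real J) * (\<Sum>k=1..J. linf_norm D (\<nu> k))"
  have "AE x in lebesgue_on D. \<forall>k\<in>{1..J}. norm (\<nu> k x) \<le> linf_norm D (\<nu> k)"
    using \<nu>(1) by (intro AE_finite_allI AE_le_linf_norm) auto
  then have Bbar: "AE x in lebesgue_on D. \<bar>nu_bar J \<nu> x\<bar> \<le> B"
  proof eventually_elim
    fix x assume *: "\<forall>k\<in>{1..J}. norm (\<nu> k x) \<le> linf_norm D (\<nu> k)"
    have "\<bar>\<Sum>k=1..J. \<nu> k x\<bar> \<le> (\<Sum>k=1..J. linf_norm D (\<nu> k))"
      using * by (intro order_trans[OF sum_abs] sum_mono) auto
    then show "\<bar>nu_bar J \<nu> x\<bar> \<le> B"
      by (simp add: nu_bar_def B_def abs_mult divide_right_mono)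
  qed
  then show "\<exists>B. AE x in lebesgue_on D. \<bar>nu_bar J \<nu> x\<bar> \<le> B" by blast
  \<comment> \<open>Nonnegativity is the lower bound that keeps the essential infimum of the mean
    from being a default value.\<close>
  have "AE x in lebesgue_on D. \<forall>k\<in>{1..J}. 0 \<le> \<nu> k x"
  proof (rule AE_finite_allI)
    fix k assume "k \<in> {1..J}"
    then obtain m where "m > 0" "AE x in lebesgue_on D. m \<le> \<nu> k x" using \<nu>(2) by blast
    then show "AE x in lebesgue_on D. 0 \<le> \<nu> k x" by (auto elim!: eventually_mono)
  qed simp
  then have "AE x in lebesgue_on D. 0 \<le> nu_bar J \<nu> x"
    by eventually_elim (auto simp: nu_bar_def intro!: divide_nonneg_nonneg sum_nonneg)
  then show "AE x in lebesgue_on D. nu_bar_min D J \<nu> \<le> nu_bar J \<nu> x"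
    unfolding nu_bar_min_def by (rule AE_ge_ess_inf[OF mbar])
  assume j: "j \<in> {1..J}"
  show "nu_fluct J \<nu> j \<in> Linf_space D"
  proof (rule Linf_spaceI)
    show "nu_fluct J \<nu> j \<in> borel_measurable (lebesgue_on D)"
      unfolding nu_fluct_def[abs_def] using m[OF j] mbar by (rule borel_measurable_diff)
    show "AE x in lebesgue_on D. norm (nu_fluct J \<nu> j x) \<le> linf_norm D (\<nu> j) + B"
      using AE_le_linf_norm[OF \<nu>(1)[OF j]] Bbar
      by eventually_elim (auto simp: nu_fluct_def)
  qed
qed

lemma l2_norm_scaleR_le:
  assumes "f \<in> L2_space D" "h \<in> borel_measurable (lebesgue_on D)" "AE x in lebesgue_on D. \<bar>h x\<bar> \<le> B" "B \<ge> 0"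
  shows "l2_norm D (\<lambda>x. h x *\<^sub>R f x) \<le> B * l2_norm D f"
proof (rule power2_le_imp_le)
  have "(l2_norm D (\<lambda>x. h x *\<^sub>R f x))\<^sup>2 \<le> (\<integral>x. B\<^sup>2 * (norm (f x))\<^sup>2 \<partial>lebesgue_on D)"
    unfolding l2_norm_sq
  proof (rule integral_mono_AE)
    show "integrable (lebesgue_on D) (\<lambda>x. (norm (h x *\<^sub>R f x))\<^sup>2)"
      by (rule L2_spaceD(2)[OF L2_scaleR_bounded[OF assms(1-3)]])
    show "integrable (lebesgue_on D) (\<lambda>x. B\<^sup>2 * (norm (f x))\<^sup>2)"
      using L2_spaceD(2)[OF assms(1)] by simp
    show "AE x in lebesgue_on D. (norm (h x *\<^sub>R f x))\<^sup>2 \<le> B\<^sup>2 * (norm (f x))\<^sup>2"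
      using assms(3)
    proof eventually_elim
      fix x assume "\<bar>h x\<bar> \<le> B"
      then have "\<bar>h x\<bar>\<^sup>2 \<le> B\<^sup>2" by (intro power_mono) auto
      then show "(norm (h x *\<^sub>R f x))\<^sup>2 \<le> B\<^sup>2 * (norm (f x))\<^sup>2"
        by (simp add: power_mult_distrib mult_right_mono)
    qed
  qed
  then show "(l2_norm D (\<lambda>x. h x *\<^sub>R f x))\<^sup>2 \<le> (B * l2_norm D f)\<^sup>2"
    by (simp add: power_mult_distrib l2_norm_sq)
qed (use assms(4) in simp)

text \<open>Serves both diffusion terms: k = 1 with c = \<open>nu_bar_min\<close> for the mean
  viscosity, and k the modulus of the fluctuation with c = 2 \<mu> \<Delta>t for the eddy
  viscosity.\<close>

lemma l2_inner_weight_mono: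
  assumes "f \<in> L2_space D" "h \<in> borel_measurable (lebesgue_on D)" "AE x in lebesgue_on D. \<bar>h x\<bar> \<le> B"
    and "(\<lambda>x. k x *\<^sub>R f x) \<in> L2_space D" "AE x in lebesgue_on D. c * (k x)\<^sup>2 \<le> h x"
  shows "c * (l2_norm D (\<lambda>x. k x *\<^sub>R f x))\<^sup>2 \<le> l2_inner D (\<lambda>x. h x *\<^sub>R f x) f"
proof -
  have "(\<integral>x. c * (norm (k x *\<^sub>R f x))\<^sup>2 \<partial>lebesgue_on D) \<le> (\<integral>x. (h x *\<^sub>R f x) \<bullet> f x \<partial>lebesgue_on D)"
  proof (rule integral_mono_AE)
    show "integrable (lebesgue_on D) (\<lambda>x. c * (norm (k x *\<^sub>R f x))\<^sup>2)"
      using L2_spaceD(2)[OF assms(4)] by (intro integrable_mult_right) auto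
    show "integrable (lebesgue_on D) (\<lambda>x. (h x *\<^sub>R f x) \<bullet> f x)"
      by (intro L2_integrable_inner L2_scaleR_bounded[OF assms(1-3)] assms(1))
    show "AE x in lebesgue_on D. c * (norm (k x *\<^sub>R f x))\<^sup>2 \<le> (h x *\<^sub>R f x) \<bullet> f x"
      using assms(5)
    proof eventually_elim
      fix x assume "c * (k x)\<^sup>2 \<le> h x"
      from mult_right_mono[OF this, of "(norm (f x))\<^sup>2"]
      show "c * (norm (k x *\<^sub>R f x))\<^sup>2 \<le> (h x *\<^sub>R f x) \<bullet> f x"
        by (simp add: power_mult_distrib power2_norm_eq_inner mult.assoc)
    qed
  qed
  then show ?thesis by (simp add: l2_norm_sq l2_inner_def)
qed

text \<open>The bound K in \<open>Hm1_space\<close> is used twice: it makes the supremum in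
  \<open>hm1_norm\<close> one over a bounded set, and it forces F v = 0 when the gradient norm of v
  is 0, a case left out of that supremum.\<close>

lemma Hm1_bound:
  assumes "F \<in> Hm1_space D" "v \<in> H10_space D"
  shows "F v \<le> hm1_norm D F * l2_norm D (grad D v)"
proof -
  obtain K where K: "\<And>v. v \<in> H10_space D \<Longrightarrow> \<bar>F v\<bar> \<le> K * l2_norm D (grad D v)"
    using assms(1) unfolding Hm1_space_def by blast
  show ?thesis
  proof (cases "l2_norm D (grad D v) = 0")
    case True
    then show ?thesis using K[OF assms(2)] by simp
  next
    case False
    then have pos: "l2_norm D (grad D v) > 0" using l2_norm_nonneg[of D "grad D v"] by linarith
    have "\<bar>F v\<bar> / l2_norm D (grad D v) \<le> hm1_norm D F"
      unfolding hm1_norm_def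
    proof (rule cSUP_upper)
      show "v \<in> {v \<in> H10_space D. l2_norm D (grad D v) \<noteq> 0}" using False assms(2) by simp
      show "bdd_above ((\<lambda>v. \<bar>F v\<bar> / l2_norm D (grad D v)) ` {v \<in> H10_space D. l2_norm D (grad D v) \<noteq> 0})"
      proof (rule bdd_aboveI2)
        fix w assume "w \<in> {v \<in> H10_space D. l2_norm D (grad D v) \<noteq> 0}"
        then have "w \<in> H10_space D" "l2_norm D (grad D w) > 0"
          using l2_norm_nonneg[of D "grad D w"] by (auto simp: less_le)
        then show "\<bar>F w\<bar> / l2_norm D (grad D w) \<le> K"
          using K[of w] by (simp add: pos_divide_le_eq)
      qed
    qed
    with pos have "\<bar>F v\<bar> \<le> hm1_norm D F * l2_norm D (grad D v)" by (simp add: pos_divide_le_eq)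
    then show ?thesis by linarith
  qed
qed

lemma function_subspace_lincomb:
  assumes "function_subspace V" "u \<in> V" "v \<in> V"
  shows "(\<lambda>x. a *\<^sub>R u x + b *\<^sub>R v x) \<in> V"
  using assms unfolding function_subspace_def by blast

lemma function_subspace_sum:
  assumes V: "function_subspace V" and "\<And>k. k \<in> I \<Longrightarrow> u k \<in> V"
  shows "(\<lambda>x. \<Sum>k\<in>I. u k x) \<in> V"
  using assms(2)
proof (induction I rule: infinite_finite_induct)
  case (insert k I)
  then show ?case using function_subspace_lincomb[OF V, of "u k" "\<lambda>x. \<Sum>k\<in>I. u k x" 1 1] by simp
qed (use V in \<open>auto simp: function_subspace_def\<close>)

text \<open>As a linear combination of iterates the fluctuation stays in the finite element space,
  which supplies its vanishing normal trace, its boundedness and its bounded divergence.\<close>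

lemma ens_fluct_subspace:
  assumes V: "function_subspace V" and u: "\<And>k. k \<in> {1..J} \<Longrightarrow> u k n \<in> V" and j: "j \<in> {1..J}"
  shows "ens_fluct J u j n \<in> V"
proof -
  have "(\<lambda>x. 1 *\<^sub>R u j n x + (- (1 / real J)) *\<^sub>R (\<Sum>k=1..J. u k n x)) \<in> V"
    by (intro function_subspace_lincomb[OF V] function_subspace_sum[OF V] u j)
  then show ?thesis by (simp add: ens_fluct_def[abs_def] ens_mean_def)
qed

section \<open>Stability of the two steps\<close>

text \<open>The Young weights exhaust N on each side. Of X^2, the viscosity fluctuation takes N - a,
  the force a/2 and the divergence term a/2; of Y^2, the viscosity fluctuation takes N - a, the
  convective term a/2 and the divergence term a/2. X and Y stand for the gradient norms of the new
  and old iterate, W for that of the gradient weighted by the fluctuation.\<close>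

lemma energy_algebra:
  fixes F :: real
  assumes a: "0 < a" "a \<le> N" and d: "0 \<le> d" "d * P\<^sup>2 \<le> a" and m: "P\<^sup>2 / (2 * a) \<le> m"
    and nn: "0 \<le> P" "0 \<le> X" "0 \<le> Y" "0 \<le> W" "0 \<le> y" "0 \<le> v"
    and vy: "v \<le> P * X" "y \<le> P * Y"
  shows "2 * F * X + 2 * W * y + d * v * y + 2 * (N - a) * X * Y
    \<le> N * X\<^sup>2 + N * Y\<^sup>2 + 2 / a * F\<^sup>2 + 4 * m * W\<^sup>2"
proof -
  have sq: "2 * (s * t) \<le> s\<^sup>2 + t\<^sup>2" for s t :: real
    using sum_squares_bound[of s t] by simp
  have "2 * F * X = 2 * (2 * F * (a * X)) / (2 * a)" using a(1) by simp
  also have "\<dots> \<le> ((2 * F)\<^sup>2 + (a * X)\<^sup>2) / (2 * a)"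
    using a(1) by (intro divide_right_mono sq) auto
  also have "\<dots> = 2 / a * F\<^sup>2 + a / 2 * X\<^sup>2"
    using a(1) by (simp add: field_simps power2_eq_square)
  finally have 1: "2 * F * X \<le> 2 / a * F\<^sup>2 + a / 2 * X\<^sup>2" .
  \<comment> \<open>Poincare replaces y by P Y. Granting a/2 of Y^2 costs 2 P^2 / a of W^2, the
    origin of the threshold P^2 / (2 a) for m.\<close>
  have "2 * W * y \<le> 2 * W * (P * Y)" using nn vy by (intro mult_left_mono) auto
  also have "\<dots> = 2 * (2 * P * W * (a * Y)) / (2 * a)" using a(1) by simp
  also have "\<dots> \<le> ((2 * P * W)\<^sup>2 + (a * Y)\<^sup>2) / (2 * a)"
    using a(1) by (intro divide_right_mono sq) auto
  also have "\<dots> = 4 * (P\<^sup>2 / (2 * a)) * W\<^sup>2 + a / 2 * Y\<^sup>2"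
    using a(1) by (simp add: field_simps power2_eq_square)
  also have "\<dots> \<le> 4 * m * W\<^sup>2 + a / 2 * Y\<^sup>2"
    using m by (intro add_right_mono mult_right_mono) auto
  finally have 2: "2 * W * y \<le> 4 * m * W\<^sup>2 + a / 2 * Y\<^sup>2" .
  \<comment> \<open>Poincare is applied to both factors; this produces P^2 and with it the condition
    on d behind C1.\<close>
  have "d * v * y \<le> d * (P * X) * (P * Y)"
    using nn vy d by (intro mult_mono mult_nonneg_nonneg) auto
  also have "\<dots> = d * P\<^sup>2 * (X * Y)" by (simp add: power2_eq_square)
  also have "\<dots> \<le> a * (X * Y)" using d nn by (intro mult_right_mono) auto
  also have "\<dots> \<le> a * ((X\<^sup>2 + Y\<^sup>2) / 2)" using a sq[of X Y] by (intro mult_left_mono) auto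
  finally have 3: "d * v * y \<le> a * ((X\<^sup>2 + Y\<^sup>2) / 2)" .
  have "2 * (N - a) * X * Y = (N - a) * (2 * (X * Y))" by simp
  also have "\<dots> \<le> (N - a) * (X\<^sup>2 + Y\<^sup>2)" using a sq[of X Y] by (intro mult_left_mono) auto
  finally have 4: "2 * (N - a) * X * Y \<le> (N - a) * (X\<^sup>2 + Y\<^sup>2)" .
  show ?thesis using 1 2 3 4 by (simp add: algebra_simps)
qed

text \<open>Testing Step 2 with the projected field itself removes the pressure, since the
  divergence of that field is orthogonal to \<open>Qh\<close>. The squared norm of the projection is
  then its inner product with the unprojected field, and Cauchy-Schwarz applies.\<close>

lemma step2_stability:
  assumes fe: "fe_discretization D h \<sigma> c \<beta> \<T> Xh Yh Qh" and \<Delta>t: "\<Delta>t > 0"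
    and u: "u j (Suc n) \<in> L2_space D" and step: "spp_eev_step2 D Yh Qh \<Delta>t u ut p j n"
  shows "ut j (Suc n) \<in> L2_space D" "l2_norm D (ut j (Suc n)) \<le> l2_norm D (u j (Suc n))"
proof -
  define a b where "a = ut j (Suc n)" and "b = u j (Suc n)"
  have s: "a \<in> Yh" "p j (Suc n) \<in> Qh"
    "\<forall>v\<in>Yh. l2_inner D (\<lambda>x. (a x - b x) /\<^sub>R \<Delta>t) v - l2_inner D (p j (Suc n)) (wdiv D v) = 0"
    "\<forall>q\<in>Qh. l2_inner D (wdiv D a) q = 0"
    using step unfolding spp_eev_step2_def a_def b_def by auto
  have "a \<in> Y_space D" using s(1) fe unfolding fe_discretization_def by blast
  then have a: "a \<in> L2_space D" by (rule has_weak_divD(1)[OF Y_space_has_weak_div])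
  then show "ut j (Suc n) \<in> L2_space D" by (simp add: a_def)
  have b: "b \<in> L2_space D" using u by (simp add: b_def)
  have "l2_inner D (p j (Suc n)) (wdiv D a) = 0" using s(2,4) l2_inner_commute by metis
  then have "l2_inner D (\<lambda>x. (a x - b x) /\<^sub>R \<Delta>t) a = 0"
    using s(1,3) by auto
  then have "inverse \<Delta>t * (l2_inner D a a - l2_inner D b a) = 0"
    by (simp add: l2_inner_scaleR_left l2_inner_diff_left[OF a b a])
  then have "(l2_norm D a)\<^sup>2 = l2_inner D b a" using \<Delta>t by (simp add: l2_inner_self)
  also have "\<dots> \<le> l2_norm D b * l2_norm D a" using l2_Cauchy_Schwarz[OF b a] by linarith
  finally have "l2_norm D a * l2_norm D a \<le> l2_norm D b * l2_norm D a" by (simp add: power2_eq_square)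
  then have "l2_norm D a \<le> l2_norm D b"
    using l2_norm_nonneg[of D a] l2_norm_nonneg[of D b]
    by (cases "l2_norm D a = 0") (auto simp: mult_le_cancel_right)
  then show "l2_norm D (ut j (Suc n)) \<le> l2_norm D (u j (Suc n))" by (simp add: a_def b_def)
qed

lemma bstar_bound:
  fixes D :: "(real^'n) set"
  assumes D: "open D" "D \<in> lmeasurable"
    and u: "u \<in> Y_space D" "AE x in lebesgue_on D. norm (u x) \<le> B" "wdiv D u \<in> Linf_space D"
    and y: "y \<in> H10_space D" "AE x in lebesgue_on D. norm (y x) \<le> B"
    and v: "v \<in> H10_space D" "AE x in lebesgue_on D. norm (v x) \<le> B"
  shows "- bstar D u y v \<le> l2_norm D (\<lambda>x. norm (u x) *\<^sub>R grad D v x) * l2_norm D y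
    + 1/2 * linf_norm D (wdiv D u) * l2_norm D v * l2_norm D y"
proof -
  let ?d = "wdiv D u"
  note d = Y_space_has_weak_div[OF u(1)]
  have mu: "u \<in> borel_measurable (lebesgue_on D)" by (rule L2_spaceD(1)[OF has_weak_divD(1)[OF d]])
  have md: "?d \<in> borel_measurable (lebesgue_on D)" by (rule L2_spaceD(1)[OF has_weak_divD(2)[OF d]])
  have bd: "AE x in lebesgue_on D. \<bar>?d x\<bar> \<le> linf_norm D ?d" using AE_le_linf_norm[OF u(3)] by simp
  note yL = H10_space_L2(1)[OF y(1)] and vL = H10_space_L2(1)[OF v(1)]
  \<comment> \<open>\<open>bstar\<close> contains half of each convective term. Eliminating the one
    with the gradient of y makes the halves add up to the full (u . grad v, y) and leaves half of
    the divergence term.\<close>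
  have eq: "- bstar D u y v = l2_inner D (convect D u v) y + 1/2 * l2_inner D (\<lambda>x. ?d x *\<^sub>R y x) v"
    using convect_by_parts[OF D u(1) y v] by (simp add: bstar_def)
  have "l2_inner D (convect D u v) y \<le> l2_norm D (convect D u v) * l2_norm D y"
    using l2_Cauchy_Schwarz[OF convect_L2(1)[OF mu u(2) v(1)] yL] by linarith
  also have "\<dots> \<le> l2_norm D (\<lambda>x. norm (u x) *\<^sub>R grad D v x) * l2_norm D y"
    by (intro mult_right_mono convect_L2(3)[OF mu u(2) v(1)]) simp
  finally have 1: "l2_inner D (convect D u v) y \<le> l2_norm D (\<lambda>x. norm (u x) *\<^sub>R grad D v x) * l2_norm D y" .
  have "l2_inner D (\<lambda>x. ?d x *\<^sub>R y x) v \<le> l2_norm D (\<lambda>x. ?d x *\<^sub>R y x) * l2_norm D v"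
    using l2_Cauchy_Schwarz[OF L2_scaleR_bounded[OF yL md bd] vL] by linarith
  also have "\<dots> \<le> linf_norm D ?d * l2_norm D y * l2_norm D v"
    by (intro mult_right_mono l2_norm_scaleR_le[OF yL md bd] linf_norm_nonneg u(3)) simp
  finally have 2: "l2_inner D (\<lambda>x. ?d x *\<^sub>R y x) v \<le> linf_norm D ?d * l2_norm D v * l2_norm D y"
    by (simp add: mult.commute mult.left_commute)
  show ?thesis using eq 1 2 by simp
qed

text \<open>Boundedness keeps the eddy term integrable. The lower bound retains only the j-th
  summand, which suffices because only the fluctuation of member j enters its own equation beside
  the mean.\<close>

lemma eddy_viscosity_bounds:
  assumes u: "\<forall>k\<in>{1..J}. ens_fluct J u k n \<in> borel_measurable (lebesgue_on D)"
    "\<forall>k\<in>{1..J}. \<exists>B. AE x in lebesgue_on D. norm (ens_fluct J u k n x) \<le> B"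
    and pos: "\<mu> > 0" "\<Delta>t > 0"
  shows "eddy_viscosity J \<mu> \<Delta>t u n \<in> borel_measurable (lebesgue_on D)"
    and "\<exists>B. AE x in lebesgue_on D. \<bar>eddy_viscosity J \<mu> \<Delta>t u n x\<bar> \<le> B"
    and "j \<in> {1..J} \<Longrightarrow> \<mu> * \<Delta>t * (norm (ens_fluct J u j n x))\<^sup>2 \<le> eddy_viscosity J \<mu> \<Delta>t u n x"
proof -
  show "eddy_viscosity J \<mu> \<Delta>t u n \<in> borel_measurable (lebesgue_on D)"
    unfolding eddy_viscosity_def[abs_def]
    using u(1) by (auto intro!: borel_measurable_times borel_measurable_sum borel_measurable_power borel_measurable_norm)
  obtain B where B: "\<And>k. k \<in> {1..J} \<Longrightarrow> AE x in lebesgue_on D. norm (ens_fluct J u k n x) \<le> B k"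
    using u(2) by metis
  have "AE x in lebesgue_on D. \<forall>k\<in>{1..J}. norm (ens_fluct J u k n x) \<le> B k"
    by (rule AE_finite_allI[OF _ B]) auto
  then have "AE x in lebesgue_on D. \<bar>eddy_viscosity J \<mu> \<Delta>t u n x\<bar> \<le> \<mu> * \<Delta>t * (\<Sum>k=1..J. (B k)\<^sup>2)"
  proof eventually_elim
    fix x assume *: "\<forall>k\<in>{1..J}. norm (ens_fluct J u k n x) \<le> B k"
    have "(\<Sum>k=1..J. (norm (ens_fluct J u k n x))\<^sup>2) \<le> (\<Sum>k=1..J. (B k)\<^sup>2)"
      using * by (intro sum_mono power_mono) auto
    moreover have "0 \<le> (\<Sum>k=1..J. (norm (ens_fluct J u k n x))\<^sup>2)" by (intro sum_nonneg) auto
    ultimately show "\<bar>eddy_viscosity J \<mu> \<Delta>t u n x\<bar> \<le> \<mu> * \<Delta>t * (\<Sum>k=1..J. (B k)\<^sup>2)"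
      using pos by (simp add: eddy_viscosity_def abs_mult)
  qed
  then show "\<exists>B. AE x in lebesgue_on D. \<bar>eddy_viscosity J \<mu> \<Delta>t u n x\<bar> \<le> B" by blast
  assume "j \<in> {1..J}"
  then have "(norm (ens_fluct J u j n x))\<^sup>2 \<le> (\<Sum>k=1..J. (norm (ens_fluct J u k n x))\<^sup>2)"
    by (intro member_le_sum) auto
  then show "\<mu> * \<Delta>t * (norm (ens_fluct J u j n x))\<^sup>2 \<le> eddy_viscosity J \<mu> \<Delta>t u n x"
    using pos by (simp add: eddy_viscosity_def)
qed

text \<open>The right-hand side mixes the L2 norm of the projected field \<open>ut j n\<close>, from
  which the time difference starts, with the gradient of \<open>u j n\<close>, which enters through
  the lagged terms. Only the former has to be converted by Step 2.\<close>

lemma energy_step: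
  fixes D :: "(real^'n) set"
  assumes domain: "convex_polytopal_domain D" and R: "\<And>x. x \<in> D \<Longrightarrow> norm x \<le> R" "R \<ge> 1"
    and fe: "fe_discretization D h \<sigma> c \<beta> \<T> Xh Yh Qh"
    and visc: "admissible_viscosities D J \<nu>" "J \<ge> 1" and j: "j \<in> {1..J}"
    and pos: "\<Delta>t > 0" "\<mu> > 0"
    and u: "\<And>k. k \<in> {1..J} \<Longrightarrow> u k n \<in> Xh" and ut: "ut j n \<in> L2_space D"
    and f: "f j (real (Suc n) * \<Delta>t) \<in> Hm1_space D"
    and step: "spp_eev_step1 D Xh J \<Delta>t \<nu> \<gamma> \<mu> f u ut j n"
    and small: "alpha D J \<nu> j > (2 * R)\<^sup>2 * linf_norm D (wdiv D (ens_fluct J u j n))"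
    and large: "\<mu> \<ge> alpha D J \<nu> j / (\<Delta>t * (2 / (2 * R)\<^sup>2 * (alpha D J \<nu> j)\<^sup>2
        - (linf_norm D (wdiv D (ens_fluct J u j n)))\<^sup>2))"
  shows "(l2_norm D (u j (Suc n)))\<^sup>2 + nu_bar_min D J \<nu> * \<Delta>t * (l2_norm D (grad D (u j (Suc n))))\<^sup>2
      + 2 * \<gamma> * \<Delta>t * (l2_norm D (wdiv D (u j (Suc n))))\<^sup>2
    \<le> (l2_norm D (ut j n))\<^sup>2 + nu_bar_min D J \<nu> * \<Delta>t * (l2_norm D (grad D (u j n)))\<^sup>2
      + 2 * \<Delta>t / alpha D J \<nu> j * (hm1_norm D (f j (real (Suc n) * \<Delta>t)))\<^sup>2"
proof -
  note D = polytopal_domain_facts[OF domain]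
  have T: "regular_triangulation D h \<sigma> \<T>" and XhV: "fe_vector_space \<T> Xh"
    and sub: "Xh \<subseteq> H10_space D" "Xh \<subseteq> Y_space D"
    using fe unfolding fe_discretization_def by blast+
  have Xh: "function_subspace Xh" using XhV unfolding fe_vector_space_def by blast
  define v y where "v = u j (Suc n)" and "y = u j n"
  define w where "w k = ens_fluct J u k n" for k
  define a N where "a = alpha D J \<nu> j" and "N = nu_bar_min D J \<nu>"
  define d where "d = linf_norm D (wdiv D (w j))"
  have vX: "v \<in> Xh" using step by (simp add: spp_eev_step1_def v_def)
  have yX: "y \<in> Xh" using u[OF j] by (simp add: y_def)
  have wX: "w k \<in> Xh" if "k \<in> {1..J}" for k
    unfolding w_def by (rule ens_fluct_subspace[OF Xh]) (use u that in auto)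
  have vH: "v \<in> H10_space D" and yH: "y \<in> H10_space D" and wH: "\<And>k. k \<in> {1..J} \<Longrightarrow> w k \<in> H10_space D"
    and wY: "w j \<in> Y_space D"
    using sub vX yX wX j by blast+
  note vL = H10_space_L2[OF vH] and yL = H10_space_L2[OF yH]
  obtain Bv where Bv: "AE x in lebesgue_on D. norm (v x) \<le> Bv"
    by (rule fe_vector_bounded[OF T D(5) XhV vX]) blast
  obtain By where By: "AE x in lebesgue_on D. norm (y x) \<le> By"
    by (rule fe_vector_bounded[OF T D(5) XhV yX]) blast
  have wB: "\<exists>B. AE x in lebesgue_on D. norm (w k x) \<le> B" if "k \<in> {1..J}" for k
    by (rule fe_vector_bounded[OF T D(5) XhV wX[OF that]]) blast
  then obtain Bw where Bw: "AE x in lebesgue_on D. norm (w j x) \<le> Bw" using j by blast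
  define B where "B = max Bv (max By Bw)"
  have B: "AE x in lebesgue_on D. norm (v x) \<le> B" "AE x in lebesgue_on D. norm (y x) \<le> B"
    "AE x in lebesgue_on D. norm (w j x) \<le> B"
  proof -
    show "AE x in lebesgue_on D. norm (v x) \<le> B"
      using Bv by eventually_elim (simp add: B_def)
    show "AE x in lebesgue_on D. norm (y x) \<le> B"
      using By by eventually_elim (simp add: B_def)
    show "AE x in lebesgue_on D. norm (w j x) \<le> B"
      using Bw by eventually_elim (simp add: B_def)
  qed
  have divL: "wdiv D (w j) \<in> L2_space D" by (rule has_weak_divD(2)[OF Y_space_has_weak_div[OF wY]])
  obtain Bd where "AE x in lebesgue_on D. \<bar>wdiv D (w j) x\<bar> \<le> Bd"
    by (rule fe_weak_div_bounded[OF T D(1,2,4) XhV wX[OF j] Y_space_has_weak_div[OF wY]]) blast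
  then have divB: "wdiv D (w j) \<in> Linf_space D"
    by (intro Linf_spaceI[OF L2_spaceD(1)[OF divL]]) simp
  have d0: "d \<ge> 0" unfolding d_def by (rule linf_norm_nonneg[OF divB])
  define X Y W where "X = l2_norm D (grad D v)" and "Y = l2_norm D (grad D y)"
    and "W = l2_norm D (\<lambda>x. norm (w j x) *\<^sub>R grad D v x)"
  define F where "F = hm1_norm D (f j (real (Suc n) * \<Delta>t))"
  have a0: "a > 0" using visc(1) j by (simp add: admissible_viscosities_def a_def)
  note visc_bounds = admissible_viscosity_bounds[OF visc]
  note fluct = visc_bounds(4)[OF j]
  \<comment> \<open>By the definition of \<open>alpha\<close>, N - a is the sup norm of the
    viscosity fluctuation and so the share of dissipation that the lagged viscosity term
    costs.\<close>
  have aN: "N - a = linf_norm D (nu_fluct J \<nu> j)" by (simp add: a_def N_def alpha_def)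
  then have Na: "a \<le> N" using linf_norm_nonneg[OF fluct] by linarith
  have poinc: "l2_norm D z \<le> 2 * R * l2_norm D (grad D z)" if "z \<in> H10_space D" for z
  proof (rule power2_le_imp_le)
    show "(l2_norm D z)\<^sup>2 \<le> (2 * R * l2_norm D (grad D z))\<^sup>2"
      using Poincare[OF D(5) R(1) _ that] R(2) by (simp add: power_mult_distrib)
  qed (use R(2) in simp)
  have R2: "(2 * R)\<^sup>2 > 0" using R(2) by simp
  have dP: "d * (2 * R)\<^sup>2 \<le> a"
    using small by (simp add: a_def d_def w_def mult.commute)
  have mP: "(2 * R)\<^sup>2 / (2 * a) \<le> \<mu> * \<Delta>t"
  proof -
    define q where "q = 2 / (2 * R)\<^sup>2 * a\<^sup>2 - d\<^sup>2"
    \<comment> \<open>This is where R \<ge> 1 matters: the condition on d controls d^2 P^4, and P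
      \<ge> 1 is needed to pass to d^2 P^2, which fixes the sign of q.\<close>
    have "(2 * R)\<^sup>2 \<ge> 2\<^sup>2" using R(2) by (intro power_mono) auto
    have "(d * (2 * R)\<^sup>2) * (d * (2 * R)\<^sup>2) \<le> a * a" using dP d0 a0 by (intro mult_mono) auto
    then have "d\<^sup>2 * (2 * R)\<^sup>2 * (2 * R)\<^sup>2 \<le> a\<^sup>2" by (simp add: power2_eq_square mult.assoc mult.left_commute)
    moreover have "d\<^sup>2 * (2 * R)\<^sup>2 * 1 \<le> d\<^sup>2 * (2 * R)\<^sup>2 * (2 * R)\<^sup>2"
      using \<open>(2 * R)\<^sup>2 \<ge> 2\<^sup>2\<close> by (intro mult_left_mono) auto
    ultimately have "d\<^sup>2 * (2 * R)\<^sup>2 \<le> a\<^sup>2" by linarith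
    moreover have "a\<^sup>2 > 0" using a0 by simp
    ultimately have "d\<^sup>2 * (2 * R)\<^sup>2 < 2 * a\<^sup>2" by linarith
    then have "d\<^sup>2 < 2 * a\<^sup>2 / (2 * R)\<^sup>2" using R2 by (simp only: pos_less_divide_eq)
    then have q0: "q > 0" by (simp add: q_def)
    \<comment> \<open>Discarding d^2 enlarges the positive denominator, so a / q is at least the
      threshold P^2 / (2 a).\<close>
    have "q \<le> 2 / (2 * R)\<^sup>2 * a\<^sup>2" by (simp add: q_def)
    then have "a / (2 / (2 * R)\<^sup>2 * a\<^sup>2) \<le> a / q"
      using q0 a0 by (intro divide_left_mono mult_pos_pos) auto
    also have "a / (2 / (2 * R)\<^sup>2 * a\<^sup>2) = (2 * R)\<^sup>2 / (2 * a)"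
      using a0 R2 by (simp add: field_simps power2_eq_square)
    finally have "(2 * R)\<^sup>2 / (2 * a) \<le> a / q" .
    moreover have "a / (\<Delta>t * q) \<le> \<mu>"
      using large by (simp add: q_def a_def d_def w_def)
    then have "a / q \<le> \<mu> * \<Delta>t" using pos(1) q0 by (simp add: pos_divide_le_eq mult.assoc)
    ultimately show ?thesis by linarith
  qed
  \<comment> \<open>The inner product is half of the difference of the squared norms plus half of
    the squared norm of v - \<open>ut j n\<close>, up to the factor 1 / \<Delta>t; the latter is
    nonnegative and is given up.\<close>
  have time: "((l2_norm D v)\<^sup>2 - (l2_norm D (ut j n))\<^sup>2) / (2 * \<Delta>t) \<le> l2_inner D (\<lambda>x. (v x - ut j n x) /\<^sub>R \<Delta>t) v"
  proof -
    have "l2_inner D (ut j n) v \<le> l2_norm D (ut j n) * l2_norm D v"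
      using l2_Cauchy_Schwarz[OF ut vL(1)] by linarith
    then have "2 * l2_inner D (ut j n) v \<le> (l2_norm D (ut j n))\<^sup>2 + (l2_norm D v)\<^sup>2"
      using sum_squares_bound[of "l2_norm D (ut j n)" "l2_norm D v"] by linarith
    then have "((l2_norm D v)\<^sup>2 - (l2_norm D (ut j n))\<^sup>2) / 2 \<le> l2_inner D v v - l2_inner D (ut j n) v"
      by (simp add: l2_inner_self)
    then have "((l2_norm D v)\<^sup>2 - (l2_norm D (ut j n))\<^sup>2) / 2 / \<Delta>t \<le> (l2_inner D v v - l2_inner D (ut j n) v) / \<Delta>t"
      using pos(1) by (intro divide_right_mono) auto
    moreover have "l2_inner D (\<lambda>x. (v x - ut j n x) /\<^sub>R \<Delta>t) v = (l2_inner D v v - l2_inner D (ut j n) v) / \<Delta>t"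
      unfolding l2_inner_scaleR_left l2_inner_diff_left[OF vL(1) ut vL(1)] by (simp add: divide_inverse)
    ultimately show ?thesis by simp
  qed
  obtain Bn where Bn: "AE x in lebesgue_on D. \<bar>nu_bar J \<nu> x\<bar> \<le> Bn" using visc_bounds(2) by blast
  have diffusion: "N * X\<^sup>2 \<le> l2_inner D (\<lambda>x. nu_bar J \<nu> x *\<^sub>R grad D v x) (grad D v)"
    using l2_inner_weight_mono[OF vL(2) visc_bounds(1) Bn, of "\<lambda>_. 1" N] vL(2) visc_bounds(3)
    by (simp add: N_def X_def)
  have wm: "w k \<in> borel_measurable (lebesgue_on D)" if "k \<in> {1..J}" for k
    using L2_spaceD(1)[OF H10_space_L2(1)[OF wH[OF that]]] .
  have "\<forall>k\<in>{1..J}. ens_fluct J u k n \<in> borel_measurable (lebesgue_on D)"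
    "\<forall>k\<in>{1..J}. \<exists>B. AE x in lebesgue_on D. norm (ens_fluct J u k n x) \<le> B"
    using wm wB unfolding w_def by blast+
  note eddy = eddy_viscosity_bounds[OF this pos(2,1)]
  obtain Be where "AE x in lebesgue_on D. \<bar>eddy_viscosity J \<mu> \<Delta>t u n x\<bar> \<le> Be" using eddy(2) by blast
  then have Be: "AE x in lebesgue_on D. \<bar>2 * eddy_viscosity J \<mu> \<Delta>t u n x\<bar> \<le> 2 * Be"
    by eventually_elim (simp add: abs_mult)
  have eddy_diffusion: "2 * (\<mu> * \<Delta>t) * W\<^sup>2 \<le> l2_inner D (\<lambda>x. (2 * eddy_viscosity J \<mu> \<Delta>t u n x) *\<^sub>R grad D v x) (grad D v)"
    unfolding W_def
  proof (rule l2_inner_weight_mono[OF vL(2) _ Be])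
    show "(\<lambda>x. 2 * eddy_viscosity J \<mu> \<Delta>t u n x) \<in> borel_measurable (lebesgue_on D)"
      using eddy(1) by (intro borel_measurable_times) auto
    show "(\<lambda>x. norm (w j x) *\<^sub>R grad D v x) \<in> L2_space D"
      by (rule convect_L2(2)[OF wm[OF j] B(3) vH])
    show "AE x in lebesgue_on D. 2 * (\<mu> * \<Delta>t) * (norm (w j x))\<^sup>2 \<le> 2 * eddy_viscosity J \<mu> \<Delta>t u n x"
      using eddy(3)[OF j] by (intro AE_I2) (simp add: w_def mult.assoc)
  qed
  have force: "f j (real (Suc n) * \<Delta>t) v \<le> F * X"
    unfolding F_def X_def by (rule Hm1_bound[OF f vH])
  have convection: "- bstar D (w j) y v \<le> W * l2_norm D y + 1/2 * d * l2_norm D v * l2_norm D y"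
    unfolding W_def d_def by (rule bstar_bound[OF D(1,4) wY B(3) divB yH B(2) vH B(1)])
  have fluctuation: "- l2_inner D (\<lambda>x. nu_fluct J \<nu> j x *\<^sub>R grad D y x) (grad D v) \<le> (N - a) * X * Y"
  proof -
    have m: "nu_fluct J \<nu> j \<in> borel_measurable (lebesgue_on D)" using fluct by (simp add: Linf_space_def)
    have b: "AE x in lebesgue_on D. \<bar>nu_fluct J \<nu> j x\<bar> \<le> N - a"
      using AE_le_linf_norm[OF fluct] by (simp add: aN)
    have "- l2_inner D (\<lambda>x. nu_fluct J \<nu> j x *\<^sub>R grad D y x) (grad D v)
        \<le> l2_norm D (\<lambda>x. nu_fluct J \<nu> j x *\<^sub>R grad D y x) * X"
      using l2_Cauchy_Schwarz[OF L2_scaleR_bounded[OF yL(2) m b] vL(2)] unfolding X_def by linarith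
    also have "\<dots> \<le> (N - a) * Y * X"
      unfolding Y_def using Na by (intro mult_right_mono l2_norm_scaleR_le[OF yL(2) m b]) (auto simp: X_def)
    finally show ?thesis by (simp add: mult.commute mult.left_commute)
  qed
  have "l2_inner D (\<lambda>x. (v x - ut j n x) /\<^sub>R \<Delta>t) v + bstar D (ens_mean J u n) v v
        + l2_inner D (\<lambda>x. nu_bar J \<nu> x *\<^sub>R grad D v x) (grad D v)
        + \<gamma> * l2_inner D (wdiv D v) (wdiv D v)
        + l2_inner D (\<lambda>x. (2 * eddy_viscosity J \<mu> \<Delta>t u n x) *\<^sub>R grad D v x) (grad D v)
        = f j (real (Suc n) * \<Delta>t) v - bstar D (w j) y v
        - l2_inner D (\<lambda>x. nu_fluct J \<nu> j x *\<^sub>R grad D y x) (grad D v)"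
    using step vX unfolding spp_eev_step1_def v_def y_def w_def by blast
  \<comment> \<open>With equal last arguments the skew-symmetric form subtracts a term from itself,
    so convection by the mean contributes nothing.\<close>
  moreover have "bstar D (ens_mean J u n) v v = 0" by (simp add: bstar_def)
  moreover define E where "E = ((l2_norm D v)\<^sup>2 - (l2_norm D (ut j n))\<^sup>2) / (2 * \<Delta>t)"
  ultimately have "E + N * X\<^sup>2
      + \<gamma> * (l2_norm D (wdiv D v))\<^sup>2 + 2 * (\<mu> * \<Delta>t) * W\<^sup>2
      \<le> F * X + (W * l2_norm D y + 1/2 * d * l2_norm D v * l2_norm D y) + (N - a) * X * Y"
    using time diffusion eddy_diffusion force convection fluctuation by (simp add: l2_inner_self)
  from mult_left_mono[OF this, of "2 * \<Delta>t"] pos(1)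
  have "2 * \<Delta>t * E + 2 * \<Delta>t * (N * X\<^sup>2)
      + 2 * \<gamma> * \<Delta>t * (l2_norm D (wdiv D v))\<^sup>2 + \<Delta>t * (4 * (\<mu> * \<Delta>t) * W\<^sup>2)
      \<le> \<Delta>t * (2 * F * X + 2 * W * l2_norm D y + d * l2_norm D v * l2_norm D y + 2 * (N - a) * X * Y)"
    by (simp add: algebra_simps)
  moreover have "2 * \<Delta>t * E = (l2_norm D v)\<^sup>2 - (l2_norm D (ut j n))\<^sup>2"
    using pos(1) by (simp add: E_def)
  ultimately have balance: "(l2_norm D v)\<^sup>2 - (l2_norm D (ut j n))\<^sup>2 + 2 * \<Delta>t * (N * X\<^sup>2)
      + 2 * \<gamma> * \<Delta>t * (l2_norm D (wdiv D v))\<^sup>2 + \<Delta>t * (4 * (\<mu> * \<Delta>t) * W\<^sup>2)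
      \<le> \<Delta>t * (2 * F * X + 2 * W * l2_norm D y + d * l2_norm D v * l2_norm D y + 2 * (N - a) * X * Y)"
    by simp
  \<comment> \<open>Here m = \<mu> \<Delta>t and P = 2R. The W^2 term cancels against the eddy
    dissipation, and N X^2 uses one half of the viscous dissipation.\<close>
  have "2 * F * X + 2 * W * l2_norm D y + d * l2_norm D v * l2_norm D y + 2 * (N - a) * X * Y
    \<le> N * X\<^sup>2 + N * Y\<^sup>2 + 2 / a * F\<^sup>2 + 4 * (\<mu> * \<Delta>t) * W\<^sup>2"
    by (rule energy_algebra[OF a0 Na d0 dP mP])
       (use R(2) poinc[OF vH] poinc[OF yH] in \<open>simp_all add: X_def Y_def W_def\<close>)
  from mult_left_mono[OF this, of \<Delta>t] pos(1) balance
  have "(l2_norm D v)\<^sup>2 + N * \<Delta>t * X\<^sup>2 + 2 * \<gamma> * \<Delta>t * (l2_norm D (wdiv D v))\<^sup>2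
      \<le> (l2_norm D (ut j n))\<^sup>2 + N * \<Delta>t * Y\<^sup>2 + 2 * \<Delta>t / a * F\<^sup>2"
    by (simp add: algebra_simps)
  then show ?thesis
    by (simp only: v_def y_def a_def N_def X_def Y_def F_def)
qed

theorem lemma4p1:
  fixes D :: "(real^'n) set"
  assumes dim: "CARD('n) = 2 \<or> CARD('n) = 3"
    and domain: "convex_polytopal_domain D"
  shows "\<exists>C1>0. \<exists>C2>0. C1\<^sup>2 * C2 \<ge> 1 \<and>
    (\<forall>(h::real) (\<sigma>::real) (c::real) (\<beta>::real) \<T> Xh Yh Qh (J::nat) \<nu> (M::nat) (\<Delta>t::real) (\<gamma>::real)
        (\<mu>::real) f u ut p.
      \<sigma> > 0 \<and> c > 0 \<and> \<beta> > 0 \<and> fe_discretization D h \<sigma> c \<beta> \<T> Xh Yh Qh \<and>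
      J \<ge> 1 \<and> admissible_viscosities D J \<nu> \<and>
      \<Delta>t > 0 \<and> \<gamma> > 0 \<and> \<mu> > 0 \<and>
      (\<forall>j\<in>{1..J}. f j \<in> Linf_time_Hm1 D (real M * \<Delta>t) \<and>
         (\<forall>n\<in>{1..M}. f j (real n * \<Delta>t) \<in> Hm1_space D) \<and>
         u j 0 \<in> Vh_space D Xh Qh) \<and>
      spp_eev_solution D Xh Yh Qh J M \<Delta>t \<nu> \<gamma> \<mu> f u ut p \<and>
      (\<forall>j\<in>{1..J}. \<forall>n<M.
         alpha D J \<nu> j > C1 * linf_norm D (wdiv D (ens_fluct J u j n)) \<and>
         \<mu> \<ge> alpha D J \<nu> j /
               (\<Delta>t * (C2 * (alpha D J \<nu> j)\<^sup>2 - (linf_norm D (wdiv D (ens_fluct J u j n)))\<^sup>2)))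
      \<longrightarrow>
      (\<forall>j\<in>{1..J}.
         (l2_norm D (u j M))\<^sup>2 + nu_bar_min D J \<nu> * \<Delta>t * (l2_norm D (grad D (u j M)))\<^sup>2
           + 2 * \<gamma> * \<Delta>t * (\<Sum>n=1..M. (l2_norm D (wdiv D (u j n)))\<^sup>2)
         \<le> (l2_norm D (u j 0))\<^sup>2 + nu_bar_min D J \<nu> * \<Delta>t * (l2_norm D (grad D (u j 0)))\<^sup>2
           + 2 * \<Delta>t / alpha D J \<nu> j * (\<Sum>n=1..M. (hm1_norm D (f j (real n * \<Delta>t)))\<^sup>2)))"
proof -
  obtain R0 where R0: "\<And>x. x \<in> D \<Longrightarrow> norm x \<le> R0"
    using polytopal_domain_facts(2)[OF domain] by (auto simp: bounded_iff)
  \<comment> \<open>The maximum with 1 makes the constants positive and gives C1^2 C2 = 8 R^2 \<ge>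
    1.\<close>
  define R where "R = max 1 R0"
  have R: "\<And>x. x \<in> D \<Longrightarrow> norm x \<le> R" "R \<ge> 1" using R0 by (fastforce simp: R_def)+
  have C: "(2 * R)\<^sup>2 > 0" "2 / (2 * R)\<^sup>2 > 0" using R(2) by auto
  have "1 \<le> R\<^sup>2" using R(2) by simp
  then have C': "((2 * R)\<^sup>2)\<^sup>2 * (2 / (2 * R)\<^sup>2) \<ge> 1"
    using R(2) by (simp add: power2_eq_square)
  show ?thesis
  proof (rule exI[of _ "(2 * R)\<^sup>2"], intro conjI C(1), rule exI[of _ "2 / (2 * R)\<^sup>2"],
      intro conjI C(2) C' allI impI ballI)
    fix h \<sigma> c \<beta> :: real and \<T> and Xh Yh :: "(real^'n \<Rightarrow> real^'n) set" and Qh J \<nu>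
      and M :: nat and \<Delta>t \<gamma> \<mu> :: real and f and u ut :: "nat \<Rightarrow> nat \<Rightarrow> real^'n \<Rightarrow> real^'n" and p j
    assume asm: "\<sigma> > 0 \<and> c > 0 \<and> \<beta> > 0 \<and> fe_discretization D h \<sigma> c \<beta> \<T> Xh Yh Qh \<and>
      J \<ge> 1 \<and> admissible_viscosities D J \<nu> \<and>
      \<Delta>t > 0 \<and> \<gamma> > 0 \<and> \<mu> > 0 \<and>
      (\<forall>j\<in>{1..J}. f j \<in> Linf_time_Hm1 D (real M * \<Delta>t) \<and>
         (\<forall>n\<in>{1..M}. f j (real n * \<Delta>t) \<in> Hm1_space D) \<and>
         u j 0 \<in> Vh_space D Xh Qh) \<and>
      spp_eev_solution D Xh Yh Qh J M \<Delta>t \<nu> \<gamma> \<mu> f u ut p \<and>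
      (\<forall>j\<in>{1..J}. \<forall>n<M.
         alpha D J \<nu> j > (2 * R)\<^sup>2 * linf_norm D (wdiv D (ens_fluct J u j n)) \<and>
         \<mu> \<ge> alpha D J \<nu> j /
               (\<Delta>t * (2 / (2 * R)\<^sup>2 * (alpha D J \<nu> j)\<^sup>2 - (linf_norm D (wdiv D (ens_fluct J u j n)))\<^sup>2)))"
      and j: "j \<in> {1..J}"
    then have fe: "fe_discretization D h \<sigma> c \<beta> \<T> Xh Yh Qh" and visc: "admissible_viscosities D J \<nu>" "J \<ge> 1"
      and pos: "\<Delta>t > 0" "\<mu> > 0"
      and f: "\<And>n. n \<in> {1..M} \<Longrightarrow> f j (real n * \<Delta>t) \<in> Hm1_space D"
      and u0: "\<And>k. k \<in> {1..J} \<Longrightarrow> u k 0 \<in> Vh_space D Xh Qh"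
      and sol: "spp_eev_solution D Xh Yh Qh J M \<Delta>t \<nu> \<gamma> \<mu> f u ut p"
      and cond: "\<And>n. n < M \<Longrightarrow> alpha D J \<nu> j > (2 * R)\<^sup>2 * linf_norm D (wdiv D (ens_fluct J u j n))"
         "\<And>n. n < M \<Longrightarrow> \<mu> \<ge> alpha D J \<nu> j /
               (\<Delta>t * (2 / (2 * R)\<^sup>2 * (alpha D J \<nu> j)\<^sup>2 - (linf_norm D (wdiv D (ens_fluct J u j n)))\<^sup>2))"
      by blast+
    have sol1: "\<And>k n. k \<in> {1..J} \<Longrightarrow> n < M \<Longrightarrow> spp_eev_step1 D Xh J \<Delta>t \<nu> \<gamma> \<mu> f u ut k n"
      and sol2: "\<And>n. n < M \<Longrightarrow> spp_eev_step2 D Yh Qh \<Delta>t u ut p j n" and ut0: "ut j 0 = u j 0"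
      using sol j unfolding spp_eev_solution_def by blast+
    have uX: "u k n \<in> Xh" if "k \<in> {1..J}" "n \<le> M" for k n
    proof (cases n)
      case 0
      then show ?thesis using u0[OF that(1)] by (simp add: Vh_space_def)
    next
      case (Suc m)
      then show ?thesis using sol1[OF that(1), of m] that(2) by (simp add: spp_eev_step1_def)
    qed
    have XhH: "Xh \<subseteq> H10_space D" using fe unfolding fe_discretization_def by blast
    have uL: "u j n \<in> L2_space D" if "n \<le> M" for n
      by (rule H10_space_L2(1)[OF subsetD[OF XhH uX[OF j that]]])
    have utL: "ut j n \<in> L2_space D \<and> l2_norm D (ut j n) \<le> l2_norm D (u j n)" if "n \<le> M" for n
    proof (cases n)
      case 0
      then show ?thesis using ut0 uL[of 0] by simp
    next
      case (Suc m)
      then show ?thesis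
        using step2_stability[OF fe pos(1) uL sol2, of m] that by simp
    qed
    \<comment> \<open>The final time M is replaced by m \<le> M for the induction, since the scheme
      and the smallness conditions are available only below the fixed M.\<close>
    have "(l2_norm D (u j m))\<^sup>2 + nu_bar_min D J \<nu> * \<Delta>t * (l2_norm D (grad D (u j m)))\<^sup>2
           + 2 * \<gamma> * \<Delta>t * (\<Sum>n=1..m. (l2_norm D (wdiv D (u j n)))\<^sup>2)
         \<le> (l2_norm D (u j 0))\<^sup>2 + nu_bar_min D J \<nu> * \<Delta>t * (l2_norm D (grad D (u j 0)))\<^sup>2
           + 2 * \<Delta>t / alpha D J \<nu> j * (\<Sum>n=1..m. (hm1_norm D (f j (real n * \<Delta>t)))\<^sup>2)" if "m \<le> M" for m
      using that
    proof (induction m)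
      case 0
      show ?case by simp
    next
      case (Suc m)
      then have m: "m < M" "m \<le> M" by auto
      have sum_Suc: "(\<Sum>n=1..Suc m. g n) = (\<Sum>n=1..m. g n) + g (Suc m)" for g :: "nat \<Rightarrow> real"
        by simp
      \<comment> \<open>The projection does not increase the L2 norm, so the one-step bound links up
        with the energy of \<open>u j m\<close>; at m = 0 the two fields coincide.\<close>
      have "(l2_norm D (ut j m))\<^sup>2 \<le> (l2_norm D (u j m))\<^sup>2"
        using utL[OF m(2)] by (intro power_mono) auto
      moreover have "f j (real (Suc m) * \<Delta>t) \<in> Hm1_space D" using f[of "Suc m"] Suc.prems by simp
      note energy_step[OF domain R fe visc j pos uX[OF _ m(2)] conjunct1[OF utL[OF m(2)]] this
          sol1[OF j m(1)] cond[OF m(1)]]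
      ultimately show ?case
        using Suc.IH[OF m(2)] unfolding sum_Suc distrib_left by linarith
    qed
    then show "(l2_norm D (u j M))\<^sup>2 + nu_bar_min D J \<nu> * \<Delta>t * (l2_norm D (grad D (u j M)))\<^sup>2
           + 2 * \<gamma> * \<Delta>t * (\<Sum>n=1..M. (l2_norm D (wdiv D (u j n)))\<^sup>2)
         \<le> (l2_norm D (u j 0))\<^sup>2 + nu_bar_min D J \<nu> * \<Delta>t * (l2_norm D (grad D (u j 0)))\<^sup>2
           + 2 * \<Delta>t / alpha D J \<nu> j * (\<Sum>n=1..M. (hm1_norm D (f j (real n * \<Delta>t)))\<^sup>2)"
      by simp
  qed
qed

end
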